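(* Consider a sequence of problems indexed by the sample size $n\to\infty$, in which the dimension $d=d_n$, the integer $r=r_n$ with $1\le r\ll d$ (i.e. $r/d\to 0$), and the covariance matrix $\Gamma=\Gamma_n\in\mathbb{R}^{d\times d}$ may depend on $n$. For each $n$, let $Y,Y_1,\dots,Y_n$ be i.i.d. mean zero multivariate Gaussian random vectors in $\mathbb{R}^d$ with covariance matrix $\Gamma$, write $Y=(Y^{(1)},\dots,Y^{(d)})^\top$, and let $\hat\Gamma_n=\frac1n\sum_{k=1}^n Y_kY_k^\top$. Let $U$ and $\hat U$ be the $d\times r$ matrices of leading singular vectors of $\Gamma$ and $\hat\Gamma_n$, respectively. Let $\mathfrak{r}(\Gamma):=\mathrm{trace}(\Gamma)/\sigma_1(\Gamma)$, $\delta_r(\Gamma):=\sigma_r(\Gamma)-\sigma_{r+1}(\Gamma)$ and $\nu(Y):=\max_{1\le i\le d}\sqrt{\mathrm{Var}(Y^{(i)})}$. Assume that $\max\{\mathfrak{r}(\Gamma),\log d\}=o(n)$ and that, for some positive constants $c_1,c_2,c_3$ not depending on $n$, $$\sigma_1(\Gamma)/\sigma_r(\Gamma)\le c_1,\qquad \delta_r(\Gamma)\ge c_2\,\sigma_r(\Gamma)>0,\qquad \|U\|_{2\to\infty}\le c_3\sqrt{r/d}.$$ Then there exists a constant $C>0$ not depending on $n$ such that, for all sufficiently large $n$, with probability at least $1-d^{-2}$, the $r\times r$ orthogonal matrix $W_U$ satisfies $$\|\hat U-UW_U\|_{2\to\infty}\le C\sqrt{\tfrac{\max\{\mathfrak{r}(\Gamma),\log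 d\}}{n}}\left(\tfrac{\nu(Y)\,r}{\sqrt{\sigma_r(\Gamma)}}+\tfrac{\sigma_{r+1}(\Gamma)}{\sigma_r(\Gamma)}\right)+C\left(\tfrac{\max\{\mathfrak{r}(\Gamma),\log d\}}{n}\right)\left(\sqrt{\tfrac{\sigma_{r+1}(\Gamma)}{\sigma_r(\Gamma)}}+\sqrt{\tfrac{r}{d}}\right).$$
   Context: For a real matrix $A$, $\|A\|_{2\to\infty}:=\sup_{\|x\|_2=1}\|Ax\|_\infty$, and $\sigma_1(A)\ge\sigma_2(A)\ge\cdots$ denote its singular values in non-increasing order. The covariance matrix has singular value decomposition $\Gamma=U\Sigma U^\top+U_\perp\Sigma_\perp U_\perp^\top$, where $[U|U_\perp]\in\mathbb{R}^{d\times d}$ is orthogonal, $U\in\mathbb{R}^{d\times r}$, $\Sigma=\mathrm{diag}(\sigma_1(\Gamma),\dots,\sigma_r(\Gamma))$ and $\Sigma_\perp=\mathrm{diag}(\sigma_{r+1}(\Gamma),\dots,\sigma_d(\Gamma))$. Singular values are not assumed distinct. Analogously $\hat\Gamma_n=\hat U\hat\Sigma\hat U^\top+\hat U_\perp\hat\Sigma_\perp\hat U_\perp^\top$, with $\hat\Sigma$ containing the $r$ largest singular values of $\hat\Gamma_n$. $W_U$ denotes the Frobenius-optimal orthogonal Procrustes matrix: if $U^\top\hat U=W_1\Sigma_UW_2^\top$ is a singular value decomposition of the $r\times r$ matrix $U^\top\hat U$, then $W_U:=W_1W_2^\top$ (a minimizer of $\|\hat U-UW\|_{\mathrm F}$ over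 $r\times r$ orthogonal matrices $W$). *)

theory Defs
  imports
    "HOL-Probability.Probability"
    "HOL-Library.Landau_Symbols"
    "Jordan_Normal_Form.Char_Poly"
begin

section \<open>Singular values and singular vectors\<close>

text \<open>The singular values are the square roots of the eigenvalues of \<open>A\<^sup>T A\<close>, repeated
  according to multiplicity. All roots of this characteristic polynomial are real, so the list
  has \<open>dim_col A\<close> entries.\<close>

definition singular_values :: "real mat \<Rightarrow> real list" where
  "singular_values A =
     rev (sorted_list_of_multiset (image_mset sqrt (proots (char_poly (transpose_mat A * A)))))"

text \<open>One-based, as in \<open>\<sigma>\<^sub>1(A) \<ge> \<sigma>\<^sub>2(A) \<ge> \<dots>\<close>; meaningful for \<open>1 \<le> k \<le> dim_col A\<close>.\<close>

definition sing_val :: "real mat \<Rightarrow> nat \<Rightarrow> real" where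
  "sing_val A k = singular_values A ! (k - 1)"

text \<open>The library predicate \<^const>\<open>orthogonal_mat\<close> does not require columns of unit length.\<close>

definition orthogonal_matrix_of_dim :: "nat \<Rightarrow> real mat \<Rightarrow> bool" where
  "orthogonal_matrix_of_dim m Q \<longleftrightarrow>
     Q \<in> carrier_mat m m \<and> transpose_mat Q * Q = 1\<^sub>m m \<and> Q * transpose_mat Q = 1\<^sub>m m"

definition append_cols :: "real mat \<Rightarrow> real mat \<Rightarrow> real mat" where
  "append_cols A B = transpose_mat (transpose_mat A @\<^sub>r transpose_mat B)"

text \<open>\<open>U\<close> is the left block of an orthogonal matrix \<open>[U | V]\<close> (with \<open>V\<close> in the role of
  \<open>U\<^sub>\<bottom>\<close>) for which \<open>S = U \<Sigma> U\<^sup>T + V \<Sigma>\<^sub>\<bottom> V\<^sup>T\<close>, where \<open>S\<close> is a (symmetric positive semidefinite)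
  \<open>d \<times> d\<close> matrix. If singular values coincide, \<open>U\<close> is not unique.\<close>

definition leading_singular_vectors :: "nat \<Rightarrow> nat \<Rightarrow> real mat \<Rightarrow> real mat \<Rightarrow> bool" where
  "leading_singular_vectors d r S U \<longleftrightarrow>
     U \<in> carrier_mat d r \<and>
     (\<exists>V \<in> carrier_mat d (d - r).
        orthogonal_matrix_of_dim d (append_cols U V) \<and>
        S = U * mat_diag r (\<lambda>i. sing_val S (i + 1)) * transpose_mat U
          + V * mat_diag (d - r) (\<lambda>i. sing_val S (r + i + 1)) * transpose_mat V)"

text \<open>\<open>W\<close> is \<open>W\<^sub>1 W\<^sub>2\<^sup>T\<close> for some singular value decomposition \<open>W\<^sub>1 \<Sigma>\<^sub>U W\<^sub>2\<^sup>T\<close> of \<open>U\<^sup>T U'\<close>.\<close>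

definition procrustes_matrix :: "nat \<Rightarrow> real mat \<Rightarrow> real mat \<Rightarrow> real mat \<Rightarrow> bool" where
  "procrustes_matrix r U U' W \<longleftrightarrow>
     (\<exists>W\<^sub>1 W\<^sub>2. orthogonal_matrix_of_dim r W\<^sub>1 \<and> orthogonal_matrix_of_dim r W\<^sub>2 \<and>
        transpose_mat U * U' =
          W\<^sub>1 * mat_diag r (\<lambda>i. sing_val (transpose_mat U * U') (i + 1)) * transpose_mat W\<^sub>2 \<and>
        W = W\<^sub>1 * transpose_mat W\<^sub>2)"

section \<open>Norms and spectral quantities\<close>

definition vec_norm2 :: "real Matrix.vec \<Rightarrow> real" where
  "vec_norm2 x = sqrt (scalar_prod x x)"

definition vec_norm_inf :: "real Matrix.vec \<Rightarrow> real" where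
  "vec_norm_inf x = Max ((\<lambda>i. \<bar>vec_index x i\<bar>) ` {..<dim_vec x})"

definition norm_2_inf :: "real mat \<Rightarrow> real" where
  "norm_2_inf A =
     (SUP x \<in> {x \<in> carrier_vec (dim_col A). vec_norm2 x = 1}. vec_norm_inf (A *\<^sub>v x))"

definition eff_rank :: "real mat \<Rightarrow> real" where
  "eff_rank S = sum_list (diag_mat S) / sing_val S 1"

definition sv_gap :: "real mat \<Rightarrow> nat \<Rightarrow> real" where
  "sv_gap S r = sing_val S r - sing_val S (r + 1)"

section \<open>Gaussian random vectors\<close>

text \<open>A random vector in \<open>\<real>\<^sup>d\<close> is a measurable map into the product of the Borel
  spaces over the index set \<open>{..<d}\<close>.\<close>

definition vec_borel :: "nat \<Rightarrow> (nat \<Rightarrow> real) measure" where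
  "vec_borel d = Pi\<^sub>M {..<d} (\<lambda>_. borel)"

text \<open>Point masses count as (degenerate) Gaussian laws, so that the covariance matrix of a
  Gaussian vector may be singular.\<close>

definition gaussian_var :: "'a measure \<Rightarrow> ('a \<Rightarrow> real) \<Rightarrow> bool" where
  "gaussian_var M X \<longleftrightarrow>
     (\<exists>\<mu> s. s > 0 \<and> distributed M lborel X (\<lambda>x. ennreal (normal_density \<mu> s x))) \<or>
     (X \<in> borel_measurable M \<and> (\<exists>\<mu>. AE \<omega> in M. X \<omega> = \<mu>))"

definition gaussian_vector :: "'a measure \<Rightarrow> nat \<Rightarrow> ('a \<Rightarrow> nat \<Rightarrow> real) \<Rightarrow> bool" where
  "gaussian_vector M d X \<longleftrightarrow>
     X \<in> measurable M (vec_borel d) \<and>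
     (\<forall>a :: nat \<Rightarrow> real. gaussian_var M (\<lambda>\<omega>. \<Sum>i<d. a i * X \<omega> i))"

definition covariance_matrix :: "'a measure \<Rightarrow> nat \<Rightarrow> ('a \<Rightarrow> nat \<Rightarrow> real) \<Rightarrow> real mat" where
  "covariance_matrix M d X =
     Matrix.mat d d (\<lambda>(i, j).
       prob_space.expectation M (\<lambda>\<omega>.
         (X \<omega> i - prob_space.expectation M (\<lambda>\<omega>. X \<omega> i)) *
         (X \<omega> j - prob_space.expectation M (\<lambda>\<omega>. X \<omega> j))))"

definition max_std :: "'a measure \<Rightarrow> nat \<Rightarrow> ('a \<Rightarrow> nat \<Rightarrow> real) \<Rightarrow> real" where
  "max_std M d X = Max ((\<lambda>i. sqrt (prob_space.variance M (\<lambda>\<omega>. X \<omega> i))) ` {..<d})"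

definition iid_vectors :: "'a measure \<Rightarrow> nat \<Rightarrow> (nat \<Rightarrow> 'a \<Rightarrow> nat \<Rightarrow> real) \<Rightarrow> nat set \<Rightarrow> bool" where
  "iid_vectors M d X I \<longleftrightarrow>
     prob_space.indep_vars M (\<lambda>_. vec_borel d) X I \<and>
     (\<forall>k\<in>I. \<forall>l\<in>I. distr M (vec_borel d) (X k) = distr M (vec_borel d) (X l))"

text \<open>Index \<open>0\<close> holds the generic vector \<open>Y\<close>, indices \<open>1, \<dots>, n\<close> the sample.\<close>

definition gaussian_sample ::
  "'a measure \<Rightarrow> nat \<Rightarrow> real mat \<Rightarrow> nat \<Rightarrow> (nat \<Rightarrow> 'a \<Rightarrow> nat \<Rightarrow> real) \<Rightarrow> bool" where
  "gaussian_sample M d S n Y \<longleftrightarrow>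
     prob_space M \<and>
     iid_vectors M d Y {0..n} \<and>
     gaussian_vector M d (Y 0) \<and>
     (\<forall>i<d. prob_space.expectation M (\<lambda>\<omega>. Y 0 \<omega> i) = 0) \<and>
     covariance_matrix M d (Y 0) = S"

definition sample_cov :: "nat \<Rightarrow> nat \<Rightarrow> (nat \<Rightarrow> 'a \<Rightarrow> nat \<Rightarrow> real) \<Rightarrow> 'a \<Rightarrow> real mat" where
  "sample_cov d n Y \<omega> =
     Matrix.mat d d (\<lambda>(i, j). (1 / real n) * (\<Sum>k=1..n. Y k \<omega> i * Y k \<omega> j))"

end

theory Submission
  imports Defs
begin

text \<open>
  Write \<open>\<sigma>\<^sub>1 \<ge> \<sigma>\<^sub>2 \<ge> \<dots>\<close> for the eigenvalues of \<open>\<Gamma>\<close>, \<open>s = \<sigma>\<^sub>r\<close>, \<open>E\<close> for the difference of the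
  sample covariance and \<open>\<Gamma>\<close>, \<open>\<nu> = \<nu>(Y)\<close> and \<open>m = max (eff_rank \<Gamma>) (ln d)\<close>. It is shown that, up to a
  constant, every row of \<open>Uhat - U W\<close> has Euclidean norm at most \<open>(\<nu> r / sqrt s) * sqrt (m / n)\<close>,
  which is one of the nonnegative summands of the claimed bound. All computations take place in the eigenbasis of \<open>\<Gamma>\<close>,
  where \<open>\<Gamma>\<close> is diagonal and the observations have uncorrelated Gaussian coordinates.

  Deterministic part. The misfit \<open>U\<^sup>T Uhat - W\<close> has Frobenius norm at most that of \<open>sin \<Theta>\<close>, the
  block of \<open>Uhat\<close> outside the range of \<open>U\<close> (\<open>procrustes_misfit\<close>). A row of \<open>U\<close> is small
  because \<open>\<Gamma>\<^sub>i\<^sub>i\<close> dominates \<open>s\<close> times its squared norm, so that its norm is at most \<open>\<nu> / sqrt s\<close>.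
  Let \<open>v\<^sub>i\<close> be the projection of the \<open>i\<close>-th standard basis vector to the complement of \<open>U\<close>. The
  eigenvector equation for \<open>Uhat\<close> expresses the component of row \<open>i\<close> in that complement through \<open>E v\<^sub>i\<close>
  and through \<open>sin \<Theta>\<close> weighted with \<open>\<Gamma> v\<^sub>i\<close> (\<open>row_bound\<close>). Davis and Kahan's argument bounds
  \<open>sin \<Theta>\<close> by the vectors \<open>E u\<^sub>j\<close>, where \<open>u\<^sub>j\<close> are the columns of \<open>U\<close> (\<open>davis_kahan\<close>). Hence \<open>E\<close> enters in
  only two ways: through \<open>E v\<close> for \<open>r + d\<close> vectors \<open>v\<close> that are not random, and through an operator
  norm bound by a small constant times \<open>\<sigma>\<^sub>1\<close>, which by Weyl's inequality keeps the two groups of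
  eigenvalues apart.

  Fixed vectors (\<open>cov_err_concentration\<close>). The squared norm of \<open>E v\<close> is at most a constant
  times \<open>(v\<^sup>T \<Gamma> v) \<sigma>\<^sub>1 m / n\<close>, with failure probability a negative power of \<open>d\<close>. Bounding the
  coordinates one by one would lose a logarithm. Instead each observation is split into its
  regression on \<open>v \<bullet> Y\<close> and a residual that is independent of \<open>v \<bullet> Y\<close>. The regression part is a
  chi-square deviation. Given the values \<open>v \<bullet> Y\<close>, the residual part is a Gaussian vector, and the
  method of mixtures (\<open>norm_tail_from_mixture\<close>) bounds its norm by the trace plus the top
  eigenvalue times the logarithm of the inverse failure probability.

  Operator norm (\<open>operator_norm_concentration\<close>). At most \<open>m / \<theta>\<close> eigenvalues exceed
  \<open>\<theta> \<sigma>\<^sub>1\<close>, which is a small fraction of \<open>n\<close>; on their span a finite net and the chi-square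
  bound suffice. On the remaining space the sample covariance itself is small: its norm is that of a
  form on the sample space of dimension \<open>n\<close>, where another net is used. Neither net depends on \<open>d\<close>,
  which may be exponentially large in \<open>n\<close>.
\<close>

section \<open>Quadratic forms and nets of the Euclidean ball\<close>

definition sqnorm :: "nat \<Rightarrow> (nat \<Rightarrow> real) \<Rightarrow> real" where
  "sqnorm k x = (\<Sum>i<k. (x i)\<^sup>2)"

definition bilin :: "nat \<Rightarrow> (nat \<Rightarrow> nat \<Rightarrow> real) \<Rightarrow> (nat \<Rightarrow> real) \<Rightarrow> (nat \<Rightarrow> real) \<Rightarrow> real" where
  "bilin k B x y = (\<Sum>i<k. \<Sum>j<k. x i * B i j * y j)"

lemma sum_rotate:
  fixes f :: "'a \<Rightarrow> 'b \<Rightarrow> 'c \<Rightarrow> real"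
  shows "(\<Sum>i\<in>A. \<Sum>j\<in>B. \<Sum>k\<in>C. f i j k) = (\<Sum>j\<in>B. \<Sum>k\<in>C. \<Sum>i\<in>A. f i j k)"
  by (subst sum.swap) (intro sum.cong refl sum.swap)

lemma sqnorm_nonneg: "0 \<le> sqnorm k x"
  by (simp add: sqnorm_def sum_nonneg)

lemma sqnorm_scale: "sqnorm k (\<lambda>i. c * x i) = c\<^sup>2 * sqnorm k x"
  by (simp add: sqnorm_def power_mult_distrib sum_distrib_left)

lemma sqnorm_zero: "sqnorm k x = 0 \<Longrightarrow> i < k \<Longrightarrow> x i = 0"
  by (simp add: sqnorm_def sum_nonneg_eq_0_iff)

lemma sum_half_power_abs_le: "(\<Sum>z\<in>{- int R..int R}. (1/2::real) ^ nat \<bar>z\<bar>) \<le> 3 - 2 * (1/2) ^ R"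
proof (induction R)
  case (Suc R)
  have "{- int (Suc R)..int (Suc R)} = insert (- int (Suc R)) (insert (int (Suc R)) {- int R..int R})"
    by auto
  then show ?case using Suc by (simp add: nat_add_distrib)
qed simp

text \<open>The generating function \<open>2 ^ - (\<bar>z\<^sub>1\<bar> + \<dots> + \<bar>z\<^sub>k\<bar>)\<close> is at least \<open>2 ^ - m\<close> on the ball and
  sums to at most \<open>3 ^ k\<close> over the whole lattice.\<close>
lemma card_lattice_ball_le:
  fixes m k :: nat
  defines "Z \<equiv> {z \<in> PiE {..<k} (\<lambda>_. {- int m..int m}). (\<Sum>i<k. (z i)\<^sup>2) \<le> int m}"
  shows "real (card Z) \<le> 2 ^ m * 3 ^ k"
proof -
  let ?P = "PiE {..<k} (\<lambda>_. {- int m..int m})"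
  let ?w = "\<lambda>z. \<Prod>i<k. (1/2::real) ^ nat \<bar>z i\<bar>"
  have fin: "finite ?P" by (intro finite_PiE) auto
  have w: "1 \<le> 2 ^ m * ?w z" if z: "z \<in> Z" for z
  proof -
    have "(\<Sum>i<k. \<bar>z i\<bar>) \<le> (\<Sum>i<k. (z i)\<^sup>2)"
    proof (rule sum_mono)
      fix i
      show "\<bar>z i\<bar> \<le> (z i)\<^sup>2"
        by (cases "z i = 0") (auto simp: power2_eq_square abs_mult_self_eq[symmetric, of "z i"] simp del: abs_mult_self_eq intro: order_trans[OF _ mult_right_mono[of 1]])
    qed
    also have "\<dots> \<le> int m" using z by (simp add: Z_def)
    finally have "(\<Sum>i<k. nat \<bar>z i\<bar>) \<le> m"
      by (metis (mono_tags, lifting) abs_ge_zero int_nat_eq of_nat_le_iff of_nat_sum sum.cong)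
    then have "(1/2::real) ^ m \<le> (1/2) ^ (\<Sum>i<k. nat \<bar>z i\<bar>)"
      by (intro power_decreasing) auto
    then have "2 ^ m * (1/2::real) ^ m \<le> 2 ^ m * ?w z"
      unfolding power_sum by (intro mult_left_mono) simp_all
    moreover have "2 ^ m * (1/2::real) ^ m = 1" by (simp add: power_one_over)
    ultimately show ?thesis by linarith
  qed
  have "real (card Z) = (\<Sum>z\<in>Z. 1)" by simp
  also have "\<dots> \<le> (\<Sum>z\<in>Z. 2 ^ m * ?w z)" by (intro sum_mono w)
  also have "\<dots> \<le> (\<Sum>z\<in>?P. 2 ^ m * ?w z)"
  proof (rule sum_mono2[OF fin])
    show "Z \<subseteq> ?P" unfolding Z_def by (rule Collect_restrict)
    show "0 \<le> 2 ^ m * ?w z" for z by (intro mult_nonneg_nonneg prod_nonneg) simp_all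
  qed
  also have "\<dots> = 2 ^ m * (\<Sum>z\<in>?P. ?w z)" by (simp add: sum_distrib_left)
  also have "(\<Sum>z\<in>?P. ?w z) = (\<Prod>i<k. \<Sum>z\<in>{- int m..int m}. (1/2::real) ^ nat \<bar>z\<bar>)"
    by (subst prod_sum_PiE) auto
  also have "\<dots> \<le> (\<Prod>i<k. 3)"
    by (intro prod_mono conjI sum_nonneg order_trans[OF sum_half_power_abs_le]) auto
  finally show ?thesis by simp
qed

text \<open>The covering number per dimension of the net of radius \<open>1/4\<close> below: the lattice ball with
  \<open>m = 16 k\<close> has at most \<open>2 ^ (16 k) * 3 ^ k\<close> points.\<close>
definition net_const :: real where "net_const = 3 * 2 ^ 16"

text \<open>The scaled integer lattice of mesh \<open>1 / (4 sqrt k)\<close> gives a net that is finite by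
  construction, so that union bounds over it raise no question of measurability.\<close>
lemma ball_net:
  "\<exists>N. finite N \<and> real (card N) \<le> net_const ^ k \<and> (\<forall>y\<in>N. sqnorm k y \<le> 1) \<and>
     (\<forall>x. sqnorm k x \<le> 1 \<longrightarrow> (\<exists>y\<in>N. sqnorm k (\<lambda>i. x i - y i) \<le> 1/16))"
proof (cases "k = 0")
  case True
  then show ?thesis by (intro exI[of _ "{\<lambda>_. 0}"]) (simp add: sqnorm_def)
next
  case False
  then have k: "real k > 0" by simp
  let ?m = "16 * k"
  define c where "c = 4 * sqrt (real k)"
  have c: "c > 0" "c\<^sup>2 = 16 * real k" using k by (auto simp: c_def power_mult_distrib)
  define Z where "Z = {z \<in> PiE {..<k} (\<lambda>_. {- int ?m..int ?m}). (\<Sum>i<k. (z i)\<^sup>2) \<le> int ?m}"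
  have finZ: "finite Z" unfolding Z_def
    by (rule finite_subset[of _ "PiE {..<k} (\<lambda>_. {- int ?m..int ?m})"]) (auto intro: finite_PiE)
  define N where "N = (\<lambda>z i. real_of_int (z i) / c) ` Z"
  have "real (card N) \<le> real (card Z)" unfolding N_def using finZ by (simp add: card_image_le)
  also have "\<dots> \<le> 2 ^ ?m * 3 ^ k" unfolding Z_def by (rule card_lattice_ball_le)
  also have "\<dots> = (2 ^ 16 * 3) ^ k" by (simp only: power_mult power_mult_distrib)
  also have "\<dots> = net_const ^ k" by (simp only: net_const_def mult.commute)
  finally have card: "real (card N) \<le> net_const ^ k" .
  have ball: "sqnorm k y \<le> 1" if yN: "y \<in> N" for y
  proof -
    obtain z where z: "z \<in> Z" "y = (\<lambda>i. real_of_int (z i) / c)" using yN unfolding N_def by blast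
    have "sqnorm k y = real_of_int (\<Sum>i<k. (z i)\<^sup>2) / c\<^sup>2"
      by (simp add: z(2) sqnorm_def power_divide sum_divide_distrib)
    also have "\<dots> \<le> real_of_int (int ?m) / c\<^sup>2"
      using z(1) by (intro divide_right_mono of_int_le_iff[THEN iffD2]) (auto simp: Z_def)
    also have "\<dots> = 1" using c k by simp
    finally show ?thesis .
  qed
  have dense: "\<exists>y\<in>N. sqnorm k (\<lambda>i. x i - y i) \<le> 1/16" if x: "sqnorm k x \<le> 1" for x
  proof -
    \<comment> \<open>Rounding towards zero keeps the lattice point inside the ball.\<close>
    define z where "z i = (if i < k then (if x i \<ge> 0 then \<lfloor>c * x i\<rfloor> else \<lceil>c * x i\<rceil>) else undefined)" for i
    have zle: "\<bar>real_of_int (z i)\<bar> \<le> \<bar>c * x i\<bar>" and zd: "\<bar>c * x i - z i\<bar> \<le> 1" if "i < k" for i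
    proof -
      define t where "t = c * x i"
      have "\<bar>real_of_int (z i)\<bar> \<le> \<bar>t\<bar> \<and> \<bar>t - z i\<bar> \<le> 1"
      proof (cases "x i \<ge> 0")
        case True
        then have "t \<ge> 0" "z i = \<lfloor>t\<rfloor>" using c that by (auto simp: z_def t_def)
        moreover have "0 \<le> \<lfloor>t\<rfloor>" using \<open>t \<ge> 0\<close> by simp
        ultimately show ?thesis by linarith
      next
        case False
        then have "t < 0" "z i = \<lceil>t\<rceil>" using c that by (auto simp: z_def t_def mult_pos_neg)
        moreover have "\<lceil>t\<rceil> \<le> 0" using \<open>t < 0\<close> by (simp add: ceiling_le_iff)
        ultimately show ?thesis by linarith
      qed
      then show "\<bar>real_of_int (z i)\<bar> \<le> \<bar>c * x i\<bar>" "\<bar>c * x i - z i\<bar> \<le> 1"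
        by (auto simp: t_def)
    qed
    have "real_of_int (\<Sum>i<k. (z i)\<^sup>2) = (\<Sum>i<k. (real_of_int (z i))\<^sup>2)" by simp
    also have "\<dots> \<le> (\<Sum>i<k. (c * x i)\<^sup>2)"
      by (intro sum_mono) (use zle in \<open>auto simp: abs_le_square_iff\<close>)
    also have "\<dots> = c\<^sup>2 * sqnorm k x" by (simp add: sqnorm_def power_mult_distrib sum_distrib_left)
    also have "\<dots> \<le> real ?m" using x c k by simp
    finally have sq: "(\<Sum>i<k. (z i)\<^sup>2) \<le> int ?m" by linarith
    have "z i \<in> {- int ?m..int ?m}" if "i < k" for i
    proof -
      have "\<bar>z i\<bar> \<le> (z i)\<^sup>2"
        by (cases "z i = 0") (auto simp: power2_eq_square abs_mult_self_eq[symmetric, of "z i"] simp del: abs_mult_self_eq intro: order_trans[OF _ mult_right_mono[of 1]])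
      also have "(z i)\<^sup>2 \<le> (\<Sum>i<k. (z i)\<^sup>2)" using that by (intro member_le_sum) auto
      finally show ?thesis using sq by auto
    qed
    then have "z \<in> Z" using sq by (auto simp: Z_def PiE_iff extensional_def z_def)
    moreover have "sqnorm k (\<lambda>i. x i - z i / c) \<le> 1/16"
    proof -
      have "sqnorm k (\<lambda>i. x i - z i / c) = (\<Sum>i<k. (c * x i - z i)\<^sup>2) / c\<^sup>2"
        unfolding sqnorm_def sum_divide_distrib power_divide[symmetric]
        using c(1) by (intro sum.cong refl) (simp add: diff_divide_distrib)
      also have "\<dots> \<le> (\<Sum>i<k. 1) / c\<^sup>2"
        by (intro divide_right_mono sum_mono) (use zd in \<open>auto simp: abs_square_le_1\<close>)
      also have "\<dots> = 1/16" using c k by simp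
      finally show ?thesis .
    qed
    ultimately show ?thesis unfolding N_def by (intro bexI[of _ "\<lambda>i. z i / c"]) auto
  qed
  have "finite N" using finZ by (simp add: N_def)
  then show ?thesis using card ball dense by blast
qed

lemma bilin_sym: "(\<And>i j. B i j = B j i) \<Longrightarrow> bilin k B x y = bilin k B y x"
  unfolding bilin_def by (subst sum.swap) (simp add: mult.commute mult.left_commute)

lemma bilin_scale: "bilin k B (\<lambda>i. c * x i) (\<lambda>i. d * y i) = c * d * bilin k B x y"
  by (simp add: bilin_def sum_distrib_left mult_ac)

lemma bilin_add_diff:
  assumes "\<And>i j. B i j = B j i"
  shows "bilin k B (\<lambda>i. x i + y i) (\<lambda>i. x i + y i) - bilin k B (\<lambda>i. x i - y i) (\<lambda>i. x i - y i)
    = 4 * bilin k B x y"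
proof -
  have "bilin k B (\<lambda>i. x i + y i) (\<lambda>i. x i + y i) - bilin k B (\<lambda>i. x i - y i) (\<lambda>i. x i - y i)
    = 2 * bilin k B x y + 2 * bilin k B y x"
    unfolding bilin_def sum_distrib_left sum_subtractf[symmetric] sum.distrib[symmetric]
    by (intro sum.cong refl) (simp add: algebra_simps)
  then show ?thesis using bilin_sym[of B, OF assms, where k=k and x=x and y=y] by linarith
qed

lemma bilin_diff_prod:
  assumes "\<And>i j. B i j = B j i"
  shows "bilin k B x x - bilin k B y y = bilin k B (\<lambda>i. x i - y i) (\<lambda>i. x i + y i)"
proof -
  have "bilin k B (\<lambda>i. x i - y i) (\<lambda>i. x i + y i)
    = bilin k B x x - bilin k B y y + (bilin k B x y - bilin k B y x)"
    unfolding bilin_def sum_subtractf[symmetric] sum.distrib[symmetric]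
    by (intro sum.cong refl) (simp add: algebra_simps)
  then show ?thesis using bilin_sym[of B, OF assms, where k=k and x=x and y=y] by linarith
qed

lemma sqnorm_parallelogram:
  "sqnorm k (\<lambda>i. x i + y i) + sqnorm k (\<lambda>i. x i - y i) = 2 * sqnorm k x + 2 * sqnorm k y"
  unfolding sqnorm_def sum_distrib_left sum.distrib[symmetric]
  by (intro sum.cong refl) (simp add: power2_eq_square algebra_simps)

lemma sqnorm_cauchy_schwarz: "(\<Sum>i<k. x i * y i)\<^sup>2 \<le> sqnorm k x * sqnorm k y"
  unfolding sqnorm_def by (rule Cauchy_Schwarz_ineq_sum)

text \<open>Polarisation bounds the bilinear form by the quadratic form, after scaling both arguments to unit
  length.\<close>
lemma bilin_le_from_form:
  assumes sym: "\<And>i j. B i j = B j i" and S: "\<And>x. \<bar>bilin k B x x\<bar> \<le> S * sqnorm k x"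
  shows "\<bar>bilin k B x y\<bar> \<le> S * sqrt (sqnorm k x) * sqrt (sqnorm k y)"
proof -
  have half: "\<bar>bilin k B u v\<bar> \<le> S * (sqnorm k u + sqnorm k v) / 2" for u v
  proof -
    have "4 * \<bar>bilin k B u v\<bar> \<le> S * sqnorm k (\<lambda>i. u i + v i) + S * sqnorm k (\<lambda>i. u i - v i)"
      using bilin_add_diff[of B, OF sym, where k=k and x=u and y=v] S[of "\<lambda>i. u i + v i"] S[of "\<lambda>i. u i - v i"] by linarith
    also have "\<dots> = 2 * S * (sqnorm k u + sqnorm k v)"
      unfolding distrib_left[symmetric] sqnorm_parallelogram by (simp add: algebra_simps)
    finally show ?thesis by simp
  qed
  show ?thesis
  proof (cases "sqnorm k x = 0 \<or> sqnorm k y = 0")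
    case True
    have "bilin k B x y = 0"
      unfolding bilin_def
      by (intro sum.neutral ballI) (use True in \<open>auto dest: sqnorm_zero\<close>)
    then show ?thesis using True by auto
  next
    case False
    define a b where "a = sqrt (sqnorm k x)" and "b = sqrt (sqnorm k y)"
    have ab: "a > 0" "b > 0" "a\<^sup>2 = sqnorm k x" "b\<^sup>2 = sqnorm k y"
      using False sqnorm_nonneg[of k x] sqnorm_nonneg[of k y] by (auto simp: a_def b_def)
    have "\<bar>bilin k B (\<lambda>i. (1/a) * x i) (\<lambda>i. (1/b) * y i)\<bar> \<le> S"
      using half[of "\<lambda>i. (1/a) * x i" "\<lambda>i. (1/b) * y i"] ab False unfolding sqnorm_scale
      by (simp add: power_divide)
    then show ?thesis unfolding bilin_scale using ab
      by (simp add: abs_mult field_simps a_def[symmetric] b_def[symmetric])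
  qed
qed

text \<open>A symmetric form is controlled on the whole ball by its values on the net: replacing a
  point by a net point changes the form by at most half of its supremum.\<close>

lemma form_bound_from_net:
  assumes sym: "\<And>i j. B i j = B j i"
    and net: "\<And>x. sqnorm k x \<le> 1 \<Longrightarrow> \<exists>y\<in>N. sqnorm k (\<lambda>i. x i - y i) \<le> 1/16"
    and ball: "\<And>y. y \<in> N \<Longrightarrow> sqnorm k y \<le> 1"
    and M: "\<And>y. y \<in> N \<Longrightarrow> \<bar>bilin k B y y\<bar> \<le> M"
  shows "\<bar>bilin k B x x\<bar> \<le> 2 * M * sqnorm k x"
proof -
  let ?Q = "{x. sqnorm k x \<le> 1}"
  define S where "S = (SUP x\<in>?Q. \<bar>bilin k B x x\<bar>)"
  have bdd: "bdd_above ((\<lambda>x. \<bar>bilin k B x x\<bar>) ` ?Q)"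
  proof (rule bdd_aboveI2)
    fix x assume "x \<in> ?Q"
    then have x: "\<bar>x i\<bar> \<le> 1" if "i < k" for i
    proof -
      have "(x i)\<^sup>2 \<le> sqnorm k x" unfolding sqnorm_def using that by (intro member_le_sum) auto
      then have "(x i)\<^sup>2 \<le> 1" using \<open>x \<in> ?Q\<close> by simp
      then show ?thesis by (simp only: abs_square_le_1)
    qed
    have "\<bar>bilin k B x x\<bar> \<le> (\<Sum>i<k. \<Sum>j<k. \<bar>x i * B i j * x j\<bar>)"
      unfolding bilin_def by (intro order_trans[OF sum_abs] sum_mono sum_abs)
    also have "\<dots> \<le> (\<Sum>i<k. \<Sum>j<k. \<bar>B i j\<bar>)"
    proof (intro sum_mono)
      fix i j assume "i \<in> {..<k}" "j \<in> {..<k}"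
      then have "\<bar>x i\<bar> * \<bar>x j\<bar> \<le> 1 * 1" by (intro mult_mono x) auto
      then show "\<bar>x i * B i j * x j\<bar> \<le> \<bar>B i j\<bar>"
        using mult_right_mono[of "\<bar>x i\<bar> * \<bar>x j\<bar>" 1 "\<bar>B i j\<bar>"] by (simp add: abs_mult mult_ac)
    qed
    finally show "\<bar>bilin k B x x\<bar> \<le> (\<Sum>i<k. \<Sum>j<k. \<bar>B i j\<bar>)" .
  qed
  have S_upper: "\<bar>bilin k B x x\<bar> \<le> S" if "sqnorm k x \<le> 1" for x
    unfolding S_def using that by (intro cSUP_upper bdd) auto
  have hom: "\<bar>bilin k B x x\<bar> \<le> T * sqnorm k x" if T: "\<And>x. sqnorm k x \<le> 1 \<Longrightarrow> \<bar>bilin k B x x\<bar> \<le> T" for x T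
  proof (cases "sqnorm k x = 0")
    case True
    have "bilin k B x x = 0"
      unfolding bilin_def by (intro sum.neutral ballI) (use True in \<open>auto dest: sqnorm_zero\<close>)
    then show ?thesis using True by simp
  next
    case False
    then have p: "sqnorm k x > 0" using sqnorm_nonneg[of k x] by simp
    let ?a = "1 / sqrt (sqnorm k x)"
    have a2: "?a\<^sup>2 = 1 / sqnorm k x" using p by (simp add: power_divide)
    then have "sqnorm k (\<lambda>i. ?a * x i) \<le> 1" unfolding sqnorm_scale using p by simp
    from T[OF this] have "\<bar>?a * ?a * bilin k B x x\<bar> \<le> T" unfolding bilin_scale .
    then have "\<bar>1 / sqnorm k x * bilin k B x x\<bar> \<le> T" using a2 by (simp add: power2_eq_square)
    then show ?thesis using p by (simp add: abs_mult field_simps)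
  qed
  have S0: "S \<ge> 0" using S_upper[of "\<lambda>_. 0"] by (simp add: sqnorm_def bilin_def)
  \<comment> \<open>With \<open>\<bar>B x x - B y y\<bar> = \<bar>B (x - y) (x + y)\<bar> \<le> S * (1/4) * 2\<close>.\<close>
  have "S \<le> M + S / 2"
    unfolding S_def
  proof (rule cSUP_least)
    show "?Q \<noteq> {}" by (auto simp: sqnorm_def intro!: exI[of _ "\<lambda>_. 0"])
    fix x assume "x \<in> ?Q"
    then have x: "sqnorm k x \<le> 1" by simp
    obtain y where y: "y \<in> N" "sqnorm k (\<lambda>i. x i - y i) \<le> 1/16" using net[OF x] by blast
    have "sqnorm k (\<lambda>i. x i + y i) \<le> 2\<^sup>2"
      using sqnorm_parallelogram[of k x y] sqnorm_nonneg[of k "\<lambda>i. x i - y i"] x ball[OF y(1)] by simp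
    then have "sqrt (sqnorm k (\<lambda>i. x i + y i)) \<le> 2" by (simp add: real_le_lsqrt sqnorm_nonneg)
    moreover have "sqrt (sqnorm k (\<lambda>i. x i - y i)) \<le> 1/4"
      using y(2) by (intro real_le_lsqrt) (auto simp: sqnorm_nonneg power2_eq_square)
    ultimately have "sqrt (sqnorm k (\<lambda>i. x i - y i)) * sqrt (sqnorm k (\<lambda>i. x i + y i)) \<le> (1/4) * 2"
      by (intro mult_mono) (auto simp: sqnorm_nonneg)
    then have "S * (sqrt (sqnorm k (\<lambda>i. x i - y i)) * sqrt (sqnorm k (\<lambda>i. x i + y i))) \<le> S * (1/2)"
      using S0 by (intro mult_left_mono) auto
    moreover have "\<bar>bilin k B (\<lambda>i. x i - y i) (\<lambda>i. x i + y i)\<bar>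
       \<le> S * sqrt (sqnorm k (\<lambda>i. x i - y i)) * sqrt (sqnorm k (\<lambda>i. x i + y i))"
      by (intro bilin_le_from_form sym hom S_upper)
    ultimately show "\<bar>bilin k B x x\<bar> \<le> M + (SUP x\<in>?Q. \<bar>bilin k B x x\<bar>) / 2"
      using bilin_diff_prod[of B, OF sym, where k=k and x=x and y=y] M[OF y(1)] unfolding S_def[symmetric] by linarith
  qed
  then have "\<bar>bilin k B x x\<bar> \<le> 2 * M" if "sqnorm k x \<le> 1" for x using S_upper[OF that] by simp
  then show ?thesis by (rule hom)
qed

section \<open>Independence from characteristic functions\<close>

lemma (in prob_space) exp_markov:
  fixes Z :: "'a \<Rightarrow> real" and a b :: real
  assumes [measurable]: "Z \<in> borel_measurable M" and "0 \<le> b" and b: "(\<integral>\<^sup>+\<omega>. ennreal (exp (Z \<omega>)) \<partial>M) \<le> ennreal b"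
  shows "prob {\<omega> \<in> space M. a \<le> Z \<omega>} \<le> exp (- a) * b"
proof -
  have "emeasure M {\<omega> \<in> space M. a \<le> Z \<omega>} \<le> emeasure M {\<omega> \<in> space M. 1 \<le> ennreal (exp (- a)) * ennreal (exp (Z \<omega>))}"
    by (intro emeasure_mono) (auto simp: ennreal_mult[symmetric] mult_exp_exp simp flip: ennreal_1)
  also have "\<dots> \<le> ennreal (exp (- a)) * (\<integral>\<^sup>+\<omega>. ennreal (exp (Z \<omega>)) * indicator (space M) \<omega> \<partial>M)"
    using nn_integral_Markov_inequality[of "\<lambda>\<omega>. ennreal (exp (Z \<omega>))" "space M" M "ennreal (exp (- a))"] by simp
  also have "\<dots> \<le> ennreal (exp (- a)) * ennreal b"
    using b by (intro mult_left_mono) (simp_all cong: nn_integral_cong)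
  also have "\<dots> = ennreal (exp (- a) * b)" by (simp add: ennreal_mult')
  finally show ?thesis using \<open>0 \<le> b\<close> by (simp add: emeasure_eq_measure)
qed

text \<open>If reweighting by \<open>w\<close> only rescales the characteristic function of \<open>X\<close>, then the reweighted law
  of \<open>X\<close> is the original one by Levy's uniqueness theorem; this is how independence of \<open>w\<close> and
  \<open>X\<close> is detected below.\<close>
lemma (in prob_space) tilted_law_eq_from_char:
  fixes X w :: "'a \<Rightarrow> real"
  assumes [measurable]: "X \<in> borel_measurable M" "w \<in> borel_measurable M"
    and w: "\<And>\<omega>. 0 \<le> w \<omega>" "\<And>\<omega>. w \<omega> \<le> K" and pos: "0 < (\<integral>\<omega>. w \<omega> \<partial>M)"
    and ch: "\<And>t. (CLINT \<omega>|M. w \<omega> *\<^sub>R iexp (t * X \<omega>)) = (\<integral>\<omega>. w \<omega> \<partial>M) *\<^sub>R (CLINT \<omega>|M. iexp (t * X \<omega>))"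
    and [measurable]: "B \<in> sets borel"
  shows "(\<integral>\<omega>. w \<omega> * indicator B (X \<omega>) \<partial>M) = (\<integral>\<omega>. w \<omega> \<partial>M) * (\<integral>\<omega>. indicator B (X \<omega>) \<partial>M)"
proof -
  define c where "c = (\<integral>\<omega>. w \<omega> \<partial>M)"
  have c: "c > 0" using pos by (simp add: c_def)
  have int: "integrable M w"
    by (rule integrable_const_bound[of _ K]) (use w in auto)
  define N where "N = density M (\<lambda>\<omega>. ennreal (w \<omega> / c))"
  have "(\<integral>\<^sup>+\<omega>. ennreal (w \<omega> / c) \<partial>M) = ennreal (\<integral>\<omega>. w \<omega> / c \<partial>M)"
    by (intro nn_integral_eq_integral) (use int w c in auto)
  also have "\<dots> = 1" using c by (simp add: c_def[symmetric])
  finally have "emeasure N (space N) = 1" by (simp add: N_def emeasure_density cong: nn_integral_cong)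
  then interpret N: prob_space N by (rule prob_spaceI)
  have [measurable]: "X \<in> borel_measurable N" by (simp add: N_def)
  have integral_N: "(\<integral>\<omega>. f \<omega> \<partial>N) = (\<integral>\<omega>. w \<omega> *\<^sub>R f \<omega> \<partial>M) /\<^sub>R c"
    if [measurable]: "f \<in> borel_measurable M" for f :: "'a \<Rightarrow> 'b::{banach, second_countable_topology}"
    unfolding N_def using w c by (subst integral_density) (auto simp: divide_inverse mult.commute[of _ "inverse c"] simp flip: scaleR_scaleR)
  have "char (distr N borel X) t = char (distr M borel X) t" for t
    unfolding char_def using c
    by (subst (1 2) integral_distr) (auto simp: integral_N ch c_def[symmetric] simp del: of_real_mult)
  then have "distr N borel X = distr M borel X"
    by (intro Levy_uniqueness) auto
  then have "(\<integral>x. indicator B x \<partial>distr N borel X) = (\<integral>x. indicator B x \<partial>distr M borel X :: real)" by simp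
  then have "(\<integral>\<omega>. indicator B (X \<omega>) \<partial>N) = (\<integral>\<omega>. indicator B (X \<omega>) \<partial>M :: real)"
    by (subst (asm) (1 2) integral_distr) auto
  then show ?thesis using c by (simp add: integral_N c_def[symmetric] field_simps)
qed

text \<open>Kac's theorem: random variables are independent if their joint characteristic function
  factorises. Weighting the law of \<open>X\<close> by \<open>2 + cos (s Y)\<close> or \<open>2 + sin (s Y)\<close> does not change its
  normalised characteristic function, which removes \<open>X\<close>; then the weight \<open>1\<^sub>A(X)\<close> removes \<open>Y\<close>.\<close>

lemma (in prob_space) indep_var_from_char:
  fixes X Y :: "'a \<Rightarrow> real"
  assumes [measurable]: "X \<in> borel_measurable M" "Y \<in> borel_measurable M"
    and joint: "\<And>t s. (CLINT \<omega>|M. iexp (t * X \<omega> + s * Y \<omega>))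
      = (CLINT \<omega>|M. iexp (t * X \<omega>)) * (CLINT \<omega>|M. iexp (s * Y \<omega>))"
  shows "indep_var borel X borel Y"
proof -
  have int[simp, intro]: "integrable M (\<lambda>\<omega>. iexp (f \<omega>))" if [measurable]: "f \<in> borel_measurable M" for f
    by (rule integrable_iexp) auto
  have int_cos: "integrable M (\<lambda>\<omega>. cos (f \<omega>))" "integrable M (\<lambda>\<omega>. sin (f \<omega>))"
    if [measurable]: "f \<in> borel_measurable M" for f :: "'a \<Rightarrow> real"
    by (rule integrable_const_bound[of _ 1]; auto)+
  have joint': "(CLINT \<omega>|M. iexp (t * X \<omega>) * iexp (s * Y \<omega>))
      = (CLINT \<omega>|M. iexp (t * X \<omega>)) * (CLINT \<omega>|M. iexp (s * Y \<omega>))" for t s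
    using joint[of t s] by (simp add: exp_add distrib_left)
  have int2: "integrable M (\<lambda>\<omega>. iexp (t * X \<omega>) * iexp (s * Y \<omega>))" for t s
    using int[of "\<lambda>\<omega>. t * X \<omega> + s * Y \<omega>"] by (simp add: exp_add distrib_left)
  have cos_eq: "complex_of_real (cos y) = (iexp y + iexp (- y)) / 2"
    and sin_eq: "complex_of_real (sin y) = (iexp y - iexp (- y)) / (2 * \<i>)" for y
    by (simp_all add: complex_eq_iff Re_exp Im_exp)
  have half: "(\<integral>\<omega>. indicator A (X \<omega>) * u (s * Y \<omega>) \<partial>M)
       = (\<integral>\<omega>. indicator A (X \<omega>) \<partial>M) * (\<integral>\<omega>. u (s * Y \<omega>) \<partial>M)"
    if A[measurable]: "A \<in> sets borel" and u: "u = cos \<or> u = sin" for A s and u :: "real \<Rightarrow> real"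
  proof -
    have [measurable]: "u \<in> borel_measurable borel" using u by auto
    have ub: "\<bar>u y\<bar> \<le> 1" for y using u by auto
    have intu: "integrable M (\<lambda>\<omega>. u (s * Y \<omega>))" using u int_cos[of "\<lambda>\<omega>. s * Y \<omega>"] by auto
    have w: "(\<integral>\<omega>. 2 + u (s * Y \<omega>) \<partial>M) = 2 + (\<integral>\<omega>. u (s * Y \<omega>) \<partial>M)"
      using intu by (subst Bochner_Integration.integral_add) (auto simp: prob_space)
    have "- 1 \<le> (\<integral>\<omega>. u (s * Y \<omega>) \<partial>M)"
      using integral_mono[of M "\<lambda>_. -1" "\<lambda>\<omega>. u (s * Y \<omega>)"] intu ub by (auto simp: abs_le_iff prob_space minus_le_iff)
    then have pos: "0 < (\<integral>\<omega>. 2 + u (s * Y \<omega>) \<partial>M)" using w by simp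
    have ch: "(CLINT \<omega>|M. (2 + u (s * Y \<omega>)) *\<^sub>R iexp (t * X \<omega>))
      = (\<integral>\<omega>. 2 + u (s * Y \<omega>) \<partial>M) *\<^sub>R (CLINT \<omega>|M. iexp (t * X \<omega>))" for t
    proof -
      have prod: "(CLINT \<omega>|M. complex_of_real (u (s * Y \<omega>)) * iexp (t * X \<omega>))
        = complex_of_real (\<integral>\<omega>. u (s * Y \<omega>) \<partial>M) * (CLINT \<omega>|M. iexp (t * X \<omega>))" (is "?l = ?r")
        and intp: "integrable M (\<lambda>\<omega>. complex_of_real (u (s * Y \<omega>)) * iexp (t * X \<omega>))"
      proof -
        have *: "integrable M (\<lambda>\<omega>. iexp (t * X \<omega>) * iexp (s * Y \<omega>))" "integrable M (\<lambda>\<omega>. iexp (t * X \<omega>) * iexp (- (s * Y \<omega>)))"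
          using int2[of t s] int2[of t "-s"] by simp_all
        have **: "(CLINT \<omega>|M. iexp (t * X \<omega>) * iexp (- (s * Y \<omega>)))
            = (CLINT \<omega>|M. iexp (t * X \<omega>)) * (CLINT \<omega>|M. iexp (- (s * Y \<omega>)))"
          using joint'[of t "-s"] by simp
        have i3: "integrable M (\<lambda>\<omega>. iexp (s * Y \<omega>))" "integrable M (\<lambda>\<omega>. iexp (- (s * Y \<omega>)))" 
          using int[of "\<lambda>\<omega>. s * Y \<omega>"] int[of "\<lambda>\<omega>. - (s * Y \<omega>)"] by simp_all
        consider "u = cos" | "u = sin" using u by auto
        then have "?l = ?r \<and> integrable M (\<lambda>\<omega>. complex_of_real (u (s * Y \<omega>)) * iexp (t * X \<omega>))"
        proof cases
          case 1
          have e: "complex_of_real (u (s * Y \<omega>)) * iexp (t * X \<omega>)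
            = (iexp (t * X \<omega>) * iexp (s * Y \<omega>) + iexp (t * X \<omega>) * iexp (- (s * Y \<omega>))) / 2" for \<omega>
            unfolding 1 cos_eq by (simp add: algebra_simps add_divide_distrib)
          have "?r = (CLINT \<omega>|M. complex_of_real (u (s * Y \<omega>))) * (CLINT \<omega>|M. iexp (t * X \<omega>))"
            by simp
          also have "\<dots> = ((CLINT \<omega>|M. iexp (s * Y \<omega>)) + (CLINT \<omega>|M. iexp (- (s * Y \<omega>)))) / 2 * (CLINT \<omega>|M. iexp (t * X \<omega>))"
            unfolding 1 cos_eq using i3 by (simp del: of_real_mult)
          finally have r: "?r = \<dots>" .
          show ?thesis unfolding r unfolding e using * ** joint'[of t s] by (simp add: algebra_simps add_divide_distrib)
        next
          case 2
          have e: "complex_of_real (u (s * Y \<omega>)) * iexp (t * X \<omega>)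
            = (iexp (t * X \<omega>) * iexp (s * Y \<omega>) - iexp (t * X \<omega>) * iexp (- (s * Y \<omega>))) / (2 * \<i>)" for \<omega>
            unfolding 2 sin_eq by (simp add: algebra_simps diff_divide_distrib)
          have "?r = (CLINT \<omega>|M. complex_of_real (u (s * Y \<omega>))) * (CLINT \<omega>|M. iexp (t * X \<omega>))"
            by simp
          also have "\<dots> = ((CLINT \<omega>|M. iexp (s * Y \<omega>)) - (CLINT \<omega>|M. iexp (- (s * Y \<omega>)))) / (2 * \<i>) * (CLINT \<omega>|M. iexp (t * X \<omega>))"
            unfolding 2 sin_eq using i3 by (simp del: of_real_mult)
          finally have r: "?r = \<dots>" .
          show ?thesis unfolding r unfolding e using * ** joint'[of t s] by (simp add: algebra_simps diff_divide_distrib)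
        qed
        then show "?l = ?r" "integrable M (\<lambda>\<omega>. complex_of_real (u (s * Y \<omega>)) * iexp (t * X \<omega>))" by auto
      qed
      have "(CLINT \<omega>|M. (2 + u (s * Y \<omega>)) *\<^sub>R iexp (t * X \<omega>))
        = (CLINT \<omega>|M. 2 * iexp (t * X \<omega>) + complex_of_real (u (s * Y \<omega>)) * iexp (t * X \<omega>))"
        by (simp add: scaleR_conv_of_real distrib_right)
      also have "\<dots> = 2 * (CLINT \<omega>|M. iexp (t * X \<omega>)) + ?l" for l
        using int[of "\<lambda>\<omega>. t * X \<omega>"] intp by (subst Bochner_Integration.integral_add) simp_all
      finally show ?thesis unfolding w by (simp add: prod scaleR_conv_of_real distrib_right del: of_real_mult)
    qed
    have bd: "0 \<le> 2 + u (s * Y \<omega>)" "2 + u (s * Y \<omega>) \<le> 3" for \<omega> using ub[of "s * Y \<omega>"] by auto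
    have meas: "(\<lambda>\<omega>. 2 + u (s * Y \<omega>)) \<in> borel_measurable M" by measurable
    have "(\<integral>\<omega>. (2 + u (s * Y \<omega>)) * indicator A (X \<omega>) \<partial>M)
        = (\<integral>\<omega>. 2 + u (s * Y \<omega>) \<partial>M) * (\<integral>\<omega>. indicator A (X \<omega>) \<partial>M)"
      by (rule tilted_law_eq_from_char[OF assms(1) meas bd pos ch A])
    moreover have "(\<integral>\<omega>. (2 + u (s * Y \<omega>)) * indicator A (X \<omega>) \<partial>M)
        = 2 * (\<integral>\<omega>. indicator A (X \<omega>) \<partial>M) + (\<integral>\<omega>. indicator A (X \<omega>) * u (s * Y \<omega>) \<partial>M)"
    proof -
      have "integrable M (\<lambda>\<omega>. indicator A (X \<omega>) * u (s * Y \<omega>))"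
        by (rule integrable_const_bound[of _ 1]) (auto simp: indicator_def ub)
      moreover have "integrable M (\<lambda>\<omega>. 2 * indicator A (X \<omega>) :: real)"
        by (rule integrable_const_bound[of _ 2]) (auto simp: indicator_def)
      ultimately have "(\<integral>\<omega>. 2 * indicator A (X \<omega>) + indicator A (X \<omega>) * u (s * Y \<omega>) \<partial>M)
        = (\<integral>\<omega>. 2 * indicator A (X \<omega>) \<partial>M) + (\<integral>\<omega>. indicator A (X \<omega>) * u (s * Y \<omega>) \<partial>M)"
        by (intro Bochner_Integration.integral_add)
      then show ?thesis by (simp add: algebra_simps)
    qed
    ultimately show ?thesis unfolding w by (simp add: algebra_simps)
  qed
  have rect: "(\<integral>\<omega>. indicator A (X \<omega>) * indicator B (Y \<omega>) \<partial>M)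
     = (\<integral>\<omega>. indicator A (X \<omega>) \<partial>M) * (\<integral>\<omega>. indicator B (Y \<omega>) \<partial>M :: real)"
    if [measurable]: "A \<in> sets borel" "B \<in> sets borel" for A B
  proof (cases "(\<integral>\<omega>. indicator A (X \<omega>) \<partial>M) = (0::real)")
    case True
    have "integrable M (\<lambda>\<omega>. indicator A (X \<omega>) :: real)"
      by (rule integrable_const_bound[of _ 1]) (auto simp: indicator_def)
    then have "AE \<omega> in M. indicator A (X \<omega>) = (0::real)"
      using True by (subst (asm) integral_nonneg_eq_0_iff_AE) auto
    then have "(\<integral>\<omega>. indicator A (X \<omega>) * indicator B (Y \<omega>) \<partial>M) = (\<integral>\<omega>. 0 \<partial>M :: real)"
      by (intro integral_cong_AE) auto
    then show ?thesis using True by simp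
  next
    case False
    moreover have "0 \<le> (\<integral>\<omega>. indicator A (X \<omega>) \<partial>M :: real)" by simp
    ultimately have pos: "0 < (\<integral>\<omega>. indicator A (X \<omega>) \<partial>M :: real)" by linarith
    show ?thesis
    proof (rule tilted_law_eq_from_char[OF assms(2) _ _ _ pos])
      fix t
      have i: "integrable M (\<lambda>\<omega>. indicator A (X \<omega>) * cos (t * Y \<omega>))" "integrable M (\<lambda>\<omega>. indicator A (X \<omega>) * sin (t * Y \<omega>))"
        by (rule integrable_const_bound[of _ 1]; auto simp: indicator_def)+
      have e: "indicator A (X \<omega>) *\<^sub>R iexp (t * Y \<omega>)
        = complex_of_real (indicator A (X \<omega>) * cos (t * Y \<omega>)) + \<i> * complex_of_real (indicator A (X \<omega>) * sin (t * Y \<omega>))" for \<omega>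
        by (simp add: complex_eq_iff Re_exp Im_exp)
      have e': "iexp (t * Y \<omega>) = complex_of_real (cos (t * Y \<omega>)) + \<i> * complex_of_real (sin (t * Y \<omega>))" for \<omega>
        by (simp add: complex_eq_iff Re_exp Im_exp)
      have ic: "integrable M (\<lambda>\<omega>. cos (t * Y \<omega>))" "integrable M (\<lambda>\<omega>. sin (t * Y \<omega>))"
        by (auto intro!: int_cos)
      have l: "(CLINT \<omega>|M. indicator A (X \<omega>) *\<^sub>R iexp (t * Y \<omega>))
        = complex_of_real (\<integral>\<omega>. indicator A (X \<omega>) * cos (t * Y \<omega>) \<partial>M) + \<i> * complex_of_real (\<integral>\<omega>. indicator A (X \<omega>) * sin (t * Y \<omega>) \<partial>M)"
        unfolding e using i by (subst Bochner_Integration.integral_add) (simp_all del: of_real_mult)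
      have r: "(CLINT \<omega>|M. iexp (t * Y \<omega>))
        = complex_of_real (\<integral>\<omega>. cos (t * Y \<omega>) \<partial>M) + \<i> * complex_of_real (\<integral>\<omega>. sin (t * Y \<omega>) \<partial>M)"
        unfolding e' using ic by (subst Bochner_Integration.integral_add) simp_all
      show "(CLINT \<omega>|M. indicator A (X \<omega>) *\<^sub>R iexp (t * Y \<omega>))
        = (\<integral>\<omega>. indicator A (X \<omega>) \<partial>M) *\<^sub>R (CLINT \<omega>|M. iexp (t * Y \<omega>))"
        unfolding l r by (simp add: half scaleR_conv_of_real distrib_left mult_ac)
    qed (auto simp: indicator_def)
  qed
  have "distr M borel X \<Otimes>\<^sub>M distr M borel Y = distr M (borel \<Otimes>\<^sub>M borel) (\<lambda>\<omega>. (X \<omega>, Y \<omega>))"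
  proof (rule pair_measure_eqI)
    interpret X: prob_space "distr M borel X" by (rule prob_space_distr) simp
    interpret Y: prob_space "distr M borel Y" by (rule prob_space_distr) simp
    show "sigma_finite_measure (distr M borel X)" "sigma_finite_measure (distr M borel Y)" by unfold_locales
    show "sets (distr M borel X \<Otimes>\<^sub>M distr M borel Y) = sets (distr M (borel \<Otimes>\<^sub>M borel) (\<lambda>\<omega>. (X \<omega>, Y \<omega>)))"
      by (simp add: sets_pair_measure_cong[OF sets_distr sets_distr])
    fix A B assume "A \<in> sets (distr M borel X)" "B \<in> sets (distr M borel Y)"
    then have [measurable]: "A \<in> sets borel" "B \<in> sets borel" by simp_all
    have int_prob: "(\<integral>\<omega>. f \<omega> \<partial>M) = prob S"
      if "S \<in> sets M" "\<And>\<omega>. \<omega> \<in> space M \<Longrightarrow> f \<omega> = indicator S \<omega>" for S and f :: "'a \<Rightarrow> real"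
      using Bochner_Integration.integral_cong[OF refl that(2), of M] that(1) by (simp add: sets.Int_space_eq2)
    have ind: "(\<integral>\<omega>. indicator A (X \<omega>) \<partial>M :: real) = prob (X -` A \<inter> space M)"
      by (rule int_prob) (auto simp: indicator_def)
    have ind2: "(\<integral>\<omega>. indicator B (Y \<omega>) \<partial>M :: real) = prob (Y -` B \<inter> space M)"
      by (rule int_prob) (auto simp: indicator_def)
    have ind3: "(\<integral>\<omega>. indicator A (X \<omega>) * indicator B (Y \<omega>) \<partial>M :: real) = prob ((\<lambda>\<omega>. (X \<omega>, Y \<omega>)) -` (A \<times> B) \<inter> space M)"
      by (rule int_prob, measurable) (auto simp: indicator_def)
    show "emeasure (distr M borel X) A * emeasure (distr M borel Y) B = emeasure (distr M (borel \<Otimes>\<^sub>M borel) (\<lambda>\<omega>. (X \<omega>, Y \<omega>))) (A \<times> B)"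
      using rect[of A B] unfolding ind ind2 ind3 by (simp add: emeasure_distr emeasure_eq_measure ennreal_mult'')
  qed
  then show ?thesis unfolding indep_var_distribution_eq by simp
qed

section \<open>Centred Gaussian variables and norms of Gaussian vectors\<close>

text \<open>Variance \<open>0\<close> stands for the point mass at \<open>0\<close>, so that linear functionals of a vector with a
  singular covariance matrix are covered.\<close>
definition centered_gaussian :: "'a measure \<Rightarrow> ('a \<Rightarrow> real) \<Rightarrow> real \<Rightarrow> bool" where
  "centered_gaussian M T c \<longleftrightarrow>
     (c > 0 \<and> distributed M lborel T (\<lambda>x. ennreal (normal_density 0 (sqrt c) x))) \<or>
     (c = 0 \<and> T \<in> borel_measurable M \<and> (AE \<omega> in M. T \<omega> = 0))"

lemma centered_gaussian_measurable[measurable_dest]: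
  "centered_gaussian M T c \<Longrightarrow> T \<in> borel_measurable M"
  by (auto simp: centered_gaussian_def dest: distributed_measurable)

lemma centered_gaussian_nonneg: "centered_gaussian M T c \<Longrightarrow> 0 \<le> c"
  by (auto simp: centered_gaussian_def)

lemma nn_integral_normal_density: "0 < s \<Longrightarrow> (\<integral>\<^sup>+x. ennreal (normal_density \<mu> s x) \<partial>lborel) = 1"
  using prob_space.emeasure_space_1[OF prob_space_normal_density, of s \<mu>]
  by (simp add: emeasure_density)

lemma centered_gaussian_nn_integral:
  assumes T: "centered_gaussian M T c" and c: "c > 0" and f: "f \<in> borel_measurable borel"
  shows "(\<integral>\<^sup>+\<omega>. f (T \<omega>) \<partial>M) = (\<integral>\<^sup>+x. ennreal (normal_density 0 (sqrt c) x) * f x \<partial>lborel)"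
  using distributed_nn_integral[of M lborel T "\<lambda>x. ennreal (normal_density 0 (sqrt c) x)" f] T c f
  by (auto simp: centered_gaussian_def)

text \<open>Completing the square. It reduces the exponential moments below to the total mass of a normal
  density.\<close>

lemma normal_density_exp_quadratic:
  fixes c s \<theta> x :: real
  assumes c: "c > 0" and s: "2 * s * c < 1"
  defines "q \<equiv> 1 - 2 * s * c"
  shows "normal_density 0 (sqrt c) x * exp (s * x\<^sup>2 + \<theta> * x)
    = exp (c * \<theta>\<^sup>2 / (2 * q)) / sqrt q * normal_density (c * \<theta> / q) (sqrt (c / q)) x"
proof -
  have q: "q > 0" using s by (simp add: q_def)
  have "- x\<^sup>2 / (2 * c) + (s * x\<^sup>2 + \<theta> * x)
     = c * \<theta>\<^sup>2 / (2 * q) + - (x - c * \<theta> / q)\<^sup>2 / (2 * (c / q))"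
  proof -
    have "c * \<theta>\<^sup>2 / (2 * q) + - (x - c * \<theta> / q)\<^sup>2 / (2 * (c / q))
      = - (q * x\<^sup>2) / (2 * c) + \<theta> * x"
      using c q by (simp add: field_simps power2_eq_square)
    also have "\<dots> = - x\<^sup>2 / (2 * c) + (s * x\<^sup>2 + \<theta> * x)"
      using c by (simp add: q_def field_simps)
    finally show ?thesis by simp
  qed
  then have "exp (- x\<^sup>2 / (2 * c)) * exp (s * x\<^sup>2 + \<theta> * x)
     = exp (c * \<theta>\<^sup>2 / (2 * q)) * exp (- (x - c * \<theta> / q)\<^sup>2 / (2 * (c / q)))"
    by (simp only: mult_exp_exp)
  moreover have "1 / sqrt (2 * pi * c) = 1 / sqrt q * (1 / sqrt (2 * pi * (c / q)))"
    using c q by (simp add: real_sqrt_mult real_sqrt_divide)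
  moreover have "(sqrt c)\<^sup>2 = c" "(sqrt (c / q))\<^sup>2 = c / q" using c q by auto
  ultimately show ?thesis
    unfolding normal_density_def by (simp only: diff_zero) (simp only: mult_ac times_divide_eq_right times_divide_eq_left mult_1_left mult_1_right)
qed

lemma centered_gaussian_exp_quadratic:
  assumes "prob_space M" and T: "centered_gaussian M T c" and s: "2 * s * c < 1"
  shows "(\<integral>\<^sup>+\<omega>. ennreal (exp (s * (T \<omega>)\<^sup>2 + \<theta> * T \<omega>)) \<partial>M)
    = ennreal (exp (c * \<theta>\<^sup>2 / (2 * (1 - 2 * s * c))) / sqrt (1 - 2 * s * c))"
proof -
  interpret prob_space M by fact
  show ?thesis
  proof (cases "c = 0")
    case True
    then have "AE \<omega> in M. T \<omega> = 0" using T by (auto simp: centered_gaussian_def)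
    then have "(\<integral>\<^sup>+\<omega>. ennreal (exp (s * (T \<omega>)\<^sup>2 + \<theta> * T \<omega>)) \<partial>M) = (\<integral>\<^sup>+\<omega>. 1 \<partial>M)"
      by (intro nn_integral_cong_AE) auto
    then show ?thesis using True by (simp add: emeasure_space_1)
  next
    case False
    then have c: "c > 0" using centered_gaussian_nonneg[OF T] by simp
    define q where "q = 1 - 2 * s * c"
    have q: "q > 0" using s by (simp add: q_def)
    have "(\<integral>\<^sup>+\<omega>. ennreal (exp (s * (T \<omega>)\<^sup>2 + \<theta> * T \<omega>)) \<partial>M)
      = (\<integral>\<^sup>+x. ennreal (normal_density 0 (sqrt c) x * exp (s * x\<^sup>2 + \<theta> * x)) \<partial>lborel)"
      by (subst centered_gaussian_nn_integral[OF T c, of "\<lambda>x. ennreal (exp (s * x\<^sup>2 + \<theta> * x))"]) (auto simp: ennreal_mult)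
    also have "\<dots> = (\<integral>\<^sup>+x. ennreal (exp (c * \<theta>\<^sup>2 / (2 * q)) / sqrt q) * ennreal (normal_density (c * \<theta> / q) (sqrt (c / q)) x) \<partial>lborel)"
      unfolding normal_density_exp_quadratic[OF c s] q_def[symmetric] using q by (simp add: ennreal_mult[symmetric])
    also have "\<dots> = ennreal (exp (c * \<theta>\<^sup>2 / (2 * q)) / sqrt q)"
      using c q by (subst nn_integral_cmult) (auto simp: nn_integral_normal_density)
    finally show ?thesis by (simp add: q_def)
  qed
qed

lemma centered_gaussian_exp_square_le:
  assumes M: "prob_space M" and T: "centered_gaussian M T c" and s: "\<bar>s\<bar> * c \<le> 1/4"
  shows "(\<integral>\<^sup>+\<omega>. ennreal (exp (s * (T \<omega>)\<^sup>2)) \<partial>M) \<le> ennreal (exp (s * c + 4 * s\<^sup>2 * c\<^sup>2))"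
proof -
  define u where "u = 2 * s * c"
  have "\<bar>s * c\<bar> \<le> 1/4" using s centered_gaussian_nonneg[OF T] by (simp add: abs_mult)
  then have u: "\<bar>u\<bar> \<le> 1/2" by (simp add: u_def)
  have ln: "- ln (1 - u) \<le> u + 2 * u\<^sup>2"
  proof (cases "u \<ge> 0")
    case True
    then show ?thesis using ln_one_minus_pos_lower_bound[of u] u by simp
  next
    case False
    then have "- u - u\<^sup>2 \<le> ln (1 - u)" using ln_one_plus_pos_lower_bound[of "-u"] u by simp
    then show ?thesis using zero_le_power2[of u] by linarith
  qed
  have "1 / sqrt (1 - u) = exp (- ln (1 - u) / 2)"
    using u by (simp add: exp_minus ln_sqrt[symmetric] inverse_eq_divide)
  also have "\<dots> \<le> exp (s * c + 4 * s\<^sup>2 * c\<^sup>2)"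
    using ln by (simp add: u_def power_mult_distrib)
  finally show ?thesis
    using centered_gaussian_exp_quadratic[OF M T, of s 0] u by (simp add: u_def ennreal_leI)
qed

text \<open>The scale \<open>v\<close> may exceed the variance \<open>c\<close>; this gives one deviation bound for all
  directions in the unit ball, also for those of small or vanishing variance.\<close>
lemma (in prob_space) chi_square_concentration:
  fixes T :: "'i \<Rightarrow> 'a \<Rightarrow> real" and c v t :: real
  assumes K: "finite K" and ind: "indep_vars (\<lambda>_. borel) T K"
    and T: "\<And>k. k \<in> K \<Longrightarrow> centered_gaussian M (T k) c"
    and v: "0 < v" "c \<le> v" and t: "0 \<le> t" "t \<le> 1"
  shows "prob {\<omega> \<in> space M. card K * v * t \<le> \<bar>(\<Sum>k\<in>K. (T k \<omega>)\<^sup>2) - card K * c\<bar>}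
    \<le> 2 * exp (- (card K * t\<^sup>2 / 16))"
proof (cases "K = {}")
  case False
  then obtain k0 where "k0 \<in> K" by auto
  then have c: "0 \<le> c" using T centered_gaussian_nonneg by blast
  have [measurable]: "k \<in> K \<Longrightarrow> T k \<in> borel_measurable M" for k
    by (rule centered_gaussian_measurable[OF T])
  have [measurable]: "(\<lambda>\<omega>. \<Sum>k\<in>K. (T k \<omega>)\<^sup>2) \<in> borel_measurable M"
    by (intro borel_measurable_sum borel_measurable_power) simp
  define n where "n = real (card K)"
  have n: "n \<ge> 0" by (simp add: n_def)
  have side: "prob {\<omega> \<in> space M. n * v * t \<le> e * ((\<Sum>k\<in>K. (T k \<omega>)\<^sup>2) - n * c)} \<le> exp (- (n * t\<^sup>2 / 16))"
    if e: "e = 1 \<or> e = -1" for e :: real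
  proof -
    \<comment> \<open>The sign \<open>e\<close> selects the tail; this Chernoff parameter has \<open>\<bar>s\<bar> * c \<le> 1/8\<close>.\<close>
    define s where "s = e * t / (8 * v)"
    have abs_s: "\<bar>s\<bar> = t / (8 * v)" using e t v by (auto simp: s_def abs_mult)
    have "\<bar>s\<bar> * c \<le> \<bar>s\<bar> * v" using v by (intro mult_left_mono) auto
    also have "\<dots> \<le> 1/4" using abs_s v t by simp
    finally have sc: "\<bar>s\<bar> * c \<le> 1/4" .
    have s2: "4 * s\<^sup>2 * c\<^sup>2 \<le> t\<^sup>2 / 16"
    proof -
      have "(\<bar>s\<bar> * c)\<^sup>2 \<le> (\<bar>s\<bar> * v)\<^sup>2" using v c by (intro power_mono mult_left_mono mult_nonneg_nonneg) auto
      also have "\<bar>s\<bar> * v = t / 8" using abs_s v by simp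
      finally show ?thesis by (simp add: power_mult_distrib power_divide)
    qed
    have "(\<integral>\<^sup>+\<omega>. ennreal (exp (s * ((\<Sum>k\<in>K. (T k \<omega>)\<^sup>2) - n * c))) \<partial>M)
        = (\<integral>\<^sup>+\<omega>. (\<Prod>k\<in>K. ennreal (exp (s * (T k \<omega>)\<^sup>2 - s * c))) \<partial>M)"
      using K by (intro nn_integral_cong)
        (simp add: prod_ennreal exp_sum[symmetric] sum_subtractf sum_distrib_left right_diff_distrib n_def)
    also have "\<dots> = (\<Prod>k\<in>K. \<integral>\<^sup>+\<omega>. ennreal (exp (s * (T k \<omega>)\<^sup>2 - s * c)) \<partial>M)"
      by (intro indep_vars_nn_integral K indep_vars_compose2[OF ind]) auto
    also have "\<dots> \<le> (\<Prod>k\<in>K. ennreal (exp (t\<^sup>2 / 16)))"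
    proof (intro prod_mono_ennreal)
      fix k assume k: "k \<in> K"
      have "(\<integral>\<^sup>+\<omega>. ennreal (exp (s * (T k \<omega>)\<^sup>2 - s * c)) \<partial>M)
        = ennreal (exp (- s * c)) * (\<integral>\<^sup>+\<omega>. ennreal (exp (s * (T k \<omega>)\<^sup>2)) \<partial>M)"
        using k by (subst nn_integral_cmult[symmetric])
          (auto simp: ennreal_mult[symmetric] mult_exp_exp algebra_simps intro!: nn_integral_cong)
      also have "\<dots> \<le> ennreal (exp (- s * c)) * ennreal (exp (s * c + 4 * s\<^sup>2 * c\<^sup>2))"
        by (intro mult_left_mono centered_gaussian_exp_square_le[OF prob_space_axioms T[OF k] sc]) simp
      also have "\<dots> = ennreal (exp (4 * s\<^sup>2 * c\<^sup>2))" by (simp add: ennreal_mult[symmetric] mult_exp_exp)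
      also have "\<dots> \<le> ennreal (exp (t\<^sup>2 / 16))" using s2 by (intro ennreal_leI) simp
      finally show "(\<integral>\<^sup>+\<omega>. ennreal (exp (s * (T k \<omega>)\<^sup>2 - s * c)) \<partial>M) \<le> ennreal (exp (t\<^sup>2 / 16))" .
    qed
    also have "\<dots> = ennreal (exp (n * t\<^sup>2 / 16))"
      by (simp add: n_def ennreal_power exp_of_nat_mult[symmetric])
    finally have mgf: "(\<integral>\<^sup>+\<omega>. ennreal (exp (s * ((\<Sum>k\<in>K. (T k \<omega>)\<^sup>2) - n * c))) \<partial>M) \<le> ennreal (exp (n * t\<^sup>2 / 16))" .
    have eq: "{\<omega> \<in> space M. n * v * t \<le> e * ((\<Sum>k\<in>K. (T k \<omega>)\<^sup>2) - n * c)}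
        \<subseteq> {\<omega> \<in> space M. n * t\<^sup>2 / 8 \<le> s * ((\<Sum>k\<in>K. (T k \<omega>)\<^sup>2) - n * c)}"
    proof (intro Collect_mono impI conjI; elim conjE)
      fix \<omega> assume "n * v * t \<le> e * ((\<Sum>k\<in>K. (T k \<omega>)\<^sup>2) - n * c)"
      then have "t / (8 * v) * (n * v * t) \<le> t / (8 * v) * (e * ((\<Sum>k\<in>K. (T k \<omega>)\<^sup>2) - n * c))"
        using t v by (intro mult_left_mono) auto
      moreover have "t / (8 * v) * (n * v * t) = n * t\<^sup>2 / 8" using v by (simp add: power2_eq_square)
      moreover have "t / (8 * v) * (e * ((\<Sum>k\<in>K. (T k \<omega>)\<^sup>2) - n * c)) = s * ((\<Sum>k\<in>K. (T k \<omega>)\<^sup>2) - n * c)"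
        by (simp add: s_def)
      ultimately show "n * t\<^sup>2 / 8 \<le> s * ((\<Sum>k\<in>K. (T k \<omega>)\<^sup>2) - n * c)" by linarith
    qed
    have "prob {\<omega> \<in> space M. n * v * t \<le> e * ((\<Sum>k\<in>K. (T k \<omega>)\<^sup>2) - n * c)}
       \<le> prob {\<omega> \<in> space M. n * t\<^sup>2 / 8 \<le> s * ((\<Sum>k\<in>K. (T k \<omega>)\<^sup>2) - n * c)}"
      by (intro finite_measure_mono eq) measurable
    also have "\<dots> \<le> exp (- (n * t\<^sup>2 / 8)) * exp (n * t\<^sup>2 / 16)"
      by (rule exp_markov[OF _ _ mgf]) auto
    also have "\<dots> = exp (- (n * t\<^sup>2 / 16))" by (simp add: mult_exp_exp)
    finally show ?thesis .
  qed
  have "{\<omega> \<in> space M. n * v * t \<le> \<bar>(\<Sum>k\<in>K. (T k \<omega>)\<^sup>2) - n * c\<bar>}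
     \<subseteq> {\<omega> \<in> space M. n * v * t \<le> 1 * ((\<Sum>k\<in>K. (T k \<omega>)\<^sup>2) - n * c)}
       \<union> {\<omega> \<in> space M. n * v * t \<le> (-1) * ((\<Sum>k\<in>K. (T k \<omega>)\<^sup>2) - n * c)}"
    by (auto simp: abs_if split: if_splits)
  then have "prob {\<omega> \<in> space M. n * v * t \<le> \<bar>(\<Sum>k\<in>K. (T k \<omega>)\<^sup>2) - n * c\<bar>}
     \<le> prob ({\<omega> \<in> space M. n * v * t \<le> 1 * ((\<Sum>k\<in>K. (T k \<omega>)\<^sup>2) - n * c)}
       \<union> {\<omega> \<in> space M. n * v * t \<le> (-1) * ((\<Sum>k\<in>K. (T k \<omega>)\<^sup>2) - n * c)})"
    by (intro finite_measure_mono) measurable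
  also have "\<dots> \<le> prob {\<omega> \<in> space M. n * v * t \<le> 1 * ((\<Sum>k\<in>K. (T k \<omega>)\<^sup>2) - n * c)}
       + prob {\<omega> \<in> space M. n * v * t \<le> (-1) * ((\<Sum>k\<in>K. (T k \<omega>)\<^sup>2) - n * c)}"
    by (intro measure_Un_le) measurable
  also have "\<dots> \<le> exp (- (n * t\<^sup>2 / 16)) + exp (- (n * t\<^sup>2 / 16))"
    by (intro add_mono side) auto
  finally show ?thesis by (simp add: n_def)
qed (use prob_le_1 in \<open>auto intro: order_trans\<close>)

text \<open>Averaging the linear exponential over \<open>g \<sim> N(0, 1/\<tau>)\<close> produces the exponential of a square;
  the quadratic correction at most halves the exponent and costs the factor
  \<open>exp (- \<tau>' / (2 \<tau>))\<close>.\<close>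

lemma mixture_integral_lower:
  fixes x \<tau> \<tau>' :: real
  assumes "0 < \<tau>" "0 \<le> \<tau>'" "\<tau>' \<le> \<tau>"
  shows "ennreal (exp (x\<^sup>2 / (4 * \<tau>) - \<tau>' / (2 * \<tau>)))
    \<le> (\<integral>\<^sup>+g. ennreal (normal_density 0 (sqrt (1/\<tau>)) g) * ennreal (exp (g * x - \<tau>' * g\<^sup>2 / 2)) \<partial>lborel)"
proof -
  define q where "q = 1 - 2 * (- \<tau>' / 2) * (1 / \<tau>)"
  have r: "0 \<le> \<tau>' / \<tau>" "\<tau>' / \<tau> \<le> 1" using assms by auto
  have q3: "q = 1 + \<tau>' / \<tau>" by (simp add: q_def)
  then have q: "1 \<le> q" "q \<le> 2" using r by linarith+
  have cond: "2 * (- \<tau>' / 2) * (1 / \<tau>) < 1" using q q_def by linarith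
  have "(\<integral>\<^sup>+g. ennreal (normal_density 0 (sqrt (1/\<tau>)) g) * ennreal (exp (g * x - \<tau>' * g\<^sup>2 / 2)) \<partial>lborel)
    = (\<integral>\<^sup>+g. ennreal (exp (1 / \<tau> * x\<^sup>2 / (2 * q)) / sqrt q) * ennreal (normal_density (1 / \<tau> * x / q) (sqrt (1 / \<tau> / q)) g) \<partial>lborel)"
  proof (intro nn_integral_cong)
    fix g
    have "normal_density 0 (sqrt (1 / \<tau>)) g * exp (- \<tau>' / 2 * g\<^sup>2 + x * g)
      = exp (1 / \<tau> * x\<^sup>2 / (2 * q)) / sqrt q * normal_density (1 / \<tau> * x / q) (sqrt (1 / \<tau> / q)) g"
      unfolding q_def using assms cond by (intro normal_density_exp_quadratic) simp_all
    then show "ennreal (normal_density 0 (sqrt (1/\<tau>)) g) * ennreal (exp (g * x - \<tau>' * g\<^sup>2 / 2))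
       = ennreal (exp (1 / \<tau> * x\<^sup>2 / (2 * q)) / sqrt q) * ennreal (normal_density (1 / \<tau> * x / q) (sqrt (1 / \<tau> / q)) g)"
      using q by (simp add: ennreal_mult[symmetric] algebra_simps)
  qed
  also have "\<dots> = ennreal (exp (1 / \<tau> * x\<^sup>2 / (2 * q)) / sqrt q)"
    using assms q by (subst nn_integral_cmult, simp, subst nn_integral_normal_density) auto
  finally have eq: "(\<integral>\<^sup>+g. ennreal (normal_density 0 (sqrt (1/\<tau>)) g) * ennreal (exp (g * x - \<tau>' * g\<^sup>2 / 2)) \<partial>lborel)
    = ennreal (exp (1 / \<tau> * x\<^sup>2 / (2 * q)) / sqrt q)" .
  have "sqrt q \<le> sqrt (exp (\<tau>' / \<tau>))"
    using exp_ge_add_one_self[of "\<tau>' / \<tau>"] q3 by simp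
  also have "\<dots> = exp (\<tau>' / (2 * \<tau>))"
    by (rule real_sqrt_unique) (simp_all add: power2_eq_square mult_exp_exp)
  finally have "exp (- (\<tau>' / (2 * \<tau>))) \<le> 1 / sqrt q"
    using q by (simp add: exp_minus field_simps)
  moreover have "exp (x\<^sup>2 / (4 * \<tau>)) \<le> exp (1 / \<tau> * x\<^sup>2 / (2 * q))"
  proof -
    have "x\<^sup>2 / \<tau> / 4 \<le> x\<^sup>2 / \<tau> / (2 * q)" using q assms by (intro divide_left_mono) auto
    then show ?thesis by simp
  qed
  ultimately have "exp (x\<^sup>2 / (4 * \<tau>)) * exp (- (\<tau>' / (2 * \<tau>))) \<le> exp (1 / \<tau> * x\<^sup>2 / (2 * q)) * (1 / sqrt q)"
    by (intro mult_mono) auto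
  then show ?thesis unfolding eq by (intro ennreal_leI) (simp add: mult_exp_exp)
qed

text \<open>The hypothesis on \<open>g\<close> holds, for instance, if on \<open>B\<close> the vector \<open>X\<close> is conditionally Gaussian with
  covariance at most \<open>diag v\<close>. Averaging it over independent \<open>g j \<sim> N(0, 1/\<tau>)\<close> controls the
  exponential of the squared norm of \<open>X\<close>. The deviation \<open>t\<close> is then multiplied by the largest
  variance \<open>\<tau>\<close> alone and not by the trace, as it would be in a union bound over coordinates.\<close>
lemma (in prob_space) norm_tail_from_mixture:
  fixes X :: "'b \<Rightarrow> 'a \<Rightarrow> real" and v :: "'b \<Rightarrow> real" and \<tau> t :: real
  assumes J: "finite J" and X: "\<And>j. j \<in> J \<Longrightarrow> X j \<in> borel_measurable M"
    and B[measurable]: "B \<in> sets M" and \<tau>: "0 < \<tau>" and v: "\<And>j. j \<in> J \<Longrightarrow> 0 \<le> v j \<and> v j \<le> \<tau>"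
    and mgf: "\<And>g. (\<integral>\<^sup>+\<omega>. indicator B \<omega> * ennreal (exp (\<Sum>j\<in>J. g j * X j \<omega> - v j * (g j)\<^sup>2 / 2)) \<partial>M) \<le> 1"
  shows "prob {\<omega> \<in> space M. \<omega> \<in> B \<and> 2 * (\<Sum>j\<in>J. v j) + 4 * \<tau> * t \<le> (\<Sum>j\<in>J. (X j \<omega>)\<^sup>2)} \<le> exp (- t)"
proof -
  note [measurable] = X
  \<comment> \<open>The mixing law: independent coordinates of variance \<open>1/\<tau>\<close>.\<close>
  define G where "G = (\<lambda>_::'b. density lborel (\<lambda>x. ennreal (normal_density 0 (sqrt (1/\<tau>)) x)))"
  have G1: "prob_space (G j)" for j unfolding G_def using \<tau> by (intro prob_space_normal_density) auto
  interpret G: product_prob_space G J using G1 by (intro product_prob_spaceI)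
  interpret P: prob_space "Pi\<^sub>M J G" using G1 by (intro prob_space_PiM)
  interpret Q: pair_sigma_finite M "Pi\<^sub>M J G" by unfold_locales
  have [measurable_cong, simp]: "sets (G j) = sets borel" for j by (simp add: G_def)
  let ?F = "\<lambda>\<omega> g. indicator B \<omega> * ennreal (exp (\<Sum>j\<in>J. g j * X j \<omega> - v j * (g j)\<^sup>2 / 2))"
  have meas[measurable]: "case_prod ?F \<in> borel_measurable (M \<Otimes>\<^sub>M Pi\<^sub>M J G)" by measurable
  let ?Z = "\<lambda>\<omega>. (\<Sum>j\<in>J. (X j \<omega>)\<^sup>2 / (4 * \<tau>) - v j / (2 * \<tau>))"
  have "(\<integral>\<^sup>+\<omega>. indicator B \<omega> * ennreal (exp (?Z \<omega>)) \<partial>M) \<le> (\<integral>\<^sup>+\<omega>. \<integral>\<^sup>+g. ?F \<omega> g \<partial>Pi\<^sub>M J G \<partial>M)"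
  proof (intro nn_integral_mono)
    fix \<omega> assume \<omega>: "\<omega> \<in> space M"
    have "ennreal (exp (?Z \<omega>)) = (\<Prod>j\<in>J. ennreal (exp ((X j \<omega>)\<^sup>2 / (4 * \<tau>) - v j / (2 * \<tau>))))"
      using J by (simp add: exp_sum prod_ennreal)
    also have "\<dots> \<le> (\<Prod>j\<in>J. \<integral>\<^sup>+g. ennreal (exp (g * X j \<omega> - v j * g\<^sup>2 / 2)) \<partial>G j)"
      unfolding G_def using v \<tau>
      by (intro prod_mono_ennreal) (subst nn_integral_density, auto intro!: mixture_integral_lower)
    also have "\<dots> = (\<integral>\<^sup>+g. (\<Prod>j\<in>J. ennreal (exp (g j * X j \<omega> - v j * (g j)\<^sup>2 / 2))) \<partial>Pi\<^sub>M J G)"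
      using J by (subst G.product_nn_integral_prod) auto
    also have "\<dots> = (\<integral>\<^sup>+g. ennreal (exp (\<Sum>j\<in>J. g j * X j \<omega> - v j * (g j)\<^sup>2 / 2)) \<partial>Pi\<^sub>M J G)"
      using J by (simp add: exp_sum prod_ennreal)
    finally have "indicator B \<omega> * ennreal (exp (?Z \<omega>))
       \<le> indicator B \<omega> * (\<integral>\<^sup>+g. ennreal (exp (\<Sum>j\<in>J. g j * X j \<omega> - v j * (g j)\<^sup>2 / 2)) \<partial>Pi\<^sub>M J G)"
      by (intro mult_left_mono) auto
    also have "\<dots> = (\<integral>\<^sup>+g. ?F \<omega> g \<partial>Pi\<^sub>M J G)" using \<omega> by (subst nn_integral_cmult) auto
    finally show "indicator B \<omega> * ennreal (exp (?Z \<omega>)) \<le> (\<integral>\<^sup>+g. ?F \<omega> g \<partial>Pi\<^sub>M J G)" .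
  qed
  also have "\<dots> = (\<integral>\<^sup>+g. \<integral>\<^sup>+\<omega>. ?F \<omega> g \<partial>M \<partial>Pi\<^sub>M J G)" by (rule Q.Fubini'[symmetric, OF meas])
  also have "\<dots> \<le> (\<integral>\<^sup>+g. 1 \<partial>Pi\<^sub>M J G)" by (intro nn_integral_mono mgf)
  also have "\<dots> = 1" using prob_space.emeasure_space_1[OF prob_space_PiM[OF G1]] by simp
  finally have le1: "(\<integral>\<^sup>+\<omega>. indicator B \<omega> * ennreal (exp (?Z \<omega>)) \<partial>M) \<le> 1" .
  have "emeasure M {\<omega> \<in> space M. \<omega> \<in> B \<and> 2 * (\<Sum>j\<in>J. v j) + 4 * \<tau> * t \<le> (\<Sum>j\<in>J. (X j \<omega>)\<^sup>2)}
    = (\<integral>\<^sup>+\<omega>. indicator {\<omega> \<in> space M. \<omega> \<in> B \<and> 2 * (\<Sum>j\<in>J. v j) + 4 * \<tau> * t \<le> (\<Sum>j\<in>J. (X j \<omega>)\<^sup>2)} \<omega> \<partial>M)"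
    by (subst nn_integral_indicator) auto
  also have "\<dots> \<le> (\<integral>\<^sup>+\<omega>. ennreal (exp (- t)) * (indicator B \<omega> * ennreal (exp (?Z \<omega>))) \<partial>M)"
  proof (intro nn_integral_mono)
    fix \<omega>
    show "indicator {\<omega> \<in> space M. \<omega> \<in> B \<and> 2 * (\<Sum>j\<in>J. v j) + 4 * \<tau> * t \<le> (\<Sum>j\<in>J. (X j \<omega>)\<^sup>2)} \<omega>
      \<le> ennreal (exp (- t)) * (indicator B \<omega> * ennreal (exp (?Z \<omega>)))"
    proof (cases "\<omega> \<in> B \<and> 2 * (\<Sum>j\<in>J. v j) + 4 * \<tau> * t \<le> (\<Sum>j\<in>J. (X j \<omega>)\<^sup>2)")
      case True
      have "?Z \<omega> = ((\<Sum>j\<in>J. (X j \<omega>)\<^sup>2) - 2 * (\<Sum>j\<in>J. v j)) / (4 * \<tau>)"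
        using \<tau> by (simp add: sum_subtractf sum_divide_distrib[symmetric] diff_divide_distrib)
      also have "\<dots> \<ge> t" using True \<tau> by (simp add: pos_le_divide_eq algebra_simps)
      finally have "1 \<le> ennreal (exp (- t) * exp (?Z \<omega>))"
        by (simp add: mult_exp_exp flip: ennreal_1)
      then show ?thesis using True by (simp add: ennreal_mult indicator_def)
    qed (auto simp: indicator_def)
  qed
  also have "\<dots> = ennreal (exp (- t)) * (\<integral>\<^sup>+\<omega>. indicator B \<omega> * ennreal (exp (?Z \<omega>)) \<partial>M)"
    by (subst nn_integral_cmult) auto
  also have "\<dots> \<le> ennreal (exp (- t)) * 1" by (intro mult_left_mono le1) simp
  finally show ?thesis by (simp add: emeasure_eq_measure)
qed

section \<open>The sample covariance applied to a fixed vector\<close>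

lemma (in prob_space) centered_gaussian_char:
  assumes T: "centered_gaussian M T c"
  shows "(CLINT \<omega>|M. iexp (T \<omega>)) = complex_of_real (exp (- c / 2))"
proof (cases "c = 0")
  case True
  have [measurable]: "T \<in> borel_measurable M" by (rule centered_gaussian_measurable[OF T])
  have "AE \<omega> in M. T \<omega> = 0" using T True by (auto simp: centered_gaussian_def)
  then have "(CLINT \<omega>|M. iexp (T \<omega>)) = (CLINT \<omega>|M. 1)"
    by (intro integral_cong_AE) auto
  then show ?thesis using True by (simp add: prob_space)
next
  case False
  have [measurable]: "T \<in> borel_measurable M" by (rule centered_gaussian_measurable[OF T])
  have c: "c > 0" and D: "distributed M lborel T (\<lambda>x. ennreal (normal_density 0 (sqrt c) x))"
    using T False by (auto simp: centered_gaussian_def)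
  have "distributed M lborel (\<lambda>\<omega>. 0 + (1 / sqrt c) * T \<omega>) (\<lambda>x. ennreal (normal_density (0 + (1 / sqrt c) * 0) (\<bar>1 / sqrt c\<bar> * sqrt c) x))"
    by (rule normal_density_affine[OF D]) (use c in auto)
  then have "distributed M lborel (\<lambda>\<omega>. T \<omega> / sqrt c) (\<lambda>x. ennreal (std_normal_density x))"
    using c by simp
  then have "distr M lborel (\<lambda>\<omega>. T \<omega> / sqrt c) = std_normal_distribution"
    by (auto simp: distributed_def)
  then have "char (distr M borel (\<lambda>\<omega>. T \<omega> / sqrt c)) (sqrt c) = char std_normal_distribution (sqrt c)"
    by (simp cong: distr_cong)
  then have "(CLINT \<omega>|M. iexp (sqrt c * (T \<omega> / sqrt c))) = complex_of_real (exp (- (sqrt c)\<^sup>2 / 2))"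
    unfolding char_std_normal_distribution char_def by (subst (asm) integral_distr) auto
  moreover have "sqrt c * (T \<omega> / sqrt c) = T \<omega>" for \<omega> using c by simp
  ultimately show ?thesis using c by (simp only: real_sqrt_pow2 less_imp_le)
qed

text \<open>Conditionally on \<open>X\<close> the product \<open>X Y\<close> is Gaussian with variance at most \<open>K X\<^sup>2\<close>.\<close>

lemma (in prob_space) indep_gaussian_product_mgf:
  fixes X Y :: "'a \<Rightarrow> real" and c K :: real
  assumes ind: "indep_var borel X borel Y" and Y: "centered_gaussian M Y c" and K: "c \<le> K"
  shows "(\<integral>\<^sup>+\<omega>. ennreal (exp (X \<omega> * Y \<omega> - K * (X \<omega>)\<^sup>2 / 2)) \<partial>M) \<le> 1"
proof -
  have [measurable]: "X \<in> borel_measurable M" "Y \<in> borel_measurable M"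
    using indep_var_rv1[OF ind] indep_var_rv2[OF ind] by auto
  interpret X: prob_space "distr M borel X" by (rule prob_space_distr) simp
  interpret Y: prob_space "distr M borel Y" by (rule prob_space_distr) simp
  let ?f = "\<lambda>(x, y). ennreal (exp (x * y - K * x\<^sup>2 / 2))"
  have "(\<integral>\<^sup>+\<omega>. ennreal (exp (X \<omega> * Y \<omega> - K * (X \<omega>)\<^sup>2 / 2)) \<partial>M)
    = (\<integral>\<^sup>+p. ?f p \<partial>distr M (borel \<Otimes>\<^sub>M borel) (\<lambda>\<omega>. (X \<omega>, Y \<omega>)))"
    by (subst nn_integral_distr) auto
  also have "\<dots> = (\<integral>\<^sup>+p. ?f p \<partial>(distr M borel X \<Otimes>\<^sub>M distr M borel Y))"
    using ind unfolding indep_var_distribution_eq by simp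
  also have "\<dots> = (\<integral>\<^sup>+x. \<integral>\<^sup>+y. ?f (x, y) \<partial>distr M borel Y \<partial>distr M borel X)"
    by (subst Y.nn_integral_fst[symmetric]) auto
  also have "\<dots> \<le> (\<integral>\<^sup>+x. 1 \<partial>distr M borel X)"
  proof (intro nn_integral_mono)
    fix x :: real
    have "(\<integral>\<^sup>+y. ?f (x, y) \<partial>distr M borel Y) = (\<integral>\<^sup>+\<omega>. ennreal (exp (- K * x\<^sup>2 / 2)) * ennreal (exp (0 * (Y \<omega>)\<^sup>2 + x * Y \<omega>)) \<partial>M)"
      by (subst nn_integral_distr) (auto simp: ennreal_mult[symmetric] mult_exp_exp)
    also have "\<dots> = ennreal (exp (- K * x\<^sup>2 / 2)) * ennreal (exp (c * x\<^sup>2 / 2))"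
      using centered_gaussian_exp_quadratic[OF prob_space_axioms Y, of 0 x] by (subst nn_integral_cmult) auto
    also have "\<dots> \<le> 1"
      using mult_right_mono[OF K, of "x\<^sup>2"] by (simp add: ennreal_mult[symmetric] mult_exp_exp flip: ennreal_1)
    finally show "(\<integral>\<^sup>+y. ?f (x, y) \<partial>distr M borel Y) \<le> 1" .
  qed
  also have "\<dots> = 1" using X.emeasure_space_1 by simp
  finally show ?thesis .
qed

text \<open>Only an exceptional set is required to be measurable: the properties of interest quantify over
  uncountably many vectors.\<close>
definition (in prob_space) holds_except :: "real \<Rightarrow> ('a \<Rightarrow> bool) \<Rightarrow> bool" where
  "holds_except p P \<longleftrightarrow> (\<exists>N\<in>sets M. prob N \<le> p \<and> (\<forall>\<omega>\<in>space M - N. P \<omega>))"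

lemma (in prob_space) holds_except_mono:
  fixes p q :: real
  assumes "holds_except p P" "p \<le> q" "\<And>\<omega>. \<omega> \<in> space M \<Longrightarrow> P \<omega> \<Longrightarrow> Q \<omega>"
  shows "holds_except q Q"
  using assms unfolding holds_except_def by (meson DiffD1 order_trans)

lemma (in prob_space) holds_except_conj:
  fixes p q :: real
  assumes "holds_except p P" "holds_except q Q"
  shows "holds_except (p + q) (\<lambda>\<omega>. P \<omega> \<and> Q \<omega>)"
proof -
  obtain A B where AB: "A \<in> sets M" "prob A \<le> p" "\<forall>\<omega>\<in>space M - A. P \<omega>"
    "B \<in> sets M" "prob B \<le> q" "\<forall>\<omega>\<in>space M - B. Q \<omega>"
    using assms unfolding holds_except_def by blast
  have "prob (A \<union> B) \<le> p + q" using AB measure_Un_le[of A M B] by linarith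
  then show ?thesis unfolding holds_except_def using AB by (intro bexI[of _ "A \<union> B"]) auto
qed

lemma (in prob_space) holds_except_Ball:
  fixes p :: real
  assumes "finite I" "\<And>i. i \<in> I \<Longrightarrow> holds_except p (P i)"
  shows "holds_except (real (card I) * p) (\<lambda>\<omega>. \<forall>i\<in>I. P i \<omega>)"
  using assms
proof (induction I rule: finite_induct)
  case empty
  then show ?case unfolding holds_except_def by (intro bexI[of _ "{}"]) auto
next
  case (insert i I)
  have "holds_except (p + real (card I) * p) (\<lambda>\<omega>. P i \<omega> \<and> (\<forall>i\<in>I. P i \<omega>))"
    using insert by (intro holds_except_conj) auto
  then show ?case by (rule holds_except_mono) (use insert in \<open>auto simp: algebra_simps\<close>)
qed

lemma (in prob_space) holds_except_Collect:
  assumes "{\<omega> \<in> space M. Q \<omega>} \<in> sets M" "prob {\<omega> \<in> space M. Q \<omega>} \<le> p"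
  shows "holds_except p (\<lambda>\<omega>. \<not> Q \<omega>)"
  unfolding holds_except_def using assms by (intro bexI[of _ "{\<omega> \<in> space M. Q \<omega>}"]) auto

text \<open>A centred Gaussian sample in the eigenbasis of its covariance: \<open>H k \<omega> j\<close> is the
  \<open>j\<close>-th coordinate of observation \<open>k\<close>, and the covariance is diagonal with entries \<open>\<sigma>\<close>.\<close>
locale gaussian_eigen_sample = prob_space M for M :: "'a measure" +
  fixes d n :: nat and \<sigma> :: "nat \<Rightarrow> real" and H :: "nat \<Rightarrow> 'a \<Rightarrow> nat \<Rightarrow> real"
  assumes d_pos: "0 < d" and n_pos: "0 < n"
    and \<sigma>_nonneg: "\<And>j. j < d \<Longrightarrow> 0 \<le> \<sigma> j"
    and \<sigma>_antimono: "\<And>i j. i \<le> j \<Longrightarrow> j < d \<Longrightarrow> \<sigma> j \<le> \<sigma> i"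
    and \<sigma>_top: "0 < \<sigma> 0"
    and indep: "indep_vars (\<lambda>_. Pi\<^sub>M {..<d} (\<lambda>_. borel)) H {..<n}"
    and gauss: "\<And>k g. k < n \<Longrightarrow> centered_gaussian M (\<lambda>\<omega>. \<Sum>j<d. g j * H k \<omega> j) (\<Sum>j<d. \<sigma> j * (g j)\<^sup>2)"
begin

definition lin :: "(nat \<Rightarrow> real) \<Rightarrow> nat \<Rightarrow> 'a \<Rightarrow> real" where
  "lin g k \<omega> = (\<Sum>j<d. g j * H k \<omega> j)"

definition popvar :: "(nat \<Rightarrow> real) \<Rightarrow> real" where
  "popvar g = (\<Sum>j<d. \<sigma> j * (g j)\<^sup>2)"

definition cov_err :: "(nat \<Rightarrow> real) \<Rightarrow> 'a \<Rightarrow> nat \<Rightarrow> real" where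
  "cov_err v \<omega> j = (\<Sum>k<n. lin v k \<omega> * H k \<omega> j) / n - \<sigma> j * v j"

definition eigen_sum :: real where "eigen_sum = (\<Sum>j<d. \<sigma> j)"

lemma gauss_lin: "k < n \<Longrightarrow> centered_gaussian M (lin g k) (popvar g)"
  unfolding lin_def[abs_def] popvar_def by (rule gauss)

lemma lin_measurable[measurable]: "k < n \<Longrightarrow> lin g k \<in> borel_measurable M"
  using gauss_lin centered_gaussian_measurable by blast

lemma H_measurable[measurable]: "k < n \<Longrightarrow> j < d \<Longrightarrow> (\<lambda>\<omega>. H k \<omega> j) \<in> borel_measurable M"
  using indep unfolding indep_vars_def by (auto intro: measurable_component_singleton[THEN measurable_compose[rotated]])

lemma popvar_nonneg: "0 \<le> popvar g"
  unfolding popvar_def by (intro sum_nonneg mult_nonneg_nonneg) (auto simp: \<sigma>_nonneg)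

lemma indep_fun:
  assumes "\<And>k. k < n \<Longrightarrow> f k \<in> borel_measurable (Pi\<^sub>M {..<d} (\<lambda>_. borel))"
  shows "indep_vars (\<lambda>_. borel) (\<lambda>k \<omega>. f k (H k \<omega>)) {..<n}"
  by (rule indep_vars_compose2[OF indep]) (use assms in auto)

lemma indep_lin: "indep_vars (\<lambda>_. borel) (lin g) {..<n}"
  unfolding lin_def[abs_def] by (rule indep_fun) measurable

text \<open>Uncorrelated linear functionals of one observation are independent, because every linear
  combination of them is Gaussian with the expected variance.\<close>

lemma indep_lin_uncorrelated:
  assumes k: "k < n" and orth: "(\<Sum>j<d. \<sigma> j * v j * g j) = 0"
  shows "indep_var borel (lin v k) borel (lin g k)"
proof (rule indep_var_from_char)
  show "lin v k \<in> borel_measurable M" "lin g k \<in> borel_measurable M" using k by auto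
  fix t s :: real
  have l: "t * lin v k \<omega> + s * lin g k \<omega> = lin (\<lambda>j. t * v j + s * g j) k \<omega>" for \<omega>
    by (simp add: lin_def sum_distrib_left sum.distrib[symmetric] algebra_simps)
  have sc: "t * lin v k \<omega> = lin (\<lambda>j. t * v j) k \<omega>" for t v \<omega>
    by (simp add: lin_def sum_distrib_left mult_ac)
  have psc: "popvar (\<lambda>j. t * v j) = t\<^sup>2 * popvar v" for t v
    by (simp add: popvar_def sum_distrib_left power_mult_distrib mult_ac)
  have "popvar (\<lambda>j. t * v j + s * g j) = t\<^sup>2 * popvar v + s\<^sup>2 * popvar g + 2 * t * s * (\<Sum>j<d. \<sigma> j * v j * g j)"
    unfolding popvar_def sum_distrib_left sum.distrib[symmetric]
    by (intro sum.cong refl) (simp add: power2_eq_square algebra_simps)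
  then have p: "popvar (\<lambda>j. t * v j + s * g j) = t\<^sup>2 * popvar v + s\<^sup>2 * popvar g" using orth by simp
  have "(CLINT \<omega>|M. iexp (t * lin v k \<omega> + s * lin g k \<omega>)) = complex_of_real (exp (- (t\<^sup>2 * popvar v + s\<^sup>2 * popvar g) / 2))"
    unfolding l by (subst centered_gaussian_char[OF gauss_lin[OF k]]) (simp only: p)
  also have "\<dots> = complex_of_real (exp (- (t\<^sup>2 * popvar v) / 2)) * complex_of_real (exp (- (s\<^sup>2 * popvar g) / 2))"
    by (simp only: of_real_mult[symmetric] mult_exp_exp) (simp add: field_simps)
  also have "\<dots> = (CLINT \<omega>|M. iexp (t * lin v k \<omega>)) * (CLINT \<omega>|M. iexp (s * lin g k \<omega>))"
    unfolding sc by (simp only: centered_gaussian_char[OF gauss_lin[OF k]] psc)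
  finally show "(CLINT \<omega>|M. iexp (t * lin v k \<omega> + s * lin g k \<omega>))
     = (CLINT \<omega>|M. iexp (t * lin v k \<omega>)) * (CLINT \<omega>|M. iexp (s * lin g k \<omega>))" .
qed

lemma \<sigma>_le_top: "j < d \<Longrightarrow> \<sigma> j \<le> \<sigma> 0"
  using \<sigma>_antimono[of 0 j] by simp

text \<open>The coordinates of \<open>\<Sum>k. (v \<bullet> Y\<^sub>k) Y'\<^sub>k\<close>, where \<open>Y'\<close> is the residual of \<open>Y\<close> after linear
  regression on \<open>v \<bullet> Y\<close>.\<close>
definition resid :: "(nat \<Rightarrow> real) \<Rightarrow> nat \<Rightarrow> 'a \<Rightarrow> real" where
  "resid v j \<omega> = (\<Sum>k<n. lin v k \<omega> * (H k \<omega> j - lin v k \<omega> * \<sigma> j * v j / popvar v))"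

text \<open>The residuals are independent of the weights \<open>v \<bullet> Y\<^sub>k\<close>, so for each fixed \<open>g\<close> the exponential
  moment required by the method of mixtures factorises over the sample; on the event the sum of the
  squared weights is at most \<open>A = 2 n (v\<^sup>T \<Gamma> v)\<close>, twice its mean.\<close>
lemma resid_tail:
  fixes t :: real
  assumes c: "0 < popvar v"
  shows "prob {\<omega> \<in> space M. (\<Sum>k<n. (lin v k \<omega>)\<^sup>2) \<le> 2 * n * popvar v \<and>
     4 * n * popvar v * eigen_sum + 8 * n * popvar v * \<sigma> 0 * t \<le> (\<Sum>j<d. (resid v j \<omega>)\<^sup>2)} \<le> exp (- t)"
proof -
  define c where "c = popvar v"
  define A where "A = 2 * n * c"
  have A: "A > 0" using assms n_pos by (simp add: A_def c_def)
  define B where "B = {\<omega> \<in> space M. (\<Sum>k<n. (lin v k \<omega>)\<^sup>2) \<le> A}"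
  have [measurable]: "B \<in> sets M" unfolding B_def by measurable
  have meas: "resid v j \<in> borel_measurable M" if "j < d" for j
    using that unfolding resid_def[abs_def] by measurable
  have "prob {\<omega> \<in> space M. \<omega> \<in> B \<and> 2 * (\<Sum>j\<in>{..<d}. A * \<sigma> j) + 4 * (A * \<sigma> 0) * t \<le> (\<Sum>j\<in>{..<d}. (resid v j \<omega>)\<^sup>2)} \<le> exp (- t)"
  proof (rule norm_tail_from_mixture)
    show "finite {..<d}" "B \<in> sets M" "0 < A * \<sigma> 0" using A \<sigma>_top by auto
    show "resid v j \<in> borel_measurable M" if "j \<in> {..<d}" for j using meas that by simp
    show "0 \<le> A * \<sigma> j \<and> A * \<sigma> j \<le> A * \<sigma> 0" if "j \<in> {..<d}" for j
      using that A \<sigma>_nonneg[of j] \<sigma>_le_top[of j] by (auto intro: mult_left_mono)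
    fix g :: "nat \<Rightarrow> real"
    define \<rho> where "\<rho> = (\<Sum>j<d. \<sigma> j * v j * g j)"
    \<comment> \<open>The functional \<open>g\<close> of the residual is the functional \<open>g'\<close> of the observation.\<close>
    define g' where "g' j = g j - \<rho> / c * v j" for j
    have orth: "(\<Sum>j<d. \<sigma> j * v j * g' j) = 0"
    proof -
      have "(\<Sum>j<d. \<sigma> j * v j * g' j) = \<rho> - \<rho> / c * (\<Sum>j<d. \<sigma> j * (v j)\<^sup>2)"
        unfolding \<rho>_def g'_def sum_distrib_left sum_subtractf[symmetric]
        by (intro sum.cong refl) (simp add: power2_eq_square algebra_simps)
      also have "(\<Sum>j<d. \<sigma> j * (v j)\<^sup>2) = c" by (simp add: c_def popvar_def)
      finally show ?thesis using c by (simp add: c_def)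
    qed
    have g'_le: "popvar g' \<le> popvar g"
    proof -
      have "popvar g = popvar g' + 2 * (\<rho> / c) * (\<Sum>j<d. \<sigma> j * v j * g' j) + (\<rho> / c)\<^sup>2 * popvar v"
        unfolding popvar_def g'_def sum_distrib_left sum.distrib[symmetric]
        by (intro sum.cong refl) (simp add: power2_eq_square algebra_simps)
      then show ?thesis using orth popvar_nonneg[of v] by simp
    qed
    have lin_g': "lin g' k \<omega> = lin g k \<omega> - \<rho> / c * lin v k \<omega>" for k \<omega>
      by (simp add: lin_def g'_def sum_distrib_left sum_subtractf[symmetric] algebra_simps)
    have expand: "(\<Sum>j<d. g j * resid v j \<omega>) = (\<Sum>k<n. lin v k \<omega> * lin g' k \<omega>)" for \<omega>
    proof -
      have "(\<Sum>j<d. g j * resid v j \<omega>) = (\<Sum>k<n. \<Sum>j<d. g j * (lin v k \<omega> * (H k \<omega> j - lin v k \<omega> * \<sigma> j * v j / c)))"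
        unfolding resid_def sum_distrib_left c_def by (rule sum.swap)
      also have "\<dots> = (\<Sum>k<n. lin v k \<omega> * lin g' k \<omega>)"
      proof (intro sum.cong refl)
        fix k
        have "(\<Sum>j<d. g j * (lin v k \<omega> * (H k \<omega> j - lin v k \<omega> * \<sigma> j * v j / c)))
          = lin v k \<omega> * (lin g k \<omega> - lin v k \<omega> / c * \<rho>)"
          unfolding lin_def[of g] \<rho>_def sum_distrib_left sum_subtractf[symmetric]
          by (intro sum.cong refl) (simp add: algebra_simps)
        then show "(\<Sum>j<d. g j * (lin v k \<omega> * (H k \<omega> j - lin v k \<omega> * \<sigma> j * v j / c))) = lin v k \<omega> * lin g' k \<omega>"
          by (simp add: lin_g')
      qed
      finally show ?thesis .
    qed
    have "(\<integral>\<^sup>+\<omega>. indicator B \<omega> * ennreal (exp (\<Sum>j\<in>{..<d}. g j * resid v j \<omega> - A * \<sigma> j * (g j)\<^sup>2 / 2)) \<partial>M)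
      \<le> (\<integral>\<^sup>+\<omega>. (\<Prod>k<n. ennreal (exp (lin v k \<omega> * lin g' k \<omega> - popvar g * (lin v k \<omega>)\<^sup>2 / 2))) \<partial>M)"
    proof (intro nn_integral_mono)
      fix \<omega>
      have "(\<Sum>j<d. A * \<sigma> j * (g j)\<^sup>2 / 2) = A * popvar g / 2"
        by (simp add: popvar_def sum_distrib_left sum_divide_distrib mult_ac)
      then have e: "(\<Sum>j<d. g j * resid v j \<omega> - A * \<sigma> j * (g j)\<^sup>2 / 2) = (\<Sum>k<n. lin v k \<omega> * lin g' k \<omega>) - A * popvar g / 2"
        by (simp add: sum_subtractf expand)
      have p: "(\<Prod>k<n. ennreal (exp (lin v k \<omega> * lin g' k \<omega> - popvar g * (lin v k \<omega>)\<^sup>2 / 2)))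
        = ennreal (exp ((\<Sum>k<n. lin v k \<omega> * lin g' k \<omega>) - (\<Sum>k<n. (lin v k \<omega>)\<^sup>2) * popvar g / 2))"
        by (simp add: prod_ennreal exp_sum[symmetric] sum_subtractf sum_distrib_left sum_distrib_right sum_divide_distrib mult_ac)
      show "indicator B \<omega> * ennreal (exp (\<Sum>j\<in>{..<d}. g j * resid v j \<omega> - A * \<sigma> j * (g j)\<^sup>2 / 2))
        \<le> (\<Prod>k<n. ennreal (exp (lin v k \<omega> * lin g' k \<omega> - popvar g * (lin v k \<omega>)\<^sup>2 / 2)))"
      proof (cases "\<omega> \<in> B")
        case True
        then have "(\<Sum>k<n. (lin v k \<omega>)\<^sup>2) * popvar g \<le> A * popvar g"
          unfolding B_def using popvar_nonneg[of g] by (auto intro: mult_right_mono)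
        then show ?thesis unfolding e p using True by (auto intro!: ennreal_leI)
      qed simp
    qed
    also have "\<dots> = (\<Prod>k<n. \<integral>\<^sup>+\<omega>. ennreal (exp (lin v k \<omega> * lin g' k \<omega> - popvar g * (lin v k \<omega>)\<^sup>2 / 2)) \<partial>M)"
    proof (rule indep_vars_nn_integral)
      show "indep_vars (\<lambda>_. borel) (\<lambda>k \<omega>. ennreal (exp (lin v k \<omega> * lin g' k \<omega> - popvar g * (lin v k \<omega>)\<^sup>2 / 2))) {..<n}"
        unfolding lin_def by (rule indep_vars_compose2[OF indep]) measurable
    qed auto
    also have "\<dots> \<le> (\<Prod>k<n. 1)"
      by (intro prod_mono_ennreal indep_gaussian_product_mgf[OF indep_lin_uncorrelated[OF _ orth] gauss_lin g'_le]) auto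
    finally show "(\<integral>\<^sup>+\<omega>. indicator B \<omega> * ennreal (exp (\<Sum>j\<in>{..<d}. g j * resid v j \<omega> - A * \<sigma> j * (g j)\<^sup>2 / 2)) \<partial>M) \<le> 1"
      by simp
  qed
  moreover have "2 * (\<Sum>j\<in>{..<d}. A * \<sigma> j) + 4 * (A * \<sigma> 0) * t = 4 * n * popvar v * eigen_sum + 8 * n * popvar v * \<sigma> 0 * t"
    by (simp add: A_def c_def eigen_sum_def sum_distrib_left[symmetric])
  moreover have "{\<omega> \<in> space M. \<omega> \<in> B \<and> Q \<omega>} = {\<omega> \<in> space M. (\<Sum>k<n. (lin v k \<omega>)\<^sup>2) \<le> 2 * n * popvar v \<and> Q \<omega>}" for Q
    by (auto simp: B_def A_def c_def)
  ultimately show ?thesis by simp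
qed

lemma cov_err_decomp:
  assumes "popvar v \<noteq> 0"
  shows "cov_err v \<omega> j = resid v j \<omega> / n + ((\<Sum>k<n. (lin v k \<omega>)\<^sup>2) / (n * popvar v) - 1) * (\<sigma> j * v j)"
proof -
  have "resid v j \<omega> = (\<Sum>k<n. lin v k \<omega> * H k \<omega> j) - (\<Sum>k<n. (lin v k \<omega>)\<^sup>2) * (\<sigma> j * v j / popvar v)"
    unfolding resid_def sum_distrib_right sum_subtractf[symmetric]
    by (intro sum.cong refl) (simp add: power2_eq_square algebra_simps)
  then show ?thesis using assms n_pos unfolding cov_err_def by (simp add: field_simps)
qed

lemma cov_err_measurable[measurable]: "j < d \<Longrightarrow> (\<lambda>\<omega>. cov_err v \<omega> j) \<in> borel_measurable M"
  unfolding cov_err_def by measurable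

lemma sq_weights_le: "(\<Sum>j<d. (\<sigma> j * v j)\<^sup>2) \<le> \<sigma> 0 * popvar v"
  unfolding popvar_def sum_distrib_left
proof (intro sum_mono)
  fix j assume "j \<in> {..<d}"
  then have "\<sigma> j * (\<sigma> j * (v j)\<^sup>2) \<le> \<sigma> 0 * (\<sigma> j * (v j)\<^sup>2)"
    using \<sigma>_le_top \<sigma>_nonneg by (intro mult_right_mono) auto
  then show "(\<sigma> j * v j)\<^sup>2 \<le> \<sigma> 0 * (\<sigma> j * (v j)\<^sup>2)" by (simp add: power2_eq_square mult_ac)
qed

text \<open>The deviation \<open>t\<close> of the chi-square part is chosen to make both failure probabilities
  comparable to \<open>exp (- u)\<close>. A direction of variance zero is almost surely not seen by the sample.\<close>
lemma cov_err_concentration: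
  fixes u :: real
  assumes u: "0 \<le> u" "16 * u \<le> n"
  shows "holds_except (3 * exp (- u))
    (\<lambda>\<omega>. sqnorm d (cov_err v \<omega>) \<le> popvar v * (8 * eigen_sum + 48 * \<sigma> 0 * u) / n)"
proof (cases "popvar v = 0")
  case True
  have z: "\<sigma> j * v j = 0" if "j < d" for j
  proof -
    have "\<sigma> j * (v j)\<^sup>2 = 0"
      using True that unfolding popvar_def
      by (subst (asm) sum_nonneg_eq_0_iff) (auto simp: \<sigma>_nonneg)
    then show ?thesis by auto
  qed
  have "AE \<omega> in M. \<forall>k\<in>{..<n}. lin v k \<omega> = 0"
    using gauss_lin[of _ v] True by (intro AE_finite_allI) (auto simp: centered_gaussian_def)
  then have "AE \<omega> in M. sqnorm d (cov_err v \<omega>) = 0"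
    by eventually_elim (simp add: sqnorm_def cov_err_def z)
  then have "prob {\<omega> \<in> space M. sqnorm d (cov_err v \<omega>) \<noteq> 0} = 0"
    by (intro prob_eq_0[THEN iffD2]) (auto simp: sqnorm_def)
  then have "holds_except (3 * exp (- u)) (\<lambda>\<omega>. \<not> sqnorm d (cov_err v \<omega>) \<noteq> 0)"
    by (intro holds_except_Collect) (auto simp: sqnorm_def)
  then show ?thesis by (rule holds_except_mono) (use True in auto)
next
  case False
  then have c: "0 < popvar v" using popvar_nonneg[of v] by simp
  define c where "c = popvar v"
  define t where "t = sqrt (16 * u / n)"
  have t: "0 \<le> t" "t \<le> 1" "n * t\<^sup>2 / 16 = u" using u n_pos by (auto simp: t_def)
  let ?S = "\<lambda>\<omega>. (\<Sum>k<n. (lin v k \<omega>)\<^sup>2)"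
  let ?E1 = "\<lambda>\<omega>. n * c * t \<le> \<bar>?S \<omega> - n * c\<bar>"
  let ?E2 = "\<lambda>\<omega>. ?S \<omega> \<le> 2 * n * c \<and> 4 * n * c * eigen_sum + 8 * n * c * \<sigma> 0 * u \<le> (\<Sum>j<d. (resid v j \<omega>)\<^sup>2)"
  have [measurable]: "?S \<in> borel_measurable M" by measurable
  have [measurable]: "(\<lambda>\<omega>. \<Sum>j<d. (resid v j \<omega>)\<^sup>2) \<in> borel_measurable M"
    unfolding resid_def by measurable
  have E1: "holds_except (2 * exp (- u)) (\<lambda>\<omega>. \<not> ?E1 \<omega>)"
    using chi_square_concentration[OF finite_lessThan indep_lin, of v c c t] gauss_lin c t
    by (intro holds_except_Collect) (auto simp: c_def)
  have E2: "holds_except (exp (- u)) (\<lambda>\<omega>. \<not> ?E2 \<omega>)"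
    using resid_tail[OF c, of u] by (intro holds_except_Collect) (auto simp: c_def)
  have "holds_except (2 * exp (- u) + exp (- u)) (\<lambda>\<omega>. \<not> ?E1 \<omega> \<and> \<not> ?E2 \<omega>)"
    by (rule holds_except_conj[OF E1 E2])
  then show ?thesis
  proof (rule holds_except_mono)
    fix \<omega> assume \<omega>: "\<not> ?E1 \<omega> \<and> \<not> ?E2 \<omega>"
    then have dev: "\<bar>?S \<omega> - n * c\<bar> < n * c * t" by simp
    have nc: "n * c > 0" using c n_pos by (simp add: c_def)
    have "n * c * t \<le> n * c * 1" using nc t by (intro mult_left_mono) auto
    then have "?S \<omega> \<le> 2 * n * c" using dev by linarith
    then have R: "(\<Sum>j<d. (resid v j \<omega>)\<^sup>2) \<le> 4 * n * c * eigen_sum + 8 * n * c * \<sigma> 0 * u" using \<omega> by linarith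
    define e where "e = ?S \<omega> / (n * c) - 1"
    have "e = (?S \<omega> - n * c) / (n * c)"
      using nc n_pos unfolding e_def by (subst diff_divide_distrib) (auto simp: zero_less_mult_iff)
    then have "\<bar>e\<bar> = \<bar>?S \<omega> - n * c\<bar> / (n * c)"
      using nc by (simp only: abs_divide abs_of_pos)
    also have "\<dots> \<le> t" using dev nc by (simp add: pos_divide_le_eq mult.commute)
    finally have e2: "e\<^sup>2 \<le> t\<^sup>2" by (simp add: abs_le_square_iff[symmetric] t)
    have "sqnorm d (cov_err v \<omega>) = (\<Sum>j<d. (resid v j \<omega> / n + e * (\<sigma> j * v j))\<^sup>2)"
      unfolding sqnorm_def using cov_err_decomp[of v \<omega>] False by (simp add: e_def c_def)
    also have "\<dots> \<le> (\<Sum>j<d. 2 * (resid v j \<omega> / n)\<^sup>2 + 2 * (e * (\<sigma> j * v j))\<^sup>2)"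
    proof (intro sum_mono)
      fix j
      show "(resid v j \<omega> / n + e * (\<sigma> j * v j))\<^sup>2 \<le> 2 * (resid v j \<omega> / n)\<^sup>2 + 2 * (e * (\<sigma> j * v j))\<^sup>2"
        using sum_squares_bound[of "resid v j \<omega> / n" "e * (\<sigma> j * v j)"] by (simp add: power2_sum)
    qed
    also have "\<dots> = 2 * (\<Sum>j<d. (resid v j \<omega>)\<^sup>2) / (real n)\<^sup>2 + 2 * e\<^sup>2 * (\<Sum>j<d. (\<sigma> j * v j)\<^sup>2)"
      by (simp add: sum.distrib sum_distrib_left sum_divide_distrib power_divide power_mult_distrib mult_ac)
    also have "\<dots> \<le> 2 * (4 * n * c * eigen_sum + 8 * n * c * \<sigma> 0 * u) / (real n)\<^sup>2 + 2 * t\<^sup>2 * (\<sigma> 0 * c)"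
      using R e2 sq_weights_le[of v] unfolding c_def
      by (intro add_mono divide_right_mono mult_mono sum_nonneg mult_left_mono mult_nonneg_nonneg) auto
    also have "2 * t\<^sup>2 * (\<sigma> 0 * c) = 32 * u / n * (\<sigma> 0 * c)" using u n_pos by (simp add: t_def)
    also have "2 * (4 * n * c * eigen_sum + 8 * n * c * \<sigma> 0 * u) / (real n)\<^sup>2 + 32 * u / n * (\<sigma> 0 * c)
       = c * (8 * eigen_sum + 48 * \<sigma> 0 * u) / n"
      using n_pos by (simp add: field_simps power2_eq_square)
    finally show "sqnorm d (cov_err v \<omega>) \<le> popvar v * (8 * eigen_sum + 48 * \<sigma> 0 * u) / n"
      by (simp add: c_def)
  qed simp
qed

end

section \<open>Quadratic forms on the large and on the small eigenvalues\<close>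

context gaussian_eigen_sample
begin

definition tail_part :: "nat \<Rightarrow> (nat \<Rightarrow> real) \<Rightarrow> nat \<Rightarrow> real" where
  "tail_part k0 x j = (if k0 \<le> j then x j else 0)"

definition head_part :: "nat \<Rightarrow> (nat \<Rightarrow> real) \<Rightarrow> nat \<Rightarrow> real" where
  "head_part k0 x j = (if j < k0 then x j else 0)"

text \<open>A linear combination of the observations with weights in the unit ball is again Gaussian, with
  covariance at most \<open>diag \<sigma>\<close>; here the mixture bound is applied to its coordinates with small eigenvalues.\<close>
lemma weighted_sum_tail:
  fixes \<theta> u :: real
  assumes \<theta>: "0 < \<theta>" "\<And>j. k0 \<le> j \<Longrightarrow> j < d \<Longrightarrow> \<sigma> j \<le> \<theta>" and w: "sqnorm n w \<le> 1"
  shows "prob {\<omega> \<in> space M. 2 * eigen_sum + 4 * \<theta> * u \<le> (\<Sum>j\<in>{k0..<d}. (\<Sum>k<n. w k * H k \<omega> j)\<^sup>2)} \<le> exp (- u)"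
proof -
  let ?J = "{k0..<d}"
  let ?X = "\<lambda>j \<omega>. \<Sum>k<n. w k * H k \<omega> j"
  have meas: "?X j \<in> borel_measurable M" if "j \<in> ?J" for j
  proof -
    have "j < d" using that by simp
    then show ?thesis by measurable
  qed
  have "prob {\<omega> \<in> space M. \<omega> \<in> space M \<and> 2 * (\<Sum>j\<in>?J. \<sigma> j) + 4 * \<theta> * u \<le> (\<Sum>j\<in>?J. (?X j \<omega>)\<^sup>2)} \<le> exp (- u)"
  proof (rule norm_tail_from_mixture)
    show "?X j \<in> borel_measurable M" if "j \<in> ?J" for j using meas[OF that] .
    show "0 \<le> \<sigma> j \<and> \<sigma> j \<le> \<theta>" if "j \<in> ?J" for j using that \<theta> \<sigma>_nonneg by auto
    fix g :: "nat \<Rightarrow> real"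
    define g' where "g' = tail_part k0 g"
    have J: "(\<Sum>j\<in>?J. f j) = (\<Sum>j<d. if k0 \<le> j then f j else 0)" for f :: "nat \<Rightarrow> real"
      by (simp add: sum.If_cases) (intro sum.cong, auto)
    have pv: "(\<Sum>j\<in>?J. \<sigma> j * (g j)\<^sup>2) = popvar g'"
      unfolding J popvar_def g'_def tail_part_def by (intro sum.cong) auto
    have lin: "(\<Sum>j\<in>?J. g j * H k \<omega> j) = lin g' k \<omega>" for k \<omega>
      unfolding J lin_def g'_def tail_part_def by (intro sum.cong) auto
    have e: "(\<Sum>j\<in>?J. g j * ?X j \<omega> - \<sigma> j * (g j)\<^sup>2 / 2) = (\<Sum>k<n. w k * lin g' k \<omega>) - popvar g' / 2" for \<omega>
    proof -
      have "(\<Sum>j\<in>?J. g j * ?X j \<omega>) = (\<Sum>k<n. \<Sum>j\<in>?J. g j * (w k * H k \<omega> j))"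
        unfolding sum_distrib_left by (rule sum.swap)
      also have "\<dots> = (\<Sum>k<n. w k * lin g' k \<omega>)"
        unfolding lin[symmetric] sum_distrib_left by (simp add: mult_ac)
      finally show ?thesis by (simp add: sum_subtractf pv[symmetric] sum_divide_distrib)
    qed
    have "(\<integral>\<^sup>+\<omega>. indicator (space M) \<omega> * ennreal (exp (\<Sum>j\<in>?J. g j * ?X j \<omega> - \<sigma> j * (g j)\<^sup>2 / 2)) \<partial>M)
      = (\<integral>\<^sup>+\<omega>. ennreal (exp (- popvar g' / 2)) * (\<Prod>k<n. ennreal (exp (w k * lin g' k \<omega>))) \<partial>M)"
      unfolding e by (intro nn_integral_cong) (simp add: prod_ennreal exp_sum[symmetric] ennreal_mult[symmetric] mult_exp_exp)
    also have "\<dots> = ennreal (exp (- popvar g' / 2)) * (\<integral>\<^sup>+\<omega>. (\<Prod>k<n. ennreal (exp (w k * lin g' k \<omega>))) \<partial>M)"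
      by (intro nn_integral_cmult) measurable
    also have "(\<integral>\<^sup>+\<omega>. (\<Prod>k<n. ennreal (exp (w k * lin g' k \<omega>))) \<partial>M) = (\<Prod>k<n. \<integral>\<^sup>+\<omega>. ennreal (exp (w k * lin g' k \<omega>)) \<partial>M)"
      by (intro indep_vars_nn_integral indep_vars_compose2[OF indep_lin]) auto
    also have "\<dots> = (\<Prod>k<n. ennreal (exp (popvar g' * (w k)\<^sup>2 / 2)))"
    proof (intro prod.cong refl)
      fix k assume "k \<in> {..<n}"
      then show "(\<integral>\<^sup>+\<omega>. ennreal (exp (w k * lin g' k \<omega>)) \<partial>M) = ennreal (exp (popvar g' * (w k)\<^sup>2 / 2))"
        using centered_gaussian_exp_quadratic[OF prob_space_axioms gauss_lin, of k 0 g' "w k"] by simp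
    qed
    also have "\<dots> = ennreal (exp (popvar g' * sqnorm n w / 2))"
      by (simp add: prod_ennreal exp_sum[symmetric] sqnorm_def sum_distrib_left sum_divide_distrib)
    also have "ennreal (exp (- popvar g' / 2)) * \<dots> \<le> 1"
      using mult_left_mono[OF w popvar_nonneg[of g']] by (simp add: ennreal_mult[symmetric] mult_exp_exp flip: ennreal_1)
    finally show "(\<integral>\<^sup>+\<omega>. indicator (space M) \<omega> * ennreal (exp (\<Sum>j\<in>?J. g j * ?X j \<omega> - \<sigma> j * (g j)\<^sup>2 / 2)) \<partial>M) \<le> 1" .
  qed (use \<theta> in auto)
  moreover have "(\<Sum>j\<in>?J. \<sigma> j) \<le> eigen_sum"
    unfolding eigen_sum_def by (intro sum_mono2) (auto simp: \<sigma>_nonneg)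
  then have "prob {\<omega> \<in> space M. 2 * eigen_sum + 4 * \<theta> * u \<le> (\<Sum>j\<in>?J. (?X j \<omega>)\<^sup>2)}
    \<le> prob {\<omega> \<in> space M. \<omega> \<in> space M \<and> 2 * (\<Sum>j\<in>?J. \<sigma> j) + 4 * \<theta> * u \<le> (\<Sum>j\<in>?J. (?X j \<omega>)\<^sup>2)}"
    using meas by (intro finite_measure_mono) auto
  ultimately show ?thesis by linarith
qed

text \<open>On the span of the small eigenvalues only an upper bound is needed. Taking the net in the
  sample space \<open>\<real>\<^sup>n\<close> keeps the estimate free of the ambient dimension.\<close>

lemma tail_form_bound:
  fixes \<theta> u :: real
  assumes \<theta>: "0 < \<theta>" "\<And>j. k0 \<le> j \<Longrightarrow> j < d \<Longrightarrow> \<sigma> j \<le> \<theta>"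
  shows "holds_except (net_const ^ n * exp (- u))
    (\<lambda>\<omega>. \<forall>x. (\<Sum>k<n. (lin (tail_part k0 x) k \<omega>)\<^sup>2) \<le> (4 * eigen_sum + 8 * \<theta> * u) * sqnorm d (tail_part k0 x))"
proof -
  obtain N where N: "finite N" "real (card N) \<le> net_const ^ n" "\<forall>y\<in>N. sqnorm n y \<le> 1"
    "\<forall>x. sqnorm n x \<le> 1 \<longrightarrow> (\<exists>y\<in>N. sqnorm n (\<lambda>i. x i - y i) \<le> 1/16)"
    using ball_net[of n] by blast
  let ?J = "{k0..<d}"
  let ?Z = "\<lambda>w \<omega>. \<Sum>j\<in>?J. (\<Sum>k<n. w k * H k \<omega> j)\<^sup>2"
  let ?M = "2 * eigen_sum + 4 * \<theta> * u"
  have meas: "?Z w \<in> borel_measurable M" for w by measurable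
  have "holds_except (real (card N) * exp (- u)) (\<lambda>\<omega>. \<forall>w\<in>N. \<not> ?M \<le> ?Z w \<omega>)"
    using N meas weighted_sum_tail[OF \<theta>] by (intro holds_except_Ball holds_except_Collect) auto
  then show ?thesis
  proof (rule holds_except_mono)
    show "real (card N) * exp (- u) \<le> net_const ^ n * exp (- u)" using N by (intro mult_right_mono) auto
    fix \<omega> assume good: "\<forall>w\<in>N. \<not> ?M \<le> ?Z w \<omega>"
    define B where "B k l = (\<Sum>j\<in>?J. H k \<omega> j * H l \<omega> j)" for k l
    have form: "bilin n B w w = ?Z w \<omega>" for w
    proof -
      have "bilin n B w w = (\<Sum>k<n. \<Sum>l<n. \<Sum>j\<in>?J. (w k * H k \<omega> j) * (w l * H l \<omega> j))"
        unfolding bilin_def B_def by (simp add: sum_distrib_left sum_distrib_right mult_ac)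
      also have "\<dots> = (\<Sum>j\<in>?J. \<Sum>k<n. \<Sum>l<n. (w k * H k \<omega> j) * (w l * H l \<omega> j))" by (rule sum_rotate[symmetric])
      also have "\<dots> = ?Z w \<omega>" by (simp add: power2_eq_square sum_product)
      finally show ?thesis .
    qed
    have Z: "?Z w \<omega> \<le> 2 * ?M * sqnorm n w" for w
    proof -
      have "\<bar>bilin n B w w\<bar> \<le> 2 * ?M * sqnorm n w"
      proof (rule form_bound_from_net)
        show "B i j = B j i" for i j by (simp add: B_def mult.commute)
        show "\<bar>bilin n B y y\<bar> \<le> ?M" if "y \<in> N" for y
          using good that by (subst form) (auto simp: sum_nonneg)
      qed (use N in auto)
      then show ?thesis by (simp add: form)
    qed
    show "\<forall>x. (\<Sum>k<n. (lin (tail_part k0 x) k \<omega>)\<^sup>2) \<le> (4 * eigen_sum + 8 * \<theta> * u) * sqnorm d (tail_part k0 x)"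
    proof
      fix x
      define y where "y = tail_part k0 x"
      define w where "w k = lin y k \<omega>" for k
      have lin_y: "lin y k \<omega> = (\<Sum>j\<in>?J. y j * H k \<omega> j)" for k
        unfolding lin_def by (rule sum.mono_neutral_right) (auto simp: y_def tail_part_def)
      have sq_y: "sqnorm d y = (\<Sum>j\<in>?J. (y j)\<^sup>2)"
        unfolding sqnorm_def by (rule sum.mono_neutral_right) (auto simp: y_def tail_part_def)
      \<comment> \<open>Testing the dual form at the vector of values \<open>w\<close> itself bounds its length.\<close>
      have "sqnorm n w = (\<Sum>k<n. \<Sum>j\<in>?J. w k * (y j * H k \<omega> j))"
        unfolding sqnorm_def power2_eq_square by (subst (2) w_def) (simp add: lin_y sum_distrib_left)
      also have "\<dots> = (\<Sum>j\<in>?J. y j * (\<Sum>k<n. w k * H k \<omega> j))"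
        unfolding sum_distrib_left by (subst sum.swap) (simp add: mult_ac)
      finally have "(sqnorm n w)\<^sup>2 = (\<Sum>j\<in>?J. y j * (\<Sum>k<n. w k * H k \<omega> j))\<^sup>2" by simp
      also have "\<dots> \<le> sqnorm d y * ?Z w \<omega>" unfolding sq_y by (rule Cauchy_Schwarz_ineq_sum)
      also have "\<dots> \<le> sqnorm d y * (2 * ?M * sqnorm n w)" by (intro mult_left_mono Z sqnorm_nonneg)
      finally have "sqnorm n w * sqnorm n w \<le> (2 * ?M * sqnorm d y) * sqnorm n w"
        by (simp add: power2_eq_square mult_ac)
      then have "sqnorm n w \<le> 2 * ?M * sqnorm d y"
      proof (cases "sqnorm n w = 0")
        case True
        have "0 \<le> ?M"
        proof (cases "N = {}")
          case True
          then show ?thesis using N(4)[rule_format, of "\<lambda>_. 0"] by (simp add: sqnorm_def)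
        next
          case False
          then obtain v where "v \<in> N" by auto
          moreover have "0 \<le> ?Z v \<omega>" by (intro sum_nonneg) simp
          ultimately show ?thesis using good by (meson linear order_trans)
        qed
        then show ?thesis using True sqnorm_nonneg[of d y] by simp
      next
        case False
        then have "0 < sqnorm n w" using sqnorm_nonneg[of n w] by simp
        moreover assume "sqnorm n w * sqnorm n w \<le> (2 * ?M * sqnorm d y) * sqnorm n w"
        ultimately show ?thesis by (simp only: mult_le_cancel_right_pos)
      qed
      then show "(\<Sum>k<n. (lin (tail_part k0 x) k \<omega>)\<^sup>2) \<le> (4 * eigen_sum + 8 * \<theta> * u) * sqnorm d (tail_part k0 x)"
        by (simp add: sqnorm_def w_def y_def mult.assoc)
    qed
  qed
qed

text \<open>On the few large eigenvalues a net of their span and the two-sided chi-square bound give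
  the two-sided estimate.\<close>

lemma head_form_bound:
  fixes t :: real
  assumes k0: "k0 \<le> d" and t: "0 \<le> t" "t \<le> 1"
  shows "holds_except (net_const ^ k0 * (2 * exp (- (n * t\<^sup>2 / 16))))
    (\<lambda>\<omega>. \<forall>x. \<bar>(\<Sum>k<n. (lin (head_part k0 x) k \<omega>)\<^sup>2) / n - popvar (head_part k0 x)\<bar>
         \<le> 2 * (\<sigma> 0 * t) * sqnorm d (head_part k0 x))"
proof -
  obtain N where N: "finite N" "real (card N) \<le> net_const ^ k0" "\<forall>y\<in>N. sqnorm k0 y \<le> 1"
    "\<forall>x. sqnorm k0 x \<le> 1 \<longrightarrow> (\<exists>y\<in>N. sqnorm k0 (\<lambda>i. x i - y i) \<le> 1/16)"
    using ball_net[of k0] by blast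
  have restrict: "(\<Sum>j<d. f j) = (\<Sum>j<k0. f j)" if "\<And>j. k0 \<le> j \<Longrightarrow> f j = 0" for f :: "nat \<Rightarrow> real"
    using k0 that by (intro sum.mono_neutral_right) auto
  let ?S = "\<lambda>y \<omega>. (\<Sum>k<n. (lin (head_part k0 y) k \<omega>)\<^sup>2)"
  let ?E = "\<lambda>y \<omega>. n * \<sigma> 0 * t \<le> \<bar>?S y \<omega> - n * popvar (head_part k0 y)\<bar>"
  have sq: "sqnorm d (head_part k0 x) = sqnorm k0 x" for x
    unfolding sqnorm_def by (subst restrict) (auto simp: head_part_def)
  have "holds_except (real (card N) * (2 * exp (- (n * t\<^sup>2 / 16)))) (\<lambda>\<omega>. \<forall>y\<in>N. \<not> ?E y \<omega>)"
  proof (intro holds_except_Ball holds_except_Collect N(1))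
    fix y assume y: "y \<in> N"
    show "{\<omega> \<in> space M. ?E y \<omega>} \<in> sets M" by measurable
    have "popvar (head_part k0 y) \<le> \<sigma> 0 * sqnorm d (head_part k0 y)"
      unfolding popvar_def sqnorm_def sum_distrib_left using \<sigma>_le_top by (intro sum_mono mult_right_mono) auto
    also have "\<dots> \<le> \<sigma> 0 * 1" using N(3) y \<sigma>_top by (intro mult_left_mono) (auto simp: sq)
    finally have le: "popvar (head_part k0 y) \<le> \<sigma> 0" by simp
    show "prob {\<omega> \<in> space M. ?E y \<omega>} \<le> 2 * exp (- (n * t\<^sup>2 / 16))"
      using chi_square_concentration[OF finite_lessThan indep_lin, of "head_part k0 y" "popvar (head_part k0 y)" "\<sigma> 0" t]
        gauss_lin le \<sigma>_top t by simp
  qed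
  then show ?thesis
  proof (rule holds_except_mono)
    show "real (card N) * (2 * exp (- (n * t\<^sup>2 / 16))) \<le> net_const ^ k0 * (2 * exp (- (n * t\<^sup>2 / 16)))"
      using N by (intro mult_right_mono) auto
    fix \<omega> assume good: "\<forall>y\<in>N. \<not> ?E y \<omega>"
    define B where "B i j = (\<Sum>k<n. H k \<omega> i * H k \<omega> j) / n - (if i = j then \<sigma> i else 0)" for i j
    have form: "bilin k0 B x x = ?S x \<omega> / n - popvar (head_part k0 x)" for x
    proof -
      have l: "lin (head_part k0 x) k \<omega> = (\<Sum>j<k0. x j * H k \<omega> j)" for k
        unfolding lin_def by (subst restrict) (auto simp: head_part_def)
      have "bilin k0 B x x = (\<Sum>i<k0. \<Sum>j<k0. \<Sum>k<n. (x i * H k \<omega> i) * (x j * H k \<omega> j) / n)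
          - (\<Sum>i<k0. \<Sum>j<k0. if i = j then \<sigma> i * (x i)\<^sup>2 else 0)"
        unfolding bilin_def B_def sum_subtractf[symmetric]
        by (intro sum.cong refl) (simp add: sum_distrib_left sum_distrib_right sum_divide_distrib algebra_simps power2_eq_square)
      also have "(\<Sum>i<k0. \<Sum>j<k0. if i = j then \<sigma> i * (x i)\<^sup>2 else 0) = popvar (head_part k0 x)"
        unfolding popvar_def by (subst restrict) (auto simp: head_part_def)
      also have "(\<Sum>i<k0. \<Sum>j<k0. \<Sum>k<n. (x i * H k \<omega> i) * (x j * H k \<omega> j) / n)
        = (\<Sum>i<k0. \<Sum>k<n. \<Sum>j<k0. (x i * H k \<omega> i) * (x j * H k \<omega> j) / n)"
        by (intro sum.cong refl sum.swap)
      also have "\<dots> = (\<Sum>k<n. \<Sum>i<k0. \<Sum>j<k0. (x i * H k \<omega> i) * (x j * H k \<omega> j) / n)"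
        by (rule sum.swap)
      also have "\<dots> = ?S x \<omega> / n"
        by (simp add: l power2_eq_square sum_product sum_divide_distrib)
      finally show ?thesis .
    qed
    show "\<forall>x. \<bar>?S x \<omega> / n - popvar (head_part k0 x)\<bar> \<le> 2 * (\<sigma> 0 * t) * sqnorm d (head_part k0 x)"
      unfolding sq form[symmetric]
    proof (intro allI form_bound_from_net)
      show "B i j = B j i" for i j by (simp add: B_def mult.commute)
      show "\<bar>bilin k0 B y y\<bar> \<le> \<sigma> 0 * t" if "y \<in> N" for y
      proof -
        have "\<bar>?S y \<omega> - n * popvar (head_part k0 y)\<bar> \<le> n * (\<sigma> 0 * t)" using good that by (auto simp: mult.assoc)
        then have "\<bar>?S y \<omega> - n * popvar (head_part k0 y)\<bar> / n \<le> \<sigma> 0 * t"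
          using n_pos by (simp add: pos_divide_le_eq mult.commute)
        moreover have "?S y \<omega> / n - popvar (head_part k0 y) = (?S y \<omega> - n * popvar (head_part k0 y)) / n"
          using n_pos by (simp add: field_simps)
        ultimately show ?thesis by (simp add: form)
      qed
    qed (use N in auto)
  qed
qed

end

section \<open>Concentration in operator norm and the good event\<close>

text \<open>The unit added to \<open>ln net_const\<close> leaves a factor \<open>exp (- n)\<close> after the union bound over the net
  in the sample space.\<close>
definition net_entropy :: real where "net_entropy = ln net_const + 1"

text \<open>The threshold \<open>\<theta>\<close>, relative to \<open>\<sigma>\<^sub>1\<close>, that separates large from small eigenvalues. It is
  chosen so that the tail form, of size \<open>8 \<theta> * net_entropy\<close>, is of order \<open>\<eta>\<^sup>2\<close>.\<close>
definition head_cutoff :: "real \<Rightarrow> real" where "head_cutoff \<eta> = \<eta>\<^sup>2 / (2048 * net_entropy)"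

text \<open>An upper bound on \<open>m / n\<close> under which the entropy \<open>(m / \<theta>) * net_entropy\<close> of the net for
  the large eigenvalues and the target exponent \<open>8 m\<close> together stay below the chi-square exponent
  \<open>n \<eta>\<^sup>2 / 1024\<close>.\<close>
definition max_ratio :: "real \<Rightarrow> real" where
  "max_ratio \<eta> = (\<eta>\<^sup>2 / 1024) / (net_entropy / head_cutoff \<eta> + 8)"

lemma net_entropy_ge: "1 \<le> net_entropy"
  by (simp add: net_entropy_def net_const_def)

lemma net_const_exp: "net_const ^ k \<le> exp (k * net_entropy)"
proof -
  have "net_const ^ k = exp (k * ln net_const)"
    by (simp add: exp_of_nat_mult net_const_def)
  also have "\<dots> \<le> exp (k * net_entropy)" by (simp add: net_entropy_def mult_left_mono)
  finally show ?thesis .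
qed

lemma net_const_exp_minus: "net_const ^ k * exp (- (net_entropy * k)) \<le> exp (- real k)"
proof -
  have "net_const ^ k * exp (- (net_entropy * k)) = exp (k * ln net_const) * exp (- (net_entropy * k))"
    by (simp add: exp_of_nat_mult net_const_def)
  also have "\<dots> = exp (- real k)" by (simp add: mult_exp_exp net_entropy_def algebra_simps)
  finally show ?thesis by simp
qed

context
  fixes \<eta> :: real assumes \<eta>: "0 < \<eta>" "\<eta> \<le> 1"
begin

lemma eta_sq_le: "\<eta>\<^sup>2 \<le> \<eta>"
  using \<eta> by (simp add: power2_eq_square mult_left_le)

lemma head_cutoff_pos: "0 < head_cutoff \<eta>"
  using \<eta> net_entropy_ge by (simp add: head_cutoff_def)

lemma head_cutoff_entropy: "8 * head_cutoff \<eta> * net_entropy = \<eta>\<^sup>2 / 256"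
  using net_entropy_ge by (simp add: head_cutoff_def)

lemma head_cutoff_le: "head_cutoff \<eta> \<le> \<eta> / 8"
proof -
  have "head_cutoff \<eta> * 1 \<le> head_cutoff \<eta> * net_entropy"
    using net_entropy_ge head_cutoff_pos by (intro mult_left_mono) auto
  then show ?thesis using head_cutoff_entropy eta_sq_le \<eta> by linarith
qed

lemma max_ratio_bounds: "0 < max_ratio \<eta>" "max_ratio \<eta> \<le> \<eta>\<^sup>2 / 8192"
  "max_ratio \<eta> * (net_entropy / head_cutoff \<eta> + 8) = \<eta>\<^sup>2 / 1024"
proof -
  define D where "D = net_entropy / head_cutoff \<eta> + 8"
  have "0 \<le> net_entropy / head_cutoff \<eta>" using net_entropy_ge head_cutoff_pos by simp
  then have D: "8 \<le> D" by (simp add: D_def)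
  have "\<eta>\<^sup>2 / 1024 / D \<le> \<eta>\<^sup>2 / 1024 / 8" using D by (intro divide_left_mono) auto
  then show "0 < max_ratio \<eta>" "max_ratio \<eta> \<le> \<eta>\<^sup>2 / 8192"
    "max_ratio \<eta> * (net_entropy / head_cutoff \<eta> + 8) = \<eta>\<^sup>2 / 1024"
    unfolding max_ratio_def D_def[symmetric] using \<eta> D by auto
qed

end

context gaussian_eigen_sample
begin

lemma popvar_head_tail: "popvar x = popvar (head_part k0 x) + popvar (tail_part k0 x)"
  unfolding popvar_def sum.distrib[symmetric]
  by (intro sum.cong refl) (simp add: head_part_def tail_part_def)

lemma sqnorm_head_tail: "sqnorm d x = sqnorm d (head_part k0 x) + sqnorm d (tail_part k0 x)"
  unfolding sqnorm_def sum.distrib[symmetric]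
  by (intro sum.cong refl) (simp add: head_part_def tail_part_def)

lemma lin_head_tail: "lin x k \<omega> = lin (head_part k0 x) k \<omega> + lin (tail_part k0 x) k \<omega>"
  unfolding lin_def sum.distrib[symmetric]
  by (intro sum.cong refl) (simp add: head_part_def tail_part_def)

text \<open>The cross term of head and tail is the geometric mean of a quantity of order \<open>1\<close> and one of order
  \<open>\<eta>\<^sup>2\<close>, hence of order \<open>\<eta>\<close>. This is why the tail has to be small to second order.\<close>
lemma form_combine:
  fixes \<eta> :: real
  assumes \<eta>: "0 < \<eta>" "\<eta> \<le> 1"
    and tail: "\<And>j. k0 \<le> j \<Longrightarrow> j < d \<Longrightarrow> \<sigma> j \<le> \<eta> / 8 * \<sigma> 0"
    and head_err: "\<bar>(\<Sum>k<n. (lin (head_part k0 x) k \<omega>)\<^sup>2) / n - popvar (head_part k0 x)\<bar>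
         \<le> \<eta> / 4 * \<sigma> 0 * sqnorm d (head_part k0 x)"
    and tail_err: "(\<Sum>k<n. (lin (tail_part k0 x) k \<omega>)\<^sup>2) / n \<le> \<eta>\<^sup>2 / 128 * \<sigma> 0 * sqnorm d (tail_part k0 x)"
  shows "\<bar>(\<Sum>k<n. (lin x k \<omega>)\<^sup>2) / n - popvar x\<bar> \<le> \<eta> * \<sigma> 0 * sqnorm d x"
proof -
  let ?h = "head_part k0 x" and ?t = "tail_part k0 x"
  define X where "X = \<sigma> 0 * sqnorm d x"
  define P where "P = (\<Sum>k<n. (lin ?h k \<omega>)\<^sup>2) / n"
  define T where "T = (\<Sum>k<n. (lin ?t k \<omega>)\<^sup>2) / n"
  define C where "C = (\<Sum>k<n. lin ?h k \<omega> * lin ?t k \<omega>) / n"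
  have sh: "\<sigma> 0 * sqnorm d ?h \<le> X" and st: "\<sigma> 0 * sqnorm d ?t \<le> X"
    unfolding X_def using sqnorm_head_tail[of x k0] sqnorm_nonneg[of d ?h] sqnorm_nonneg[of d ?t] \<sigma>_top
    by (auto intro!: mult_left_mono)
  have X0: "0 \<le> X" using sqnorm_nonneg[of d x] \<sigma>_top by (simp add: X_def)
  have PT0: "0 \<le> P" "0 \<le> T" by (simp_all add: P_def T_def sum_nonneg)
  have pop_h: "popvar ?h \<le> X"
  proof -
    have "popvar ?h \<le> \<sigma> 0 * sqnorm d ?h"
      unfolding popvar_def sqnorm_def sum_distrib_left using \<sigma>_le_top by (intro sum_mono mult_right_mono) auto
    then show ?thesis using sh by linarith
  qed
  have pop_t: "popvar ?t \<le> \<eta> / 8 * X"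
  proof -
    have "popvar ?t \<le> \<eta> / 8 * \<sigma> 0 * sqnorm d ?t"
      unfolding popvar_def sqnorm_def sum_distrib_left
    proof (intro sum_mono)
      fix j assume "j \<in> {..<d}"
      then show "\<sigma> j * (?t j)\<^sup>2 \<le> \<eta> / 8 * \<sigma> 0 * (?t j)\<^sup>2"
      proof (cases "k0 \<le> j")
        case True
        then show ?thesis using \<open>j \<in> {..<d}\<close> by (intro mult_right_mono tail) auto
      qed (simp add: tail_part_def)
    qed
    also have "\<dots> \<le> \<eta> / 8 * X" using mult_left_mono[OF st, of "\<eta> / 8"] \<eta> by (simp add: mult_ac)
    finally show ?thesis .
  qed
  have "\<bar>P - popvar ?h\<bar> \<le> \<eta> / 4 * (\<sigma> 0 * sqnorm d ?h)"
    using head_err by (simp only: P_def mult.assoc)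
  also have "\<dots> \<le> \<eta> / 4 * X" using \<eta> by (intro mult_left_mono sh) auto
  finally have dP: "\<bar>P - popvar ?h\<bar> \<le> \<eta> / 4 * X" .
  have TX: "T \<le> \<eta>\<^sup>2 / 128 * X"
    using tail_err mult_left_mono[OF st, of "\<eta>\<^sup>2 / 128"] by (simp add: T_def mult_ac)
  have "P \<le> 2 * X"
  proof -
    have "\<eta> / 4 * X \<le> 1 * X" using \<eta> X0 by (intro mult_right_mono) auto
    then show ?thesis using dP pop_h by linarith
  qed
  then have "P * T \<le> (2 * X) * (\<eta>\<^sup>2 / 128 * X)" using TX PT0 X0 by (intro mult_mono) auto
  also have "\<dots> = (\<eta> / 8 * X)\<^sup>2" by (simp add: power2_eq_square)
  finally have PT: "P * T \<le> (\<eta> / 8 * X)\<^sup>2" .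
  have "C\<^sup>2 \<le> P * T"
  proof -
    have "(\<Sum>k<n. lin ?h k \<omega> * lin ?t k \<omega>)\<^sup>2 \<le> (\<Sum>k<n. (lin ?h k \<omega>)\<^sup>2) * (\<Sum>k<n. (lin ?t k \<omega>)\<^sup>2)"
      by (rule Cauchy_Schwarz_ineq_sum)
    then show ?thesis using n_pos by (simp add: C_def P_def T_def power_divide power2_eq_square divide_right_mono)
  qed
  then have "C\<^sup>2 \<le> (\<eta> / 8 * X)\<^sup>2" using PT by linarith
  then have C: "\<bar>C\<bar> \<le> \<eta> / 8 * X" using \<eta> X0 by (simp only: abs_le_square_iff[symmetric]) simp
  have split: "(\<Sum>k<n. (lin x k \<omega>)\<^sup>2) / n = P + 2 * C + T"
    unfolding P_def C_def T_def
    by (simp add: lin_head_tail[of x _ \<omega> k0] power2_sum sum.distrib sum_distrib_left add_divide_distrib mult_ac)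
  have eX: "\<eta>\<^sup>2 * X \<le> \<eta> * X" using eta_sq_le[OF \<eta>] X0 by (rule mult_right_mono)
  define E where "E = \<eta> * X"
  have "\<bar>P - popvar ?h\<bar> \<le> E / 4" "\<bar>C\<bar> \<le> E / 8" "popvar ?t \<le> E / 8" "T \<le> E / 128" "0 \<le> E"
    using dP C pop_t TX eX \<eta> X0 by (simp_all add: E_def)
  then have "\<bar>P + 2 * C + T - (popvar ?h + popvar ?t)\<bar> \<le> E"
    using PT0(2) popvar_nonneg[of ?t] by linarith
  then have "\<bar>P + 2 * C + T - (popvar ?h + popvar ?t)\<bar> \<le> \<eta> * X" by (simp add: E_def)
  then show ?thesis unfolding split popvar_head_tail[of x k0] X_def by (simp add: mult.assoc)
qed

text \<open>As only a constant tolerance \<open>\<eta>\<close> is required, the threshold between large and small eigenvalues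
  can be a constant multiple of \<open>\<sigma> 0\<close>. The ambient dimension \<open>d\<close> then does not enter: the large
  eigenvalues span at most \<open>m / \<theta>\<close> dimensions and the small ones are handled in the sample space.\<close>

lemma operator_norm_concentration:
  assumes \<eta>: "0 < \<eta>" "\<eta> \<le> 1" and m: "0 \<le> m" "eigen_sum \<le> m * \<sigma> 0" "m \<le> max_ratio \<eta> * n"
  shows "holds_except (3 * exp (- 8 * m))
    (\<lambda>\<omega>. \<forall>x. \<bar>(\<Sum>k<n. (lin x k \<omega>)\<^sup>2) / n - popvar x\<bar> \<le> \<eta> * \<sigma> 0 * sqnorm d x)"
proof -
  define \<theta> where "\<theta> = head_cutoff \<eta>"
  note \<theta> = head_cutoff_pos[OF \<eta>, folded \<theta>_def] head_cutoff_entropy[OF \<eta>, folded \<theta>_def] head_cutoff_le[OF \<eta>, folded \<theta>_def]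
  note mr = max_ratio_bounds[OF \<eta>, folded \<theta>_def]
  \<comment> \<open>The number of eigenvalues above the threshold; it is at most \<open>m / \<theta>\<close> because they
    sum to at most \<open>m \<sigma>\<^sub>1\<close>.\<close>
  define k0 where "k0 = (LEAST j. j = d \<or> \<sigma> j \<le> \<theta> * \<sigma> 0)"
  have k0: "k0 = d \<or> \<sigma> k0 \<le> \<theta> * \<sigma> 0" "k0 \<le> d"
    unfolding k0_def by (rule LeastI[of _ d], simp, rule Least_le, simp)
  have below: "\<theta> * \<sigma> 0 < \<sigma> j" if "j < k0" for j
    using not_less_Least[OF that[unfolded k0_def]] by auto
  have above: "\<sigma> j \<le> \<theta> * \<sigma> 0" if "k0 \<le> j" "j < d" for j
    using k0(1) \<sigma>_antimono[OF that] that by linarith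
  have "real k0 * (\<theta> * \<sigma> 0) \<le> m * \<sigma> 0"
  proof -
    have "real k0 * (\<theta> * \<sigma> 0) = (\<Sum>j<k0. \<theta> * \<sigma> 0)" by simp
    also have "\<dots> \<le> (\<Sum>j<k0. \<sigma> j)" using below by (intro sum_mono) (auto intro: less_imp_le)
    also have "\<dots> \<le> eigen_sum" unfolding eigen_sum_def using k0(2) by (intro sum_mono2) (auto simp: \<sigma>_nonneg)
    finally show ?thesis using m(2) by linarith
  qed
  then have "(real k0 * \<theta>) * \<sigma> 0 \<le> m * \<sigma> 0" by (simp only: mult.assoc)
  then have "real k0 * \<theta> \<le> m" using \<sigma>_top by (simp only: mult_le_cancel_right_pos)
  then have k0_le: "real k0 \<le> m / \<theta>" using \<theta>(1) by (simp add: pos_le_divide_eq)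
  have eta2: "\<eta>\<^sup>2 \<le> 1" using eta_sq_le[OF \<eta>] \<eta> by linarith
  have mn: "m \<le> \<eta>\<^sup>2 / 8192 * n"
    using m(3) mr(2) mult_right_mono[OF mr(2), of "real n"] by linarith
  have m8: "8 * m \<le> n"
    using mn mult_right_mono[OF eta2, of "real n"] by simp
  have head: "holds_except (2 * exp (- 8 * m))
    (\<lambda>\<omega>. \<forall>x. \<bar>(\<Sum>k<n. (lin (head_part k0 x) k \<omega>)\<^sup>2) / n - popvar (head_part k0 x)\<bar>
         \<le> \<eta> / 4 * \<sigma> 0 * sqnorm d (head_part k0 x))"
  proof (rule holds_except_mono[OF head_form_bound[OF k0(2), of "\<eta> / 8"]])
    have "real k0 * net_entropy \<le> m / \<theta> * net_entropy" using k0_le net_entropy_ge by (intro mult_right_mono) auto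
    moreover have "m * (net_entropy / \<theta> + 8) \<le> (max_ratio \<eta> * n) * (net_entropy / \<theta> + 8)"
      using m(3) \<theta>(1) net_entropy_ge by (intro mult_right_mono) auto
    moreover have "(max_ratio \<eta> * n) * (net_entropy / \<theta> + 8) = n * (\<eta>\<^sup>2 / 1024)" unfolding mr(3)[symmetric] by simp
    moreover have "m * (net_entropy / \<theta> + 8) = m / \<theta> * net_entropy + 8 * m" by (simp add: algebra_simps)
    ultimately have "real k0 * net_entropy + - (n * (\<eta>\<^sup>2 / 1024)) \<le> - 8 * m" by linarith
    then have "exp (real k0 * net_entropy) * exp (- (n * (\<eta>\<^sup>2 / 1024))) \<le> exp (- 8 * m)" by (simp add: mult_exp_exp)
    moreover have "net_const ^ k0 * exp (- (n * (\<eta>\<^sup>2 / 1024))) \<le> exp (real k0 * net_entropy) * exp (- (n * (\<eta>\<^sup>2 / 1024)))"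
      by (intro mult_right_mono net_const_exp) simp
    ultimately have "net_const ^ k0 * exp (- (n * (\<eta>\<^sup>2 / 1024))) \<le> exp (- 8 * m)" by linarith
    then show "net_const ^ k0 * (2 * exp (- (n * (\<eta> / 8)\<^sup>2 / 16))) \<le> 2 * exp (- 8 * m)"
      by (simp add: power_divide)
  qed (use \<eta> in \<open>auto simp: mult_ac\<close>)
  have tail: "holds_except (exp (- 8 * m))
    (\<lambda>\<omega>. \<forall>x. (\<Sum>k<n. (lin (tail_part k0 x) k \<omega>)\<^sup>2) / n \<le> \<eta>\<^sup>2 / 128 * \<sigma> 0 * sqnorm d (tail_part k0 x))"
  proof (rule holds_except_mono[OF tail_form_bound[of "\<theta> * \<sigma> 0" k0 "net_entropy * n"]])
    show "0 < \<theta> * \<sigma> 0" using \<theta>(1) \<sigma>_top by simp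
    show "net_const ^ n * exp (- (net_entropy * n)) \<le> exp (- 8 * m)"
      using net_const_exp_minus[of n] m8 by (intro order_trans[OF net_const_exp_minus]) simp
    fix \<omega> assume t: "\<forall>x. (\<Sum>k<n. (lin (tail_part k0 x) k \<omega>)\<^sup>2)
       \<le> (4 * eigen_sum + 8 * (\<theta> * \<sigma> 0) * (net_entropy * n)) * sqnorm d (tail_part k0 x)"
    have "4 * eigen_sum \<le> 4 * (\<eta>\<^sup>2 / 8192 * n * \<sigma> 0)"
      using m(2) mult_right_mono[OF mn, of "\<sigma> 0"] \<sigma>_top by linarith
    also have "\<dots> \<le> \<eta>\<^sup>2 / 256 * \<sigma> 0 * n" using \<sigma>_top by (simp add: field_simps)
    finally have "4 * eigen_sum \<le> \<eta>\<^sup>2 / 256 * \<sigma> 0 * n" .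
    moreover have "8 * (\<theta> * \<sigma> 0) * (net_entropy * n) = \<eta>\<^sup>2 / 256 * \<sigma> 0 * n"
      unfolding \<theta>(2)[symmetric] by simp
    ultimately have q: "4 * eigen_sum + 8 * (\<theta> * \<sigma> 0) * (net_entropy * n) \<le> \<eta>\<^sup>2 / 128 * \<sigma> 0 * n" by linarith
    show "\<forall>x. (\<Sum>k<n. (lin (tail_part k0 x) k \<omega>)\<^sup>2) / n \<le> \<eta>\<^sup>2 / 128 * \<sigma> 0 * sqnorm d (tail_part k0 x)"
    proof
      fix x
      have "(\<Sum>k<n. (lin (tail_part k0 x) k \<omega>)\<^sup>2) \<le> (\<eta>\<^sup>2 / 128 * \<sigma> 0 * n) * sqnorm d (tail_part k0 x)"
        using t mult_right_mono[OF q sqnorm_nonneg[of d "tail_part k0 x"]] by (meson order_trans)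
      then show "(\<Sum>k<n. (lin (tail_part k0 x) k \<omega>)\<^sup>2) / n \<le> \<eta>\<^sup>2 / 128 * \<sigma> 0 * sqnorm d (tail_part k0 x)"
        using n_pos by (simp add: pos_divide_le_eq mult_ac)
    qed
  qed (use above in auto)
  have "holds_except (2 * exp (- 8 * m) + exp (- 8 * m)) (\<lambda>\<omega>.
      (\<forall>x. \<bar>(\<Sum>k<n. (lin (head_part k0 x) k \<omega>)\<^sup>2) / n - popvar (head_part k0 x)\<bar> \<le> \<eta> / 4 * \<sigma> 0 * sqnorm d (head_part k0 x)) \<and>
      (\<forall>x. (\<Sum>k<n. (lin (tail_part k0 x) k \<omega>)\<^sup>2) / n \<le> \<eta>\<^sup>2 / 128 * \<sigma> 0 * sqnorm d (tail_part k0 x)))"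
    by (rule holds_except_conj[OF head tail])
  then show ?thesis
  proof (rule holds_except_mono)
    fix \<omega>
    assume g: "(\<forall>x. \<bar>(\<Sum>k<n. (lin (head_part k0 x) k \<omega>)\<^sup>2) / n - popvar (head_part k0 x)\<bar> \<le> \<eta> / 4 * \<sigma> 0 * sqnorm d (head_part k0 x)) \<and>
      (\<forall>x. (\<Sum>k<n. (lin (tail_part k0 x) k \<omega>)\<^sup>2) / n \<le> \<eta>\<^sup>2 / 128 * \<sigma> 0 * sqnorm d (tail_part k0 x))"
    show "\<forall>x. \<bar>(\<Sum>k<n. (lin x k \<omega>)\<^sup>2) / n - popvar x\<bar> \<le> \<eta> * \<sigma> 0 * sqnorm d x"
    proof
      fix x
      show "\<bar>(\<Sum>k<n. (lin x k \<omega>)\<^sup>2) / n - popvar x\<bar> \<le> \<eta> * \<sigma> 0 * sqnorm d x"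
      proof (rule form_combine[OF \<eta>])
        show "\<sigma> j \<le> \<eta> / 8 * \<sigma> 0" if "k0 \<le> j" "j < d" for j
          using above[OF that] mult_right_mono[OF \<theta>(3), of "\<sigma> 0"] \<sigma>_top by linarith
      qed (use g in auto)
    qed
  qed simp
qed

text \<open>All the random input to the perturbation argument, on one event.\<close>

lemma good_event:
  assumes \<eta>: "0 < \<eta>" "\<eta> \<le> 1" and m: "0 \<le> m" "eigen_sum \<le> m * \<sigma> 0" "m \<le> max_ratio \<eta> * n" and V: "finite V"
  shows "holds_except ((3 + 3 * real (card V)) * exp (- 8 * m))
    (\<lambda>\<omega>. (\<forall>x. \<bar>(\<Sum>k<n. (lin x k \<omega>)\<^sup>2) / n - popvar x\<bar> \<le> \<eta> * \<sigma> 0 * sqnorm d x) \<and>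
         (\<forall>v\<in>V. sqnorm d (cov_err v \<omega>) \<le> 400 * (popvar v * \<sigma> 0 * (m / n))))"
proof -
  note mr = max_ratio_bounds[OF \<eta>]
  have eta2: "\<eta>\<^sup>2 \<le> 1" using eta_sq_le[OF \<eta>] \<eta> by linarith
  have "m \<le> \<eta>\<^sup>2 / 8192 * n"
    using m(3) mr(2) mult_right_mono[OF mr(2), of "real n"] by linarith
  then have m8: "16 * (8 * m) \<le> n"
    using mult_right_mono[OF eta2, of "real n"] by simp
  have "holds_except (real (card V) * (3 * exp (- 8 * m))) (\<lambda>\<omega>. \<forall>v\<in>V. sqnorm d (cov_err v \<omega>) \<le> 400 * (popvar v * \<sigma> 0 * (m / n)))"
  proof (rule holds_except_Ball[OF V])
    fix v
    have "holds_except (3 * exp (- (8 * m))) (\<lambda>\<omega>. sqnorm d (cov_err v \<omega>) \<le> popvar v * (8 * eigen_sum + 48 * \<sigma> 0 * (8 * m)) / n)"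
      using m m8 by (intro cov_err_concentration) auto
    then show "holds_except (3 * exp (- 8 * m)) (\<lambda>\<omega>. sqnorm d (cov_err v \<omega>) \<le> 400 * (popvar v * \<sigma> 0 * (m / n)))"
    proof (rule holds_except_mono)
      fix \<omega> assume "sqnorm d (cov_err v \<omega>) \<le> popvar v * (8 * eigen_sum + 48 * \<sigma> 0 * (8 * m)) / n"
      also have "\<dots> \<le> popvar v * (400 * (\<sigma> 0 * m)) / n"
      proof (intro divide_right_mono mult_left_mono popvar_nonneg)
        have "0 \<le> \<sigma> 0 * m" using \<sigma>_top m by simp
        then show "8 * eigen_sum + 48 * \<sigma> 0 * (8 * m) \<le> 400 * (\<sigma> 0 * m)" using m(2) by (simp add: mult_ac)
      qed simp
      finally show "sqnorm d (cov_err v \<omega>) \<le> 400 * (popvar v * \<sigma> 0 * (m / n))" by (simp add: mult_ac)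
    qed simp
  qed
  from holds_except_conj[OF operator_norm_concentration[OF \<eta> m] this]
  show ?thesis by (rule holds_except_mono) (auto simp: algebra_simps)
qed

end

section \<open>Perturbation of a diagonal matrix\<close>

text \<open>A zero row turns the system into a square one with vanishing determinant.\<close>
lemma underdetermined_kernel:
  fixes A :: "nat \<Rightarrow> nat \<Rightarrow> real"
  shows "\<exists>\<alpha>. (\<exists>l\<le>m. \<alpha> l \<noteq> 0) \<and> (\<forall>i<m. (\<Sum>l\<le>m. A i l * \<alpha> l) = 0)"
proof -
  let ?N = "Suc m"
  define B where "B = Matrix.mat ?N ?N (\<lambda>(i, l). if i < m then A i l else 0)"
  have B: "B \<in> carrier_mat ?N ?N" by (simp add: B_def)
  have "transpose_mat B *\<^sub>v unit_vec ?N m = 0\<^sub>v ?N"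
  proof (rule eq_vecI)
    fix i assume "i < dim_vec (0\<^sub>v ?N :: real Matrix.vec)"
    then have i: "i < ?N" by simp
    have "(transpose_mat B *\<^sub>v unit_vec ?N m) $ i = Matrix.row (transpose_mat B) i \<bullet> unit_vec ?N m"
      using i by (intro index_mult_mat_vec) (simp add: B_def)
    also have "\<dots> = col B i \<bullet> unit_vec ?N m" using i by (subst Matrix.row_transpose) (simp_all add: B_def)
    also have "\<dots> = col B i $ m" using i B by (subst scalar_prod_right_unit) auto
    also have "\<dots> = 0" using i by (simp add: B_def)
    finally show "(transpose_mat B *\<^sub>v unit_vec ?N m) $ i = 0\<^sub>v ?N $ i" using i by simp
  qed (simp add: B_def)
  moreover have "unit_vec ?N m \<noteq> (0\<^sub>v ?N :: real Matrix.vec)" by (simp add: unit_vec_nonzero)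
  moreover have "transpose_mat B \<in> carrier_mat ?N ?N" using B by simp
  ultimately have "Determinant.det (transpose_mat B) = 0"
    by (subst det_0_iff_vec_prod_zero_field) (auto intro!: exI[of _ "unit_vec ?N m"])
  then have "Determinant.det B = 0" using det_transpose[OF B] by simp
  then obtain v where v: "v \<in> carrier_vec ?N" "v \<noteq> 0\<^sub>v ?N" "B *\<^sub>v v = 0\<^sub>v ?N"
    using det_0_iff_vec_prod_zero_field[OF B] by auto
  have "\<exists>l<?N. v $ l \<noteq> 0"
    using v(1,2) by (metis carrier_vecD eq_vecI index_zero_vec(1) index_zero_vec(2))
  moreover have "(\<Sum>l\<le>m. A i l * v $ l) = 0" if i: "i < m" for i
  proof -
    have "(B *\<^sub>v v) $ i = (\<Sum>l\<in>{0..<?N}. A i l * v $ l)"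
      using i v(1) B by (simp add: scalar_prod_def B_def)
    also have "{0..<?N} = {..m}" by auto
    finally show ?thesis using v(3) i by simp
  qed
  ultimately show ?thesis by (intro exI[of _ "\<lambda>l. v $ l"]) (auto simp: less_Suc_eq_le)
qed

definition dotp :: "nat \<Rightarrow> (nat \<Rightarrow> real) \<Rightarrow> (nat \<Rightarrow> real) \<Rightarrow> real" where
  "dotp d x y = (\<Sum>j<d. x j * y j)"

definition orthonormal_basis :: "nat \<Rightarrow> (nat \<Rightarrow> nat \<Rightarrow> real) \<Rightarrow> bool" where
  "orthonormal_basis d z \<longleftrightarrow>
     (\<forall>b<d. \<forall>c<d. (\<Sum>j<d. z b j * z c j) = (if b = c then 1 else 0)) \<and>
     (\<forall>j<d. \<forall>l<d. (\<Sum>b<d. z b j * z b l) = (if j = l then 1 else 0))"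

lemma orthonormal_basis_std: "orthonormal_basis d (\<lambda>b j. if b = j then 1 else 0)"
  unfolding orthonormal_basis_def by (simp add: if_distrib[of "\<lambda>x. x * _"] cong: if_cong)

lemma dotp_std: "b < d \<Longrightarrow> dotp d (\<lambda>j. if b = j then 1 else 0) x = x b"
  by (simp add: dotp_def if_distrib[of "\<lambda>x. x * _"] cong: if_cong)

lemma parseval_bilinear:
  assumes "orthonormal_basis d z"
  shows "(\<Sum>b<d. dotp d (z b) x * dotp d (z b) y) = dotp d x y"
proof -
  have "(\<Sum>b<d. dotp d (z b) x * dotp d (z b) y) = (\<Sum>b<d. \<Sum>j<d. \<Sum>l<d. (z b j * x j) * (z b l * y l))"
    by (simp add: dotp_def sum_product)
  also have "\<dots> = (\<Sum>j<d. \<Sum>l<d. \<Sum>b<d. (z b j * x j) * (z b l * y l))" by (rule sum_rotate)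
  also have "\<dots> = (\<Sum>j<d. \<Sum>l<d. x j * y l * (\<Sum>b<d. z b j * z b l))" by (simp add: sum_distrib_left mult_ac)
  also have "\<dots> = (\<Sum>j<d. \<Sum>l<d. if j = l then x j * y l else 0)"
    using assms by (intro sum.cong refl) (auto simp: orthonormal_basis_def)
  also have "\<dots> = dotp d x y" by (simp add: dotp_def)
  finally show ?thesis .
qed

lemma parseval:
  assumes "orthonormal_basis d z"
  shows "(\<Sum>b<d. (dotp d (z b) x)\<^sup>2) = sqnorm d x"
  using parseval_bilinear[OF assms, of x x] by (simp add: power2_eq_square sqnorm_def dotp_def)

text \<open>Weyl's inequality, one-sided: the span of the first \<open>j + 1\<close> vectors of one basis meets the
  orthogonal complement of the first \<open>j\<close> vectors of the other.\<close>

lemma weyl_inequality: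
  fixes \<mu> \<mu>' :: "nat \<Rightarrow> real" and e :: real
  assumes p: "orthonormal_basis d p" and q: "orthonormal_basis d q" and j: "j < d"
    and mono: "\<And>i. i \<le> j \<Longrightarrow> \<mu> j \<le> \<mu> i" "\<And>i. j \<le> i \<Longrightarrow> i < d \<Longrightarrow> \<mu>' i \<le> \<mu>' j"
    and le: "\<And>x. (\<Sum>b<d. \<mu> b * (dotp d (p b) x)\<^sup>2) \<le> (\<Sum>b<d. \<mu>' b * (dotp d (q b) x)\<^sup>2) + e * sqnorm d x"
  shows "\<mu> j \<le> \<mu>' j + e"
proof -
  \<comment> \<open>The coefficients of a vector in the span of \<open>p 0, \<dots>, p j\<close> orthogonal to \<open>q 0, \<dots>, q (j - 1)\<close>.\<close>
  obtain \<alpha> where \<alpha>: "\<exists>l\<le>j. \<alpha> l \<noteq> 0" "\<And>i. i < j \<Longrightarrow> (\<Sum>l\<le>j. dotp d (q i) (p l) * \<alpha> l) = 0"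
    using underdetermined_kernel[of j "\<lambda>i l. dotp d (q i) (p l)"] by blast
  define x where "x i = (\<Sum>l\<le>j. \<alpha> l * p l i)" for i
  have dotp_x: "dotp d y x = (\<Sum>l\<le>j. dotp d y (p l) * \<alpha> l)" for y
    unfolding dotp_def x_def sum_distrib_left sum_distrib_right by (subst sum.swap) (simp add: mult_ac)
  have px: "dotp d (p b) x = (if b \<le> j then \<alpha> b else 0)" if b: "b < d" for b
  proof -
    have "dotp d (p b) x = (\<Sum>l\<le>j. if b = l then \<alpha> l else 0)"
      unfolding dotp_x using b j p by (intro sum.cong refl) (auto simp: orthonormal_basis_def dotp_def)
    then show ?thesis by simp
  qed
  have sub: "(\<Sum>b<d. if b \<le> j then f b else 0) = (\<Sum>b\<le>j. f b)" for f :: "nat \<Rightarrow> real"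
    using j by (intro sum.mono_neutral_cong_right) auto
  have sq: "sqnorm d x = (\<Sum>b\<le>j. (\<alpha> b)\<^sup>2)"
    unfolding parseval[OF p, symmetric] sub[symmetric] by (intro sum.cong refl) (simp add: px)
  have pos: "0 < sqnorm d x"
  proof -
    obtain l where l: "l \<le> j" "\<alpha> l \<noteq> 0" using \<alpha>(1) by blast
    have "(\<alpha> l)\<^sup>2 \<le> (\<Sum>b\<le>j. (\<alpha> b)\<^sup>2)" using l by (intro member_le_sum) auto
    then show ?thesis unfolding sq using l by (smt (verit) zero_less_power2)
  qed
  have "\<mu> j * sqnorm d x = (\<Sum>b\<le>j. \<mu> j * (\<alpha> b)\<^sup>2)" by (simp add: sq sum_distrib_left)
  also have "\<dots> \<le> (\<Sum>b\<le>j. \<mu> b * (\<alpha> b)\<^sup>2)" by (intro sum_mono mult_right_mono mono) auto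
  also have "\<dots> = (\<Sum>b<d. \<mu> b * (dotp d (p b) x)\<^sup>2)"
    unfolding sub[symmetric] by (intro sum.cong refl) (simp add: px)
  also have "\<dots> \<le> (\<Sum>b<d. \<mu>' b * (dotp d (q b) x)\<^sup>2) + e * sqnorm d x" by (rule le)
  also have "(\<Sum>b<d. \<mu>' b * (dotp d (q b) x)\<^sup>2) \<le> (\<Sum>b<d. \<mu>' j * (dotp d (q b) x)\<^sup>2)"
  proof (intro sum_mono)
    fix b assume b: "b \<in> {..<d}"
    show "\<mu>' b * (dotp d (q b) x)\<^sup>2 \<le> \<mu>' j * (dotp d (q b) x)\<^sup>2"
    proof (cases "b < j")
      case True
      then show ?thesis using \<alpha>(2)[of b] by (simp add: dotp_x)
    next
      case False
      then show ?thesis using b mono(2)[of b] by (intro mult_right_mono) auto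
    qed
  qed
  also have "\<dots> = \<mu>' j * sqnorm d x" by (simp add: sum_distrib_left[symmetric] parseval[OF q])
  finally have "\<mu> j * sqnorm d x \<le> (\<mu>' j + e) * sqnorm d x" by (simp add: algebra_simps)
  then show ?thesis using pos by (simp only: mult_le_cancel_right_pos)
qed

text \<open>An orthogonal matrix has the same Frobenius mass in its two off-diagonal blocks. It lets
  Davis and Kahan's bound, which controls the lower left block, be used for the upper right one.\<close>
lemma block_mass:
  assumes z: "orthonormal_basis d z" and r: "r \<le> d"
  shows "(\<Sum>b<r. \<Sum>a\<in>{r..<d}. (z b a)\<^sup>2) = r - (\<Sum>a<r. \<Sum>b<r. (z b a)\<^sup>2)"
    and "(\<Sum>a<r. \<Sum>b\<in>{r..<d}. (z b a)\<^sup>2) = r - (\<Sum>a<r. \<Sum>b<r. (z b a)\<^sup>2)"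
proof -
  have split: "(\<Sum>a<d. f a) = (\<Sum>a<r. f a) + (\<Sum>a\<in>{r..<d}. f a)" for f :: "nat \<Rightarrow> real"
    using r by (simp add: sum.atLeastLessThan_concat[of 0 r d f, symmetric] lessThan_atLeast0)
  have "(\<Sum>a\<in>{r..<d}. (z b a)\<^sup>2) = 1 - (\<Sum>a<r. (z b a)\<^sup>2)" if "b < r" for b
    using z r that split[of "\<lambda>a. (z b a)\<^sup>2"] by (auto simp: orthonormal_basis_def power2_eq_square)
  then have "(\<Sum>b<r. \<Sum>a\<in>{r..<d}. (z b a)\<^sup>2) = (\<Sum>b<r. 1 - (\<Sum>a<r. (z b a)\<^sup>2))" by (intro sum.cong) auto
  then show "(\<Sum>b<r. \<Sum>a\<in>{r..<d}. (z b a)\<^sup>2) = r - (\<Sum>a<r. \<Sum>b<r. (z b a)\<^sup>2)"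
    using sum.swap[of "\<lambda>b a. (z b a)\<^sup>2" "{..<r}" "{..<r}"] by (simp add: sum_subtractf)
  have "(\<Sum>b\<in>{r..<d}. (z b a)\<^sup>2) = 1 - (\<Sum>b<r. (z b a)\<^sup>2)" if "a < r" for a
    using z r that split[of "\<lambda>b. (z b a)\<^sup>2"] by (auto simp: orthonormal_basis_def power2_eq_square)
  then have "(\<Sum>a<r. \<Sum>b\<in>{r..<d}. (z b a)\<^sup>2) = (\<Sum>a<r. 1 - (\<Sum>b<r. (z b a)\<^sup>2))" by (intro sum.cong) auto
  then show "(\<Sum>a<r. \<Sum>b\<in>{r..<d}. (z b a)\<^sup>2) = r - (\<Sum>a<r. \<Sum>b<r. (z b a)\<^sup>2)" by (simp add: sum_subtractf)
qed

text \<open>\<open>G\<close> has the orthonormal eigenvectors \<open>z b\<close> with eigenvalues \<open>\<sigma>' b\<close> and is compared with the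
  diagonal matrix of the \<open>\<sigma> j\<close>. In the application \<open>z b j\<close> is the inner product of the \<open>j\<close>-th
  population and the \<open>b\<close>-th sample eigenvector.\<close>
locale perturbed_diagonal =
  fixes d r :: nat and \<sigma> \<sigma>' :: "nat \<Rightarrow> real" and z G :: "nat \<Rightarrow> nat \<Rightarrow> real"
  assumes r: "0 < r" "r < d"
    and \<sigma>_nonneg: "\<And>j. j < d \<Longrightarrow> 0 \<le> \<sigma> j"
    and \<sigma>_anti: "\<And>i j. i \<le> j \<Longrightarrow> j < d \<Longrightarrow> \<sigma> j \<le> \<sigma> i"
    and \<sigma>'_anti: "\<And>i j. i \<le> j \<Longrightarrow> j < d \<Longrightarrow> \<sigma>' j \<le> \<sigma>' i"
    and z: "orthonormal_basis d z"
    and G: "\<And>j l. j < d \<Longrightarrow> l < d \<Longrightarrow> G j l = (\<Sum>b<d. \<sigma>' b * z b j * z b l)"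
begin

definition err :: "(nat \<Rightarrow> real) \<Rightarrow> nat \<Rightarrow> real" where
  "err v j = (\<Sum>l<d. G j l * v l) - \<sigma> j * v j"

lemma G_eigen:
  assumes b: "b < d" shows "(\<Sum>l<d. z b l * (\<Sum>i<d. G l i * v i)) = \<sigma>' b * dotp d (z b) v"
proof -
  have Gz: "(\<Sum>l<d. G l i * z b l) = \<sigma>' b * z b i" if i: "i < d" for i
  proof -
    have "(\<Sum>l<d. G l i * z b l) = (\<Sum>l<d. \<Sum>c<d. \<sigma>' c * z c i * (z c l * z b l))"
      by (intro sum.cong refl) (simp add: G i sum_distrib_left sum_distrib_right mult_ac)
    also have "\<dots> = (\<Sum>c<d. \<sigma>' c * z c i * (\<Sum>l<d. z c l * z b l))"
      unfolding sum_distrib_left by (rule sum.swap)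
    also have "\<dots> = (\<Sum>c<d. if c = b then \<sigma>' c * z c i else 0)"
      using z b by (intro sum.cong refl) (auto simp: orthonormal_basis_def)
    finally show ?thesis using b by simp
  qed
  have "(\<Sum>l<d. z b l * (\<Sum>i<d. G l i * v i)) = (\<Sum>l<d. \<Sum>i<d. v i * (G l i * z b l))"
    by (simp add: sum_distrib_left mult_ac)
  also have "\<dots> = (\<Sum>i<d. v i * (\<Sum>l<d. G l i * z b l))"
    unfolding sum_distrib_left by (rule sum.swap)
  also have "\<dots> = (\<Sum>i<d. v i * (\<sigma>' b * z b i))" by (intro sum.cong refl) (simp add: Gz)
  also have "\<dots> = \<sigma>' b * dotp d (z b) v" by (simp add: dotp_def sum_distrib_left mult_ac)
  finally show ?thesis .
qed

lemma dotp_err: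
  assumes "b < d" shows "dotp d (z b) (err v) = \<sigma>' b * dotp d (z b) v - (\<Sum>j<d. z b j * (\<sigma> j * v j))"
  using G_eigen[OF assms, of v] by (simp add: dotp_def err_def right_diff_distrib sum_subtractf)

lemma form_G: "bilin d G x x = (\<Sum>b<d. \<sigma>' b * (dotp d (z b) x)\<^sup>2)"
proof -
  have "bilin d G x x = (\<Sum>i<d. \<Sum>j<d. \<Sum>b<d. \<sigma>' b * ((z b i * x i) * (z b j * x j)))"
    unfolding bilin_def by (intro sum.cong refl) (simp add: G sum_distrib_left sum_distrib_right mult_ac)
  also have "\<dots> = (\<Sum>b<d. \<Sum>i<d. \<Sum>j<d. \<sigma>' b * ((z b i * x i) * (z b j * x j)))" by (rule sum_rotate[symmetric])
  also have "\<dots> = (\<Sum>b<d. \<sigma>' b * (dotp d (z b) x)\<^sup>2)"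
    unfolding dotp_def power2_eq_square sum_product by (simp add: sum_distrib_left)
  finally show ?thesis .
qed

lemma eigenvalues_close:
  fixes e :: real
  assumes e: "\<And>x. \<bar>bilin d G x x - (\<Sum>j<d. \<sigma> j * (x j)\<^sup>2)\<bar> \<le> e * sqnorm d x" and j: "j < d"
  shows "\<sigma>' j \<le> \<sigma> j + e" "\<sigma> j \<le> \<sigma>' j + e"
proof -
  have std: "(\<Sum>b<d. \<sigma> b * (dotp d (\<lambda>j. if b = j then 1 else 0) x)\<^sup>2) = (\<Sum>j<d. \<sigma> j * (x j)\<^sup>2)" for x
    by (intro sum.cong refl) (simp add: dotp_std)
  show "\<sigma>' j \<le> \<sigma> j + e"
  proof (rule weyl_inequality[OF z orthonormal_basis_std j])
    show "(\<Sum>b<d. \<sigma>' b * (dotp d (z b) x)\<^sup>2) \<le> (\<Sum>b<d. \<sigma> b * (dotp d (\<lambda>j. if b = j then 1 else 0) x)\<^sup>2) + e * sqnorm d x" for x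
      unfolding std form_G[symmetric] using e[of x] by linarith
  qed (use \<sigma>_anti \<sigma>'_anti j in auto)
  show "\<sigma> j \<le> \<sigma>' j + e"
  proof (rule weyl_inequality[OF orthonormal_basis_std z j])
    show "(\<Sum>b<d. \<sigma> b * (dotp d (\<lambda>j. if b = j then 1 else 0) x)\<^sup>2) \<le> (\<Sum>b<d. \<sigma>' b * (dotp d (z b) x)\<^sup>2) + e * sqnorm d x" for x
      unfolding std form_G[symmetric] using e[of x] by linarith
  qed (use \<sigma>_anti \<sigma>'_anti j in auto)
qed

text \<open>The squared Frobenius norm of \<open>sin \<Theta>\<close>, where \<open>\<Theta>\<close> are the principal angles between the spans
  of the first \<open>r\<close> vectors of the two bases.\<close>
definition sin_sq :: real where "sin_sq = (\<Sum>b<r. \<Sum>a\<in>{r..<d}. (z b a)\<^sup>2)"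

lemma sin_sq_nonneg: "0 \<le> sin_sq"
  by (simp add: sin_sq_def sum_nonneg)

text \<open>Davis and Kahan's argument: \<open>(\<sigma>' b - \<sigma> a) * z b a\<close> is the coordinate along \<open>z b\<close> of the error
  applied to the \<open>a\<close>-th basis vector. In this form the error is applied only to leading population
  eigenvectors, which are not random.\<close>

lemma davis_kahan:
  fixes \<gamma> K :: real
  assumes \<gamma>: "0 < \<gamma>" "\<And>a b. a < r \<Longrightarrow> r \<le> b \<Longrightarrow> b < d \<Longrightarrow> \<gamma> \<le> \<sigma> a - \<sigma>' b"
    and K: "\<And>a. a < r \<Longrightarrow> sqnorm d (err (\<lambda>j. if j = a then 1 else 0)) \<le> K"
  shows "\<gamma>\<^sup>2 * sin_sq \<le> r * K"
proof -
  have one: "\<gamma>\<^sup>2 * (\<Sum>b\<in>{r..<d}. (z b a)\<^sup>2) \<le> K" if a: "a < r" for a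
  proof -
    let ?e = "\<lambda>j. if j = a then 1 else 0 :: real"
    have ad: "a < d" using a r by simp
    have z_e: "dotp d (z b) ?e = z b a" "(\<Sum>j<d. z b j * (\<sigma> j * ?e j)) = \<sigma> a * z b a" for b
      using ad by (simp_all add: dotp_def if_distrib[of "\<lambda>x. _ * x"] mult.commute cong: if_cong)
    have "\<gamma>\<^sup>2 * (\<Sum>b\<in>{r..<d}. (z b a)\<^sup>2) \<le> (\<Sum>b\<in>{r..<d}. (dotp d (z b) (err ?e))\<^sup>2)"
      unfolding sum_distrib_left
    proof (intro sum_mono)
      fix b assume b: "b \<in> {r..<d}"
      have "dotp d (z b) (err ?e) = - ((\<sigma> a - \<sigma>' b) * z b a)"
        using dotp_err[of b ?e] b unfolding z_e by (simp add: algebra_simps)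
      then have "(dotp d (z b) (err ?e))\<^sup>2 = (\<sigma> a - \<sigma>' b)\<^sup>2 * (z b a)\<^sup>2" by (simp add: power_mult_distrib)
      moreover have "\<gamma>\<^sup>2 \<le> (\<sigma> a - \<sigma>' b)\<^sup>2" using \<gamma>(1) \<gamma>(2)[OF a] b by (intro power_mono) auto
      ultimately show "\<gamma>\<^sup>2 * (z b a)\<^sup>2 \<le> (dotp d (z b) (err ?e))\<^sup>2" by (simp add: mult_right_mono)
    qed
    also have "\<dots> \<le> (\<Sum>b<d. (dotp d (z b) (err ?e))\<^sup>2)" by (intro sum_mono2) auto
    also have "\<dots> \<le> K" unfolding parseval[OF z] by (rule K[OF a])
    finally show ?thesis .
  qed
  have "\<gamma>\<^sup>2 * sin_sq = \<gamma>\<^sup>2 * (\<Sum>a<r. \<Sum>b\<in>{r..<d}. (z b a)\<^sup>2)"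
    unfolding sin_sq_def block_mass(1)[OF z less_imp_le[OF r(2)]] block_mass(2)[OF z less_imp_le[OF r(2)]] ..
  also have "\<dots> = (\<Sum>a<r. \<gamma>\<^sup>2 * (\<Sum>b\<in>{r..<d}. (z b a)\<^sup>2))" by (simp add: sum_distrib_left)
  also have "\<dots> \<le> (\<Sum>a<r. K)" by (intro sum_mono one) auto
  finally show ?thesis by simp
qed

text \<open>One row of \<open>Uhat - U W\<close>, where \<open>y\<close> holds the coordinates of a standard basis vector in the
  population eigenbasis. The part in the complement is estimated through the eigenvector
  equation; the part along \<open>U\<close> is the misfit of the Procrustes rotation.\<close>

lemma row_bound:
  fixes s V K :: real and y :: "nat \<Rightarrow> real" and W :: "nat \<Rightarrow> nat \<Rightarrow> real"
  assumes s: "0 < s" "s = \<sigma> (r - 1)" "\<And>b. b < r \<Longrightarrow> s / 2 \<le> \<sigma>' b"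
    and y: "(\<Sum>j<d. \<sigma> j * (y j)\<^sup>2) \<le> V"
    and K: "sqnorm d (err (\<lambda>j. if r \<le> j then y j else 0)) \<le> K * V"
    and W: "(\<Sum>a<r. \<Sum>b<r. (z b a - W a b)\<^sup>2) \<le> sin_sq"
  shows "(\<Sum>b<r. ((\<Sum>j<d. y j * z b j) - (\<Sum>j<r. y j * W j b))\<^sup>2) \<le> V * (16 * K / s\<^sup>2 + 18 * sin_sq / s)"
proof -
  let ?v = "\<lambda>j. if r \<le> j then y j else 0"
  define p where "p b = (\<Sum>j\<in>{r..<d}. y j * z b j)" for b
  define t where "t b = (\<Sum>j<r. y j * (z b j - W j b))" for b
  define w where "w b = (\<Sum>j\<in>{r..<d}. z b j * (\<sigma> j * y j))" for b
  have split: "(\<Sum>a<d. f a) = (\<Sum>a<r. f a) + (\<Sum>a\<in>{r..<d}. f a)" for f :: "nat \<Rightarrow> real"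
    using r by (simp add: sum.atLeastLessThan_concat[of 0 r d f, symmetric] lessThan_atLeast0)
  have s_le: "s \<le> \<sigma> j" if "j < r" for j using \<sigma>_anti[of j "r - 1"] that r s(2) by simp
  have le_s: "\<sigma> j \<le> s" if "r \<le> j" "j < d" for j using \<sigma>_anti[of "r - 1" j] that r s(2) by simp
  have y2: "s * (\<Sum>j<r. (y j)\<^sup>2) + (\<Sum>j\<in>{r..<d}. \<sigma> j * (y j)\<^sup>2) \<le> V"
  proof -
    have "s * (\<Sum>j<r. (y j)\<^sup>2) \<le> (\<Sum>j<r. \<sigma> j * (y j)\<^sup>2)"
      unfolding sum_distrib_left using s_le by (intro sum_mono mult_right_mono) auto
    then show ?thesis using y unfolding split by linarith
  qed
  have tail0: "0 \<le> (\<Sum>j\<in>{r..<d}. \<sigma> j * (y j)\<^sup>2)" by (intro sum_nonneg) (auto simp: \<sigma>_nonneg)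
  have head0: "0 \<le> s * (\<Sum>j<r. (y j)\<^sup>2)" using s by (intro mult_nonneg_nonneg sum_nonneg) auto
  have V0: "0 \<le> V" using y2 tail0 head0 by linarith
  have row: "(\<Sum>j<d. y j * z b j) - (\<Sum>j<r. y j * W j b) = p b + t b" for b
    by (simp add: split p_def t_def right_diff_distrib sum_subtractf)
  have w_bound: "(\<Sum>b<r. (w b)\<^sup>2) \<le> s * V * sin_sq"
  proof -
    have "(\<Sum>b<r. (w b)\<^sup>2) \<le> (\<Sum>b<r. (\<Sum>j\<in>{r..<d}. (z b j)\<^sup>2) * (\<Sum>j\<in>{r..<d}. (\<sigma> j * y j)\<^sup>2))"
      unfolding w_def by (intro sum_mono Cauchy_Schwarz_ineq_sum)
    also have "\<dots> = sin_sq * (\<Sum>j\<in>{r..<d}. (\<sigma> j * y j)\<^sup>2)" by (simp add: sin_sq_def sum_distrib_right)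
    also have "\<dots> \<le> sin_sq * (s * V)"
    proof (intro mult_left_mono sin_sq_nonneg)
      have "(\<Sum>j\<in>{r..<d}. (\<sigma> j * y j)\<^sup>2) \<le> (\<Sum>j\<in>{r..<d}. s * (\<sigma> j * (y j)\<^sup>2))"
      proof (intro sum_mono)
        fix j assume "j \<in> {r..<d}"
        then have "\<sigma> j * (\<sigma> j * (y j)\<^sup>2) \<le> s * (\<sigma> j * (y j)\<^sup>2)" using le_s \<sigma>_nonneg by (intro mult_right_mono) auto
        then show "(\<sigma> j * y j)\<^sup>2 \<le> s * (\<sigma> j * (y j)\<^sup>2)" by (simp add: power2_eq_square mult_ac)
      qed
      also have "\<dots> \<le> s * V" unfolding sum_distrib_left[symmetric] using y2 head0 s by (intro mult_left_mono) auto
      finally show "(\<Sum>j\<in>{r..<d}. (\<sigma> j * y j)\<^sup>2) \<le> s * V" .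
    qed
    finally show ?thesis by (simp add: mult_ac)
  qed
  have p_bound: "s\<^sup>2 * (\<Sum>b<r. (p b)\<^sup>2) \<le> 8 * (K * V + s * V * sin_sq)"
  proof -
    have "s\<^sup>2 * (p b)\<^sup>2 \<le> 8 * ((dotp d (z b) (err ?v))\<^sup>2 + (w b)\<^sup>2)" if b: "b < r" for b
    proof -
      have restr: "(\<Sum>j<d. f j * ?v j) = (\<Sum>j\<in>{r..<d}. f j * y j)" for f
        by (simp add: split)
      have "dotp d (z b) ?v = p b" unfolding dotp_def restr p_def by (simp add: mult.commute)
      moreover have "(\<Sum>j<d. z b j * (\<sigma> j * ?v j)) = w b"
        using restr[of "\<lambda>j. z b j * \<sigma> j"] by (simp add: w_def mult.assoc)
      ultimately have eq: "\<sigma>' b * p b = dotp d (z b) (err ?v) + w b"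
        using dotp_err[of b ?v] b r by simp
      have "(s / 2)\<^sup>2 * (p b)\<^sup>2 \<le> (\<sigma>' b)\<^sup>2 * (p b)\<^sup>2"
        using s b by (intro mult_right_mono power_mono) auto
      also have "\<dots> = (dotp d (z b) (err ?v) + w b)\<^sup>2" by (simp add: eq[symmetric] power_mult_distrib)
      also have "\<dots> \<le> 2 * (dotp d (z b) (err ?v))\<^sup>2 + 2 * (w b)\<^sup>2"
        using sum_squares_bound[of "dotp d (z b) (err ?v)" "w b"] by (simp add: power2_sum)
      finally show ?thesis by (simp add: power_divide)
    qed
    then have "s\<^sup>2 * (\<Sum>b<r. (p b)\<^sup>2) \<le> (\<Sum>b<r. 8 * ((dotp d (z b) (err ?v))\<^sup>2 + (w b)\<^sup>2))"
      unfolding sum_distrib_left by (intro sum_mono) auto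
    also have "\<dots> = 8 * ((\<Sum>b<r. (dotp d (z b) (err ?v))\<^sup>2) + (\<Sum>b<r. (w b)\<^sup>2))"
      by (simp add: sum_distrib_left[symmetric] sum.distrib)
    also have "\<dots> \<le> 8 * (K * V + s * V * sin_sq)"
    proof -
      have "(\<Sum>b<r. (dotp d (z b) (err ?v))\<^sup>2) \<le> (\<Sum>b<d. (dotp d (z b) (err ?v))\<^sup>2)"
        using r by (intro sum_mono2) auto
      then have "(\<Sum>b<r. (dotp d (z b) (err ?v))\<^sup>2) \<le> K * V"
        using K unfolding parseval[OF z] by (rule order_trans)
      then show ?thesis by (intro mult_left_mono add_mono w_bound) simp_all
    qed
    finally show ?thesis .
  qed
  have t_bound: "s * (\<Sum>b<r. (t b)\<^sup>2) \<le> V * sin_sq"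
  proof -
    have "(\<Sum>b<r. (t b)\<^sup>2) \<le> (\<Sum>b<r. (\<Sum>j<r. (y j)\<^sup>2) * (\<Sum>j<r. (z b j - W j b)\<^sup>2))"
      unfolding t_def by (intro sum_mono Cauchy_Schwarz_ineq_sum)
    also have "\<dots> = (\<Sum>j<r. (y j)\<^sup>2) * (\<Sum>a<r. \<Sum>b<r. (z b a - W a b)\<^sup>2)"
      unfolding sum_distrib_left[symmetric] by (subst sum.swap) simp
    also have "\<dots> \<le> (\<Sum>j<r. (y j)\<^sup>2) * sin_sq" by (intro mult_left_mono W sum_nonneg) auto
    finally have "s * (\<Sum>b<r. (t b)\<^sup>2) \<le> s * ((\<Sum>j<r. (y j)\<^sup>2) * sin_sq)" using s by (intro mult_left_mono) auto
    also have "\<dots> = (s * (\<Sum>j<r. (y j)\<^sup>2)) * sin_sq" by simp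
    also have "\<dots> \<le> V * sin_sq" using y2 tail0 by (intro mult_right_mono sin_sq_nonneg) auto
    finally show ?thesis .
  qed
  have "(\<Sum>b<r. (p b + t b)\<^sup>2) \<le> (\<Sum>b<r. 2 * (p b)\<^sup>2 + 2 * (t b)\<^sup>2)"
  proof (intro sum_mono)
    fix b show "(p b + t b)\<^sup>2 \<le> 2 * (p b)\<^sup>2 + 2 * (t b)\<^sup>2"
      using sum_squares_bound[of "p b" "t b"] by (simp add: power2_sum)
  qed
  also have "\<dots> = 2 * (\<Sum>b<r. (p b)\<^sup>2) + 2 * (\<Sum>b<r. (t b)\<^sup>2)" by (simp add: sum.distrib sum_distrib_left)
  also have "\<dots> \<le> 2 * (8 * (K * V + s * V * sin_sq) / s\<^sup>2) + 2 * (V * sin_sq / s)"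
    using p_bound t_bound s(1) by (intro add_mono mult_left_mono) (simp_all add: pos_le_divide_eq mult.commute)
  also have "\<dots> = V * (16 * K / s\<^sup>2 + 18 * sin_sq / s)"
    using s(1) by (simp add: field_simps power2_eq_square)
  finally show ?thesis unfolding row .
qed

end

section \<open>Singular values, eigenbases and the Procrustes matrix\<close>

lemma sandwich_diag_index:
  assumes "P \<in> carrier_mat m n" "Q \<in> carrier_mat p n" "i < m" "l < p"
  shows "(P * mat_diag n f * transpose_mat Q) $$ (i, l) = (\<Sum>j<n. P $$ (i, j) * f j * Q $$ (l, j) :: real)"
  using assms by (subst mat_diag_mult_right[of _ m n]) (auto simp: scalar_prod_def lessThan_atLeast0)

lemma proots_linear_factors: "proots (\<Prod>a\<leftarrow>xs. [:- a, 1:]) = mset (xs :: real list)"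
proof (induction xs)
  case (Cons a xs)
  have "(\<Prod>a\<leftarrow>xs. [:- a, 1:]) \<noteq> (0 :: real poly)" by (auto simp: prod_list_zero_iff)
  then have "proots ([:- a, 1:] * (\<Prod>a\<leftarrow>xs. [:- a, 1:])) = proots [:- a, 1:] + proots (\<Prod>a\<leftarrow>xs. [:- a, 1:])"
    by (intro proots_mult) simp_all
  then show ?case using Cons by (simp only: list.map prod_list.Cons proots_linear_factor) simp
qed simp

text \<open>Any diagonalisation by orthogonal factors determines the singular values up to sign and order,
  since \<open>A\<^sup>T A\<close> is then similar to the diagonal matrix of the squares.\<close>
lemma singular_values_from_decomposition:
  assumes P: "orthogonal_matrix_of_dim n P" and Q: "orthogonal_matrix_of_dim n Q"
    and A: "A = P * mat_diag n f * transpose_mat Q"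
  shows "singular_values A = rev (sort (map (\<lambda>i. \<bar>f i\<bar>) [0..<n]))"
proof -
  let ?D = "mat_diag n f"
  have c: "P \<in> carrier_mat n n" "Q \<in> carrier_mat n n" "transpose_mat P \<in> carrier_mat n n"
      "transpose_mat Q \<in> carrier_mat n n" "?D \<in> carrier_mat n n"
    using P Q by (auto simp: orthogonal_matrix_of_dim_def)
  have DT: "transpose_mat ?D = ?D" by (rule eq_matI) (auto simp: mat_diag_def)
  have "transpose_mat A = transpose_mat (transpose_mat Q) * transpose_mat (P * ?D)"
    unfolding A using c by (intro transpose_mult[of "P * ?D" n n "transpose_mat Q" n]) auto
  also have "transpose_mat (P * ?D) = ?D * transpose_mat P"
    using c by (subst transpose_mult[of _ n n _ n]) (auto simp: DT)
  finally have AT: "transpose_mat A = Q * (?D * transpose_mat P)" by simp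
  have "transpose_mat A * A = (Q * (?D * transpose_mat P)) * (P * (?D * transpose_mat Q))"
    unfolding AT unfolding A using c by (simp add: assoc_mult_mat[of P n n ?D n "transpose_mat Q" n])
  also have "\<dots> = Q * ((?D * transpose_mat P) * (P * (?D * transpose_mat Q)))"
    using c by (intro assoc_mult_mat[of _ n n _ n _ n] mult_carrier_mat[of _ n n _ n]) auto
  also have "(?D * transpose_mat P) * (P * (?D * transpose_mat Q)) = ?D * (transpose_mat P * (P * (?D * transpose_mat Q)))"
    using c by (intro assoc_mult_mat[of _ n n _ n _ n] mult_carrier_mat[of _ n n _ n]) auto
  also have "transpose_mat P * (P * (?D * transpose_mat Q)) = (transpose_mat P * P) * (?D * transpose_mat Q)"
    using c by (intro assoc_mult_mat[of _ n n _ n _ n, symmetric] mult_carrier_mat[of _ n n _ n]) auto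
  also have "\<dots> = ?D * transpose_mat Q"
    using P c left_mult_one_mat[OF mult_carrier_mat[of ?D n n "transpose_mat Q" n]]
    by (simp add: orthogonal_matrix_of_dim_def)
  also have "?D * (?D * transpose_mat Q) = (?D * ?D) * transpose_mat Q"
    using c by (intro assoc_mult_mat[of _ n n _ n _ n, symmetric] mult_carrier_mat[of _ n n _ n]) auto
  also have "Q * ((?D * ?D) * transpose_mat Q) = Q * (?D * ?D) * transpose_mat Q"
    using c by (intro assoc_mult_mat[of _ n n _ n _ n, symmetric] mult_carrier_mat[of _ n n _ n]) auto
  finally have AA: "transpose_mat A * A = Q * mat_diag n (\<lambda>i. f i * f i) * transpose_mat Q" by simp
  have "similar_mat (transpose_mat A * A) (mat_diag n (\<lambda>i. f i * f i))"
    using Q c unfolding AA by (intro similar_matI[of _ _ Q "transpose_mat Q" n]) (auto simp: orthogonal_matrix_of_dim_def)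
  then have "char_poly (transpose_mat A * A) = char_poly (mat_diag n (\<lambda>i. f i * f i))" by (rule char_poly_similar)
  also have "\<dots> = (\<Prod>a\<leftarrow>diag_mat (mat_diag n (\<lambda>i. f i * f i)). [:- a, 1:])"
    by (rule char_poly_upper_triangular[of _ n]) (auto simp: mat_diag_def)
  also have "diag_mat (mat_diag n (\<lambda>i. f i * f i)) = map (\<lambda>i. f i * f i) [0..<n]"
    by (auto simp: diag_mat_def mat_diag_def)
  finally have "proots (char_poly (transpose_mat A * A)) = mset (map (\<lambda>i. f i * f i) [0..<n])"
    by (simp only: proots_linear_factors)
  then have "image_mset sqrt (proots (char_poly (transpose_mat A * A))) = mset (map (\<lambda>i. \<bar>f i\<bar>) [0..<n])"
    by (simp add: multiset.map_comp comp_def flip: mset_map)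
  then show ?thesis by (simp only: singular_values_def sorted_list_of_multiset_mset)
qed

text \<open>A decomposition whose diagonal entries are the singular values itself certifies that the
  characteristic polynomial of \<open>A\<^sup>T A\<close> splits, so that the singular values form a sorted list of
  \<open>n\<close> nonnegative numbers.\<close>
lemma sing_val_properties:
  assumes P: "orthogonal_matrix_of_dim n P" and Q: "orthogonal_matrix_of_dim n Q"
    and A: "A = P * mat_diag n (\<lambda>i. sing_val A (i + 1)) * transpose_mat Q"
  shows "\<And>i. i < n \<Longrightarrow> 0 \<le> sing_val A (i + 1)"
    and "\<And>i j. i \<le> j \<Longrightarrow> j < n \<Longrightarrow> sing_val A (j + 1) \<le> sing_val A (i + 1)"
proof -
  define L where "L = sort (map (\<lambda>i. \<bar>sing_val A (i + 1)\<bar>) [0..<n])"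
  have sv: "singular_values A = rev L"
    unfolding L_def by (rule singular_values_from_decomposition[OF P Q A])
  have len: "length L = n" by (simp add: L_def)
  show "0 \<le> sing_val A (i + 1)" if "i < n" for i
  proof -
    have "sing_val A (i + 1) = rev L ! i" using sv by (simp add: sing_val_def)
    also have "rev L ! i \<in> set (rev L)" using that len by (intro nth_mem) simp
    then have "0 \<le> rev L ! i" by (auto simp: L_def)
    finally show ?thesis .
  qed
  show "sing_val A (j + 1) \<le> sing_val A (i + 1)" if "i \<le> j" "j < n" for i j
  proof -
    have "rev L ! j \<le> rev L ! i"
      by (rule sorted_rev_nth_mono) (use that len in \<open>auto simp: L_def\<close>)
    then show ?thesis using sv by (simp add: sing_val_def)
  qed
qed

lemma orthonormal_basis_from_matrix:
  assumes "orthogonal_matrix_of_dim d Q"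
  shows "orthonormal_basis d (\<lambda>b i. Q $$ (i, b))"
proof -
  have c: "Q \<in> carrier_mat d d" and 1: "transpose_mat Q * Q = 1\<^sub>m d" and 2: "Q * transpose_mat Q = 1\<^sub>m d"
    using assms by (auto simp: orthogonal_matrix_of_dim_def)
  have "(\<Sum>j<d. Q $$ (j, b) * Q $$ (j, c)) = (transpose_mat Q * Q) $$ (b, c)" if "b < d" "c < d" for b c
    using that c by (simp add: scalar_prod_def lessThan_atLeast0)
  moreover have "(\<Sum>b<d. Q $$ (j, b) * Q $$ (l, b)) = (Q * transpose_mat Q) $$ (j, l)" if "j < d" "l < d" for j l
    using that c by (simp add: scalar_prod_def lessThan_atLeast0)
  ultimately show ?thesis unfolding orthonormal_basis_def 1 2 by auto
qed

lemma sum_lessThan_add: "(\<Sum>j<r + k. h j) = (\<Sum>j<r. h j) + (\<Sum>j<k. h (r + j :: nat) :: real)"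
  by (induction k) (auto simp: algebra_simps)

lemma append_cols_index:
  assumes "A \<in> carrier_mat d r" "B \<in> carrier_mat d k" "i < d" "j < r + k"
  shows "append_cols A B $$ (i, j) = (if j < r then A $$ (i, j) else B $$ (i, j - r))"
  using assms by (auto simp: append_cols_def append_rows_def)

text \<open>The two blocks are merged into one orthogonal matrix, whose columns are indexed by \<open>j < d\<close>.\<close>
lemma leading_singular_vectors_eigenbasis:
  assumes U: "leading_singular_vectors d r S U" and r: "r \<le> d"
  obtains Q where "orthogonal_matrix_of_dim d Q" "U \<in> carrier_mat d r"
    "\<And>i j. i < d \<Longrightarrow> j < r \<Longrightarrow> Q $$ (i, j) = U $$ (i, j)"
    "S = Q * mat_diag d (\<lambda>i. sing_val S (i + 1)) * transpose_mat Q"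
proof -
  let ?f = "\<lambda>i. sing_val S (i + 1)"
  obtain V where Uc: "U \<in> carrier_mat d r" and V: "V \<in> carrier_mat d (d - r)"
    and o: "orthogonal_matrix_of_dim d (append_cols U V)"
    and S: "S = U * mat_diag r ?f * transpose_mat U + V * mat_diag (d - r) (\<lambda>i. sing_val S (r + i + 1)) * transpose_mat V"
    using U unfolding leading_singular_vectors_def by blast
  let ?Q = "append_cols U V"
  have Q: "?Q \<in> carrier_mat d d" using o by (simp add: orthogonal_matrix_of_dim_def)
  have ix: "?Q $$ (i, j) = (if j < r then U $$ (i, j) else V $$ (i, j - r))" if "i < d" "j < d" for i j
    using append_cols_index[OF Uc V] that r by simp
  have Sc: "S \<in> carrier_mat d d" by (subst S) (use Uc V in auto)
  have "S = ?Q * mat_diag d ?f * transpose_mat ?Q"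
  proof (rule eq_matI)
    fix i l assume "i < dim_row (?Q * mat_diag d ?f * transpose_mat ?Q)" "l < dim_col (?Q * mat_diag d ?f * transpose_mat ?Q)"
    then have il: "i < d" "l < d" using Q by auto
    have "S $$ (i, l) = (U * mat_diag r ?f * transpose_mat U) $$ (i, l)
        + (V * mat_diag (d - r) (\<lambda>i. sing_val S (r + i + 1)) * transpose_mat V) $$ (i, l)"
      by (subst S, subst index_add_mat) (use il V in auto)
    also have "\<dots> = (\<Sum>j<r. U $$ (i, j) * ?f j * U $$ (l, j)) + (\<Sum>j<d - r. V $$ (i, j) * sing_val S (r + j + 1) * V $$ (l, j))"
      using sandwich_diag_index[OF Uc Uc il] sandwich_diag_index[OF V V il] by simp
    also have "\<dots> = (\<Sum>j<r. ?Q $$ (i, j) * ?f j * ?Q $$ (l, j)) + (\<Sum>j<d - r. ?Q $$ (i, r + j) * ?f (r + j) * ?Q $$ (l, r + j))"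
      using il r by (intro arg_cong2[of _ _ _ _ "(+)"] sum.cong refl) (auto simp: ix)
    also have "\<dots> = (\<Sum>j<d. ?Q $$ (i, j) * ?f j * ?Q $$ (l, j))"
      using sum_lessThan_add[of "\<lambda>j. ?Q $$ (i, j) * ?f j * ?Q $$ (l, j)" r "d - r"] r by simp
    also have "\<dots> = (?Q * mat_diag d ?f * transpose_mat ?Q) $$ (i, l)"
      by (rule sandwich_diag_index[OF Q Q il, symmetric])
    finally show "S $$ (i, l) = (?Q * mat_diag d ?f * transpose_mat ?Q) $$ (i, l)" .
  qed (use Q Sc in auto)
  then show thesis using that[of ?Q] o Uc ix r by auto
qed

lemma isometry_sqnorm:
  fixes U :: "nat \<Rightarrow> nat \<Rightarrow> real"
  assumes "\<And>a b. a < r \<Longrightarrow> b < r \<Longrightarrow> (\<Sum>i<d. U i a * U i b) = (if a = b then 1 else 0)"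
  shows "(\<Sum>i<d. (\<Sum>a<r. U i a * w a)\<^sup>2) = sqnorm r w"
proof -
  have "(\<Sum>i<d. (\<Sum>a<r. U i a * w a)\<^sup>2) = (\<Sum>i<d. \<Sum>a<r. \<Sum>b<r. (U i a * w a) * (U i b * w b))"
    by (simp add: power2_eq_square sum_product)
  also have "\<dots> = (\<Sum>a<r. \<Sum>b<r. \<Sum>i<d. (U i a * w a) * (U i b * w b))" by (rule sum_rotate)
  also have "\<dots> = (\<Sum>a<r. \<Sum>b<r. w a * w b * (\<Sum>i<d. U i a * U i b))" by (simp add: sum_distrib_left mult_ac)
  also have "\<dots> = (\<Sum>a<r. \<Sum>b<r. if a = b then w a * w b else 0)"
    using assms by (intro sum.cong refl) auto
  also have "\<dots> = sqnorm r w" by (simp add: sqnorm_def power2_eq_square)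
  finally show ?thesis .
qed

lemma frobenius_sandwich:
  fixes P Q :: "nat \<Rightarrow> nat \<Rightarrow> real"
  assumes P: "\<And>k l. k < r \<Longrightarrow> l < r \<Longrightarrow> (\<Sum>a<r. P a k * P a l) = (if k = l then 1 else 0)"
    and Q: "\<And>k l. k < r \<Longrightarrow> l < r \<Longrightarrow> (\<Sum>a<r. Q a k * Q a l) = (if k = l then 1 else 0)"
  shows "(\<Sum>a<r. \<Sum>b<r. (\<Sum>k<r. P a k * g k * Q b k)\<^sup>2) = (\<Sum>k<r. (g k)\<^sup>2)"
proof -
  have "(\<Sum>a<r. \<Sum>b<r. (\<Sum>k<r. P a k * g k * Q b k)\<^sup>2) = (\<Sum>a<r. \<Sum>b<r. (\<Sum>k<r. Q b k * (P a k * g k))\<^sup>2)"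
    by (simp add: mult_ac)
  also have "\<dots> = (\<Sum>a<r. \<Sum>k<r. (P a k * g k)\<^sup>2)"
    by (simp add: isometry_sqnorm[of r Q r, OF Q] sqnorm_def)
  also have "\<dots> = (\<Sum>k<r. (g k)\<^sup>2 * (\<Sum>a<r. P a k * P a k))"
    by (subst sum.swap) (simp add: sum_distrib_left power2_eq_square mult_ac)
  also have "\<dots> = (\<Sum>k<r. (g k)\<^sup>2)" by (simp add: P)
  finally show ?thesis .
qed

text \<open>The singular values \<open>c\<close> of \<open>U\<^sup>T Uhat\<close> are cosines of principal angles, and
  \<open>(1 - c)\<^sup>2 \<le> 1 - c\<^sup>2\<close> on the unit interval.\<close>

lemma procrustes_misfit:
  assumes W: "procrustes_matrix r U U' W" and U: "U \<in> carrier_mat d r" and U': "U' \<in> carrier_mat d r"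
    and oU: "\<And>a b. a < r \<Longrightarrow> b < r \<Longrightarrow> (\<Sum>i<d. U $$ (i, a) * U $$ (i, b)) = (if a = b then 1 else 0)"
    and oU': "\<And>a b. a < r \<Longrightarrow> b < r \<Longrightarrow> (\<Sum>i<d. U' $$ (i, a) * U' $$ (i, b)) = (if a = b then 1 else 0)"
  defines "C \<equiv> \<lambda>a b. \<Sum>i<d. U $$ (i, a) * U' $$ (i, b)"
  shows "W \<in> carrier_mat r r"
    and "(\<Sum>a<r. \<Sum>b<r. (C a b - W $$ (a, b))\<^sup>2) \<le> r - (\<Sum>a<r. \<Sum>b<r. (C a b)\<^sup>2)"
proof -
  let ?A = "transpose_mat U * U'"
  define f where "f i = sing_val ?A (i + 1)" for i
  obtain P Q where P: "orthogonal_matrix_of_dim r P" and Q: "orthogonal_matrix_of_dim r Q"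
    and A: "?A = P * mat_diag r f * transpose_mat Q" and WPQ: "W = P * transpose_mat Q"
    using W unfolding procrustes_matrix_def f_def by blast
  have c: "P \<in> carrier_mat r r" "Q \<in> carrier_mat r r" using P Q by (auto simp: orthogonal_matrix_of_dim_def)
  show "W \<in> carrier_mat r r" using c by (simp add: WPQ)
  note oP = orthonormal_basis_from_matrix[OF P, unfolded orthonormal_basis_def, THEN conjunct1, rule_format]
  note oQ = orthonormal_basis_from_matrix[OF Q, unfolded orthonormal_basis_def, THEN conjunct1, rule_format]
  have f0: "0 \<le> f k" if "k < r" for k
    using sing_val_properties(1)[OF P Q A[unfolded f_def] that] by (simp add: f_def)
  have C: "C a b = (\<Sum>k<r. P $$ (a, k) * f k * Q $$ (b, k))" if "a < r" "b < r" for a b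
  proof -
    have "C a b = ?A $$ (a, b)"
      using that U U' by (simp add: C_def scalar_prod_def lessThan_atLeast0)
    also have "\<dots> = (\<Sum>k<r. P $$ (a, k) * f k * Q $$ (b, k))"
      unfolding A by (rule sandwich_diag_index[OF c that])
    finally show ?thesis .
  qed
  have Wix: "W $$ (a, b) = (\<Sum>k<r. P $$ (a, k) * Q $$ (b, k))" if "a < r" "b < r" for a b
    using that c by (simp add: WPQ scalar_prod_def lessThan_atLeast0)
  have f1: "f k \<le> 1" if k: "k < r" for k
  proof -
    define x where "x i = (\<Sum>a<r. U $$ (i, a) * P $$ (a, k))" for i
    define y where "y i = (\<Sum>b<r. U' $$ (i, b) * Q $$ (b, k))" for i
    have x1: "sqnorm d x = 1"
      unfolding sqnorm_def[of d] x_def using isometry_sqnorm[of r "\<lambda>i a. U $$ (i, a)" d "\<lambda>a. P $$ (a, k)", OF oU] oP[OF k k]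
      by (simp add: sqnorm_def power2_eq_square)
    have y1: "sqnorm d y = 1"
      unfolding sqnorm_def[of d] y_def using isometry_sqnorm[of r "\<lambda>i a. U' $$ (i, a)" d "\<lambda>a. Q $$ (a, k)", OF oU'] oQ[OF k k]
      by (simp add: sqnorm_def power2_eq_square)
    have "(\<Sum>i<d. x i * y i) = (\<Sum>i<d. \<Sum>a<r. \<Sum>b<r. P $$ (a, k) * Q $$ (b, k) * (U $$ (i, a) * U' $$ (i, b)))"
      by (simp add: x_def y_def sum_product mult_ac)
    also have "\<dots> = (\<Sum>a<r. \<Sum>b<r. \<Sum>i<d. P $$ (a, k) * Q $$ (b, k) * (U $$ (i, a) * U' $$ (i, b)))" by (rule sum_rotate)
    also have "\<dots> = (\<Sum>a<r. \<Sum>b<r. P $$ (a, k) * Q $$ (b, k) * C a b)" by (simp add: C_def sum_distrib_left)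
    also have "\<dots> = (\<Sum>a<r. \<Sum>b<r. \<Sum>l<r. f l * (P $$ (a, k) * P $$ (a, l)) * (Q $$ (b, k) * Q $$ (b, l)))"
      by (intro sum.cong refl) (simp add: C sum_distrib_left mult_ac)
    also have "\<dots> = (\<Sum>l<r. \<Sum>a<r. \<Sum>b<r. f l * (P $$ (a, k) * P $$ (a, l)) * (Q $$ (b, k) * Q $$ (b, l)))" by (rule sum_rotate[symmetric])
    also have "\<dots> = (\<Sum>l<r. f l * ((\<Sum>a<r. P $$ (a, k) * P $$ (a, l)) * (\<Sum>b<r. Q $$ (b, k) * Q $$ (b, l))))"
      unfolding sum_product by (simp add: sum_distrib_left mult_ac)
    also have "\<dots> = (\<Sum>l<r. if k = l then f l else 0)"
      using k by (intro sum.cong refl) (auto simp: oP oQ)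
    also have "\<dots> = f k" using k by simp
    finally have "f k = (\<Sum>i<d. x i * y i)" by simp
    then have "(f k)\<^sup>2 \<le> 1" using sqnorm_cauchy_schwarz[where x = x and y = y and k = d] x1 y1 by simp
    then show ?thesis by (simp add: abs_square_le_1)
  qed
  have "(\<Sum>a<r. \<Sum>b<r. (C a b - W $$ (a, b))\<^sup>2) = (\<Sum>a<r. \<Sum>b<r. (\<Sum>k<r. P $$ (a, k) * (f k - 1) * Q $$ (b, k))\<^sup>2)"
    by (intro sum.cong refl) (simp add: C Wix sum_subtractf[symmetric] algebra_simps)
  also have "\<dots> = (\<Sum>k<r. (f k - 1)\<^sup>2)" by (rule frobenius_sandwich) (auto simp: oP oQ)
  also have "\<dots> \<le> (\<Sum>k<r. 1 - (f k)\<^sup>2)"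
  proof (intro sum_mono)
    fix k assume "k \<in> {..<r}"
    then have "f k * f k \<le> f k * 1" using f0 f1 by (intro mult_left_mono) auto
    then show "(f k - 1)\<^sup>2 \<le> 1 - (f k)\<^sup>2" by (simp add: power2_eq_square algebra_simps)
  qed
  also have "\<dots> = r - (\<Sum>k<r. (f k)\<^sup>2)" by (simp add: sum_subtractf)
  also have "(\<Sum>k<r. (f k)\<^sup>2) = (\<Sum>a<r. \<Sum>b<r. (\<Sum>k<r. P $$ (a, k) * f k * Q $$ (b, k))\<^sup>2)"
    by (rule frobenius_sandwich[symmetric]) (auto simp: oP oQ)
  also have "\<dots> = (\<Sum>a<r. \<Sum>b<r. (C a b)\<^sup>2)" by (intro sum.cong refl) (simp add: C)
  finally show "(\<Sum>a<r. \<Sum>b<r. (C a b - W $$ (a, b))\<^sup>2) \<le> r - (\<Sum>a<r. \<Sum>b<r. (C a b)\<^sup>2)" .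
qed

lemma norm_2_inf_le:
  assumes A: "A \<in> carrier_mat d r" and d: "0 < d" and r: "0 < r" and B: "0 \<le> B"
    and rows: "\<And>i. i < d \<Longrightarrow> (\<Sum>b<r. (A $$ (i, b))\<^sup>2) \<le> B\<^sup>2"
  shows "norm_2_inf A \<le> B"
  unfolding norm_2_inf_def
proof (rule cSUP_least)
  have "unit_vec r 0 \<in> {x \<in> carrier_vec (dim_col A). vec_norm2 x = 1}"
    using A r by (simp add: vec_norm2_def)
  then show "{x \<in> carrier_vec (dim_col A). vec_norm2 x = 1} \<noteq> {}" by blast
  fix x assume "x \<in> {x \<in> carrier_vec (dim_col A). vec_norm2 x = 1}"
  then have x: "x \<in> carrier_vec r" "x \<bullet> x = 1" using A by (auto simp: vec_norm2_def)
  have xs: "(\<Sum>b<r. (x $ b)\<^sup>2) = 1"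
    using x by (simp add: scalar_prod_def lessThan_atLeast0 power2_eq_square)
  have "\<bar>(A *\<^sub>v x) $ i\<bar> \<le> B" if i: "i < d" for i
  proof -
    have "(A *\<^sub>v x) $ i = (\<Sum>b<r. A $$ (i, b) * x $ b)"
      using A x i by (simp add: scalar_prod_def lessThan_atLeast0)
    then have "((A *\<^sub>v x) $ i)\<^sup>2 \<le> (\<Sum>b<r. (A $$ (i, b))\<^sup>2) * (\<Sum>b<r. (x $ b)\<^sup>2)"
      using Cauchy_Schwarz_ineq_sum[of "\<lambda>b. A $$ (i, b)" "\<lambda>b. x $ b" "{..<r}"] by simp
    also have "\<dots> \<le> B\<^sup>2" using rows[OF i] by (simp add: xs)
    finally show ?thesis using B by (simp add: abs_le_square_iff[symmetric])
  qed
  then show "vec_norm_inf (A *\<^sub>v x) \<le> B"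
    unfolding vec_norm_inf_def using A d by (subst Max_le_iff) auto
qed

section \<open>Gaussian samples in the eigenbasis of the covariance\<close>

lemma (in prob_space) indep_vars_reindex_inj:
  assumes ind: "indep_vars M' X (h ` I)" and h: "inj_on h I"
  shows "indep_vars (\<lambda>i. M' (h i)) (\<lambda>i. X (h i)) I"
proof -
  let ?F = "\<lambda>i. {X i -` A \<inter> space M | A. A \<in> sets (M' i)}"
  have rv: "\<forall>i\<in>h ` I. random_variable (M' i) (X i)" and s: "indep_sets ?F (h ` I)"
    using ind unfolding indep_vars_def2 by auto
  have "indep_sets (\<lambda>i. ?F (h i)) I"
    unfolding indep_sets_def
  proof (intro conjI ballI allI impI)
    show "?F (h i) \<subseteq> events" if "i \<in> I" for i
      using s that unfolding indep_sets_def by blast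
    fix J A assume J: "J \<subseteq> I" "J \<noteq> {}" "finite J" and A: "A \<in> Pi J (\<lambda>i. ?F (h i))"
    have inj: "inj_on h J" using h J(1) by (rule inj_on_subset)
    define A' where "A' = (\<lambda>k. A (inv_into J h k))"
    have A'h: "A' (h j) = A j" if "j \<in> J" for j using inj that by (simp add: A'_def)
    have "A' \<in> Pi (h ` J) ?F"
    proof (rule Pi_I)
      fix k assume "k \<in> h ` J"
      then obtain j where j: "j \<in> J" "k = h j" by blast
      then show "A' k \<in> ?F k" using Pi_mem[OF A j(1)] A'h[OF j(1)] by simp
    qed
    moreover have "h ` J \<subseteq> h ` I" "h ` J \<noteq> {}" "finite (h ` J)" using J by auto
    ultimately have "prob (\<Inter>k\<in>h ` J. A' k) = (\<Prod>k\<in>h ` J. prob (A' k))"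
      using s unfolding indep_sets_def by blast
    moreover have "(\<Inter>k\<in>h ` J. A' k) = (\<Inter>j\<in>J. A j)" using A'h by auto
    moreover have "(\<Prod>k\<in>h ` J. prob (A' k)) = (\<Prod>j\<in>J. prob (A j))"
      using inj by (subst prod.reindex) (auto simp: A'h)
    ultimately show "prob (\<Inter>j\<in>J. A j) = (\<Prod>j\<in>J. prob (A j))" by simp
  qed
  then show ?thesis using rv unfolding indep_vars_def2 by auto
qed

lemma (in prob_space) gaussian_var_moments:
  assumes "gaussian_var M X"
  shows "X \<in> borel_measurable M" "integrable M X" "integrable M (\<lambda>\<omega>. (X \<omega>)\<^sup>2)"
proof -
  have "X \<in> borel_measurable M \<and> integrable M X \<and> integrable M (\<lambda>\<omega>. (X \<omega>)\<^sup>2)"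
    using assms unfolding gaussian_var_def
  proof (elim disjE exE conjE)
    fix \<mu> s assume s: "s > 0" and D: "distributed M lborel X (\<lambda>x. ennreal (normal_density \<mu> s x))"
    have m: "X \<in> borel_measurable M" using distributed_measurable[OF D] by simp
    have i1: "integrable M X"
      by (rule distributed_integrable_var[OF D]) (auto intro: integrable_normal_moment_nz_1 s)
    have "integrable lborel (\<lambda>x. normal_density \<mu> s x * (x - \<mu>)\<^sup>2)" by (rule integrable_normal_moment[OF s])
    then have "integrable M (\<lambda>\<omega>. (X \<omega> - \<mu>)\<^sup>2)"
      using distributed_integrable[OF D, of "\<lambda>x. (x - \<mu>)\<^sup>2"] by simp
    then have "integrable M (\<lambda>\<omega>. (X \<omega> - \<mu>)\<^sup>2 + 2 * \<mu> * X \<omega> - \<mu>\<^sup>2)" using i1 by auto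
    moreover have "(X \<omega> - \<mu>)\<^sup>2 + 2 * \<mu> * X \<omega> - \<mu>\<^sup>2 = (X \<omega>)\<^sup>2" for \<omega> by (simp add: power2_diff)
    ultimately show ?thesis using m i1 by simp
  next
    fix \<mu> assume m[measurable]: "X \<in> borel_measurable M" and ae: "AE \<omega> in M. X \<omega> = \<mu>"
    have "integrable M X \<longleftrightarrow> integrable M (\<lambda>_. \<mu>)" using ae by (intro integrable_cong_AE) auto
    moreover have "integrable M (\<lambda>\<omega>. (X \<omega>)\<^sup>2) \<longleftrightarrow> integrable M (\<lambda>_. \<mu>\<^sup>2)" using ae by (intro integrable_cong_AE) auto
    ultimately show ?thesis using m by simp
  qed
  then show "X \<in> borel_measurable M" "integrable M X" "integrable M (\<lambda>\<omega>. (X \<omega>)\<^sup>2)" by auto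
qed

text \<open>A Gaussian law is determined by its mean and variance, also in the degenerate case.\<close>
lemma (in prob_space) gaussian_var_centered:
  assumes g: "gaussian_var M X" and mean: "expectation X = 0" and c: "expectation (\<lambda>\<omega>. (X \<omega>)\<^sup>2) = c"
  shows "centered_gaussian M X c"
  using g unfolding gaussian_var_def
proof (elim disjE exE conjE)
  fix \<mu> s assume s: "s > 0" and D: "distributed M lborel X (\<lambda>x. ennreal (normal_density \<mu> s x))"
  have "\<mu> = 0" using normal_distributed_expectation[OF s D] mean by simp
  moreover have "c = s\<^sup>2" using normal_distributed_variance[OF s D] mean c by simp
  ultimately show ?thesis using s D by (simp add: centered_gaussian_def)
next
  fix \<mu> assume m[measurable]: "X \<in> borel_measurable M" and ae: "AE \<omega> in M. X \<omega> = \<mu>"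
  have "expectation X = expectation (\<lambda>_. \<mu>)" using ae by (intro integral_cong_AE) auto
  then have \<mu>: "\<mu> = 0" using mean by (simp add: prob_space)
  have "expectation (\<lambda>\<omega>. (X \<omega>)\<^sup>2) = expectation (\<lambda>_. 0)" using ae \<mu> by (intro integral_cong_AE) auto
  then show ?thesis using m ae \<mu> c by (simp add: centered_gaussian_def)
qed

lemma centered_gaussian_cong_law:
  assumes X: "centered_gaussian M X c" and Y: "Y \<in> borel_measurable M" and eq: "distr M borel X = distr M borel Y"
  shows "centered_gaussian M Y c"
proof -
  have mX: "X \<in> borel_measurable M" by (rule centered_gaussian_measurable[OF X])
  have lb: "distr M lborel Z = distr M borel Z" for Z :: "'a \<Rightarrow> real" by (simp cong: distr_cong)
  show ?thesis
  proof (cases "c = 0")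
    case True
    then have "AE \<omega> in M. X \<omega> = 0" using X by (auto simp: centered_gaussian_def)
    then have "AE x in distr M borel X. x = 0" using mX by (subst AE_distr_iff) auto
    then have "AE \<omega> in M. Y \<omega> = 0" unfolding eq using Y by (subst (asm) AE_distr_iff) auto
    then show ?thesis using True Y by (simp add: centered_gaussian_def)
  next
    case False
    then have "c > 0" "distributed M lborel X (\<lambda>x. ennreal (normal_density 0 (sqrt c) x))"
      using X by (auto simp: centered_gaussian_def)
    then show ?thesis using Y eq by (simp add: centered_gaussian_def distributed_def lb)
  qed
qed

lemma borel_measurable_linear[measurable]:
  "(\<lambda>y. \<Sum>i<d. a i * y i :: real) \<in> borel_measurable (vec_borel d)"
  unfolding vec_borel_def by measurable

text \<open>For observation \<open>0\<close> the variance is expanded into covariances; the products of coordinates are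
  integrable because each coordinate is itself Gaussian. The other observations have the same
  law.\<close>

lemma gaussian_sample_linear:
  assumes s: "gaussian_sample M d S n Y" and k: "k \<le> n"
  shows "centered_gaussian M (\<lambda>\<omega>. \<Sum>i<d. a i * Y k \<omega> i) (\<Sum>i<d. \<Sum>l<d. a i * a l * S $$ (i, l))"
proof -
  interpret prob_space M using s by (simp add: gaussian_sample_def)
  have iid: "iid_vectors M d Y {0..n}" and g: "gaussian_vector M d (Y 0)"
    and mean: "\<And>i. i < d \<Longrightarrow> expectation (\<lambda>\<omega>. Y 0 \<omega> i) = 0" and S: "S = covariance_matrix M d (Y 0)"
    using s by (auto simp: gaussian_sample_def)
  have Ym: "Y k \<in> measurable M (vec_borel d)" if "k \<le> n" for k
    using iid that by (auto simp: iid_vectors_def indep_vars_def)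
  have gv: "gaussian_var M (\<lambda>\<omega>. \<Sum>i<d. a i * Y 0 \<omega> i)" for a using g by (simp add: gaussian_vector_def)
  have comp: "(\<Sum>i<d. (if i = j then 1 else 0) * Y 0 \<omega> i) = Y 0 \<omega> j" if "j < d" for j \<omega>
    using that by (simp add: if_distrib[of "\<lambda>x. x * _"] cong: if_cong)
  have gj: "gaussian_var M (\<lambda>\<omega>. Y 0 \<omega> j)" if "j < d" for j
    using gv[of "\<lambda>i. if i = j then 1 else 0"] comp[OF that] by simp
  note mom = gaussian_var_moments[OF gj]
  have int2: "integrable M (\<lambda>\<omega>. Y 0 \<omega> i * Y 0 \<omega> l)" if "i < d" "l < d" for i l
  proof (rule Bochner_Integration.integrable_bound[of _ "\<lambda>\<omega>. (Y 0 \<omega> i)\<^sup>2 + (Y 0 \<omega> l)\<^sup>2"])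
    show "integrable M (\<lambda>\<omega>. (Y 0 \<omega> i)\<^sup>2 + (Y 0 \<omega> l)\<^sup>2)" using mom(3) that by auto
    show "(\<lambda>\<omega>. Y 0 \<omega> i * Y 0 \<omega> l) \<in> borel_measurable M" using mom(1)[OF that(1)] mom(1)[OF that(2)] by measurable
    have "\<bar>x * y\<bar> \<le> x\<^sup>2 + y\<^sup>2" for x y :: real
      using sum_squares_bound[of "\<bar>x\<bar>" "\<bar>y\<bar>"] abs_ge_zero[of "x * y"] unfolding abs_mult power2_abs by linarith
    then show "AE \<omega> in M. norm (Y 0 \<omega> i * Y 0 \<omega> l) \<le> norm ((Y 0 \<omega> i)\<^sup>2 + (Y 0 \<omega> l)\<^sup>2)" by simp
  qed
  have Sil: "S $$ (i, l) = expectation (\<lambda>\<omega>. Y 0 \<omega> i * Y 0 \<omega> l)" if "i < d" "l < d" for i l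
    using that by (simp add: S covariance_matrix_def mean)
  have c0: "centered_gaussian M (\<lambda>\<omega>. \<Sum>i<d. a i * Y 0 \<omega> i) (\<Sum>i<d. \<Sum>l<d. a i * a l * S $$ (i, l))"
  proof (rule gaussian_var_centered[OF gv])
    have "expectation (\<lambda>\<omega>. \<Sum>i<d. a i * Y 0 \<omega> i) = (\<Sum>i<d. a i * expectation (\<lambda>\<omega>. Y 0 \<omega> i))"
      using mom(2) by (subst Bochner_Integration.integral_sum) auto
    then show "expectation (\<lambda>\<omega>. \<Sum>i<d. a i * Y 0 \<omega> i) = 0" by (simp add: mean)
    have "expectation (\<lambda>\<omega>. (\<Sum>i<d. a i * Y 0 \<omega> i)\<^sup>2) = expectation (\<lambda>\<omega>. \<Sum>i<d. \<Sum>l<d. a i * a l * (Y 0 \<omega> i * Y 0 \<omega> l))"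
      by (simp add: power2_eq_square sum_product mult_ac)
    also have "\<dots> = (\<Sum>i<d. expectation (\<lambda>\<omega>. \<Sum>l<d. a i * a l * (Y 0 \<omega> i * Y 0 \<omega> l)))"
      by (rule Bochner_Integration.integral_sum) (auto intro!: Bochner_Integration.integrable_sum int2)
    also have "\<dots> = (\<Sum>i<d. \<Sum>l<d. expectation (\<lambda>\<omega>. a i * a l * (Y 0 \<omega> i * Y 0 \<omega> l)))"
      by (intro sum.cong refl Bochner_Integration.integral_sum) (auto intro!: int2)
    also have "\<dots> = (\<Sum>i<d. \<Sum>l<d. a i * a l * expectation (\<lambda>\<omega>. Y 0 \<omega> i * Y 0 \<omega> l))"
      by simp
    finally show "expectation (\<lambda>\<omega>. (\<Sum>i<d. a i * Y 0 \<omega> i)\<^sup>2) = (\<Sum>i<d. \<Sum>l<d. a i * a l * S $$ (i, l))"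
      by (simp add: Sil)
  qed
  have law: "distr M (vec_borel d) (Y 0) = distr M (vec_borel d) (Y k)"
    using bspec[OF bspec[OF conjunct2[OF iid[unfolded iid_vectors_def]], of 0], of k] k by simp
  have "distr M borel (\<lambda>\<omega>. \<Sum>i<d. a i * Y k \<omega> i) = distr (distr M (vec_borel d) (Y k)) borel (\<lambda>y. \<Sum>i<d. a i * y i)" if "k \<le> n" for k
    using Ym[OF that] by (subst distr_distr) (auto simp: comp_def)
  then have "distr M borel (\<lambda>\<omega>. \<Sum>i<d. a i * Y 0 \<omega> i) = distr M borel (\<lambda>\<omega>. \<Sum>i<d. a i * Y k \<omega> i)"
    using law k by simp
  then show ?thesis
    using measurable_compose[OF Ym[OF k] borel_measurable_linear] by (intro centered_gaussian_cong_law[OF c0]) auto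
qed

lemma gaussian_sample_eigen:
  assumes s: "gaussian_sample M d S n Y" and n: "0 < n" and d: "0 < d"
    and Q: "orthogonal_matrix_of_dim d Q" and S: "S = Q * mat_diag d \<sigma> * transpose_mat Q"
    and \<sigma>: "\<And>j. j < d \<Longrightarrow> 0 \<le> \<sigma> j" "\<And>i j. i \<le> j \<Longrightarrow> j < d \<Longrightarrow> \<sigma> j \<le> \<sigma> i" "0 < \<sigma> 0"
  shows "gaussian_eigen_sample M d n \<sigma> (\<lambda>k \<omega>. \<lambda>j\<in>{..<d}. \<Sum>i<d. Q $$ (i, j) * Y (Suc k) \<omega> i)"
proof -
  interpret prob_space M using s by (simp add: gaussian_sample_def)
  have Qc: "Q \<in> carrier_mat d d" using Q by (simp add: orthogonal_matrix_of_dim_def)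
  note oQ = orthonormal_basis_from_matrix[OF Q]
  let ?H = "\<lambda>k \<omega>. \<lambda>j\<in>{..<d}. \<Sum>i<d. Q $$ (i, j) * Y (Suc k) \<omega> i"
  show ?thesis
  proof unfold_locales
    have "indep_vars (\<lambda>_. vec_borel d) Y {0..n}" using s by (simp add: gaussian_sample_def iid_vectors_def)
    then have "indep_vars (\<lambda>_. vec_borel d) Y (Suc ` {..<n})" by (rule indep_vars_subset) auto
    then have "indep_vars (\<lambda>_. vec_borel d) (\<lambda>k. Y (Suc k)) {..<n}" by (rule indep_vars_reindex_inj) auto
    then show "indep_vars (\<lambda>_. Pi\<^sub>M {..<d} (\<lambda>_. borel)) ?H {..<n}"
      by (rule indep_vars_compose2) (intro measurable_restrict borel_measurable_linear)
    fix k g assume k: "k < n"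
    define a where "a i = (\<Sum>j<d. Q $$ (i, j) * g j)" for i
    have "(\<Sum>j<d. g j * ?H k \<omega> j) = (\<Sum>i<d. a i * Y (Suc k) \<omega> i)" for \<omega>
    proof -
      have "(\<Sum>j<d. g j * ?H k \<omega> j) = (\<Sum>j<d. \<Sum>i<d. Q $$ (i, j) * g j * Y (Suc k) \<omega> i)"
        by (intro sum.cong refl) (simp add: sum_distrib_left mult_ac)
      also have "\<dots> = (\<Sum>i<d. a i * Y (Suc k) \<omega> i)"
        unfolding a_def sum_distrib_right by (rule sum.swap)
      finally show ?thesis .
    qed
    moreover have "(\<Sum>i<d. \<Sum>l<d. a i * a l * S $$ (i, l)) = (\<Sum>j<d. \<sigma> j * (g j)\<^sup>2)"
    proof -
      have aq: "dotp d (\<lambda>i. Q $$ (i, j)) a = g j" if "j < d" for j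
      proof -
        have "dotp d (\<lambda>i. Q $$ (i, j)) a = (\<Sum>i<d. \<Sum>l<d. g l * (Q $$ (i, j) * Q $$ (i, l)))"
          by (simp add: dotp_def a_def sum_distrib_left mult_ac)
        also have "\<dots> = (\<Sum>l<d. g l * (\<Sum>i<d. Q $$ (i, j) * Q $$ (i, l)))"
          unfolding sum_distrib_left by (rule sum.swap)
        also have "\<dots> = (\<Sum>l<d. if j = l then g l else 0)"
          using oQ that by (intro sum.cong refl) (auto simp: orthonormal_basis_def)
        finally show ?thesis using that by simp
      qed
      have "(\<Sum>i<d. \<Sum>l<d. a i * a l * S $$ (i, l)) = (\<Sum>i<d. \<Sum>l<d. \<Sum>j<d. \<sigma> j * ((Q $$ (i, j) * a i) * (Q $$ (l, j) * a l)))"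
        unfolding S by (intro sum.cong refl) (simp add: sandwich_diag_index[OF Qc Qc] sum_distrib_left mult_ac)
      also have "\<dots> = (\<Sum>j<d. \<Sum>i<d. \<Sum>l<d. \<sigma> j * ((Q $$ (i, j) * a i) * (Q $$ (l, j) * a l)))" by (rule sum_rotate[symmetric])
      also have "\<dots> = (\<Sum>j<d. \<sigma> j * (dotp d (\<lambda>i. Q $$ (i, j)) a)\<^sup>2)"
        unfolding dotp_def power2_eq_square sum_product by (simp add: sum_distrib_left)
      finally show ?thesis by (simp add: aq)
    qed
    ultimately show "centered_gaussian M (\<lambda>\<omega>. \<Sum>j<d. g j * ?H k \<omega> j) (\<Sum>j<d. \<sigma> j * (g j)\<^sup>2)"
      using gaussian_sample_linear[OF s, of "Suc k" a] k by simp
  qed (use n d \<sigma> in auto)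
qed

section \<open>The bound for one problem, and the theorem\<close>

lemma trace_eigen_sum:
  assumes Q: "orthogonal_matrix_of_dim d Q" and S: "S = Q * mat_diag d \<sigma> * transpose_mat Q"
  shows "sum_list (diag_mat S) = (\<Sum>j<d. \<sigma> j)"
proof -
  have Qc: "Q \<in> carrier_mat d d" using Q by (simp add: orthogonal_matrix_of_dim_def)
  have "sum_list (diag_mat S) = (\<Sum>i<d. S $$ (i, i))"
    using Qc by (simp add: S diag_mat_def sum_list_distinct_conv_sum_set lessThan_atLeast0)
  also have "\<dots> = (\<Sum>i<d. \<Sum>j<d. \<sigma> j * (Q $$ (i, j) * Q $$ (i, j)))"
    unfolding S by (intro sum.cong refl) (simp add: sandwich_diag_index[OF Qc Qc] mult_ac)
  also have "\<dots> = (\<Sum>j<d. \<sigma> j * (\<Sum>i<d. Q $$ (i, j) * Q $$ (i, j)))"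
    unfolding sum_distrib_left by (rule sum.swap)
  also have "\<dots> = (\<Sum>j<d. \<sigma> j)"
    using orthonormal_basis_from_matrix[OF Q] by (intro sum.cong refl) (auto simp: orthonormal_basis_def)
  finally show ?thesis .
qed

lemma rotated_basis:
  assumes q: "orthonormal_basis d q" and p: "orthonormal_basis d p"
  shows "orthonormal_basis d (\<lambda>b j. dotp d (q j) (p b))"
  unfolding orthonormal_basis_def
proof (intro conjI allI impI)
  fix b c assume "b < d" "c < d"
  then show "(\<Sum>j<d. dotp d (q j) (p b) * dotp d (q j) (p c)) = (if b = c then 1 else 0)"
    unfolding parseval_bilinear[OF q] using p by (simp add: orthonormal_basis_def dotp_def)
next
  have comm: "dotp d x y = dotp d y x" for x y by (simp add: dotp_def mult.commute)
  fix j l assume jl: "j < d" "l < d"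
  have "(\<Sum>b<d. dotp d (q j) (p b) * dotp d (q l) (p b)) = (\<Sum>b<d. dotp d (p b) (q j) * dotp d (p b) (q l))"
    by (intro sum.cong refl arg_cong2[of _ _ _ _ "(*)"] comm)
  also have "\<dots> = dotp d (q j) (q l)" by (rule parseval_bilinear[OF p])
  finally show "(\<Sum>b<d. dotp d (q j) (p b) * dotp d (q l) (p b)) = (if j = l then 1 else 0)"
    using q jl by (simp add: orthonormal_basis_def dotp_def)
qed

text \<open>For \<open>x\<close> and \<open>y\<close> in the population eigenbasis this identifies the eigenvectors of the sample
  covariance in the rotated coordinates.\<close>

lemma sample_cov_rotated:
  assumes Qh: "orthogonal_matrix_of_dim d Qh"
    and S: "sample_cov d n Y \<omega> = Qh * mat_diag d \<sigma>' * transpose_mat Qh"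
  shows "(\<Sum>k<n. (\<Sum>i<d. x i * Y (Suc k) \<omega> i) * (\<Sum>l<d. y l * Y (Suc k) \<omega> l)) / n
    = (\<Sum>b<d. \<sigma>' b * dotp d x (\<lambda>i. Qh $$ (i, b)) * dotp d y (\<lambda>i. Qh $$ (i, b)))"
proof -
  have Qc: "Qh \<in> carrier_mat d d" using Qh by (simp add: orthogonal_matrix_of_dim_def)
  have ix: "(\<Sum>k<n. Y (Suc k) \<omega> i * Y (Suc k) \<omega> l) / n = (\<Sum>b<d. Qh $$ (i, b) * \<sigma>' b * Qh $$ (l, b))"
    if "i < d" "l < d" for i l
  proof -
    have "(\<Sum>k<n. Y (Suc k) \<omega> i * Y (Suc k) \<omega> l) = (\<Sum>k=1..n. Y k \<omega> i * Y k \<omega> l)"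
      by (rule sum.reindex_bij_witness[of _ "\<lambda>k. k - 1" Suc]) auto
    then have "(\<Sum>k<n. Y (Suc k) \<omega> i * Y (Suc k) \<omega> l) / n = sample_cov d n Y \<omega> $$ (i, l)"
      using that by (simp add: sample_cov_def)
    also have "\<dots> = (\<Sum>b<d. Qh $$ (i, b) * \<sigma>' b * Qh $$ (l, b))"
      unfolding S by (rule sandwich_diag_index[OF Qc Qc that])
    finally show ?thesis .
  qed
  have "(\<Sum>k<n. (\<Sum>i<d. x i * Y (Suc k) \<omega> i) * (\<Sum>l<d. y l * Y (Suc k) \<omega> l)) / n
     = (\<Sum>k<n. \<Sum>i<d. \<Sum>l<d. x i * y l * (Y (Suc k) \<omega> i * Y (Suc k) \<omega> l) / n)"
    by (simp add: sum_product sum_divide_distrib mult_ac)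
  also have "\<dots> = (\<Sum>i<d. \<Sum>l<d. \<Sum>k<n. x i * y l * (Y (Suc k) \<omega> i * Y (Suc k) \<omega> l) / n)" by (rule sum_rotate)
  also have "\<dots> = (\<Sum>i<d. \<Sum>l<d. x i * y l * ((\<Sum>k<n. Y (Suc k) \<omega> i * Y (Suc k) \<omega> l) / n))"
    by (simp add: sum_distrib_left sum_divide_distrib)
  also have "\<dots> = (\<Sum>i<d. \<Sum>l<d. \<Sum>b<d. \<sigma>' b * (x i * Qh $$ (i, b)) * (y l * Qh $$ (l, b)))"
    by (intro sum.cong refl) (simp add: ix sum_distrib_left mult_ac)
  also have "\<dots> = (\<Sum>b<d. \<Sum>i<d. \<Sum>l<d. \<sigma>' b * (x i * Qh $$ (i, b)) * (y l * Qh $$ (l, b)))" by (rule sum_rotate[symmetric])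
  also have "\<dots> = (\<Sum>b<d. \<sigma>' b * dotp d x (\<lambda>i. Qh $$ (i, b)) * dotp d y (\<lambda>i. Qh $$ (i, b)))"
    by (simp add: dotp_def sum_product sum_distrib_left mult_ac)
  finally show ?thesis .
qed

definition bound_const :: "real \<Rightarrow> real \<Rightarrow> real" where
  "bound_const c\<^sub>1 c\<^sub>2 = sqrt (6400 * c\<^sub>1 + 28800 * c\<^sub>1\<^sup>2 / c\<^sub>2\<^sup>2)"

text \<open>With \<open>s0 \<le> c\<^sub>1 s\<close> the terms for \<open>E v\<^sub>i\<close> and for \<open>sin \<Theta>\<close> contribute \<open>6400 c\<^sub>1\<close> and
  \<open>28800 c\<^sub>1\<^sup>2 / c\<^sub>2\<^sup>2\<close> to the squared constant.\<close>
lemma bound_arith: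
  fixes s s0 V \<mu> S c\<^sub>1 c\<^sub>2 r :: real
  assumes s: "0 < s" "0 \<le> s0" "s0 \<le> c\<^sub>1 * s" and c: "0 < c\<^sub>2" and V: "0 \<le> V" and \<mu>: "0 \<le> \<mu>" and r: "1 \<le> r"
    and S: "(c\<^sub>2 * s / 2)\<^sup>2 * S \<le> r * (400 * (s0 * s0 * \<mu>))"
  shows "V * (16 * (400 * (s0 * \<mu>)) / s\<^sup>2 + 18 * S / s) \<le> (bound_const c\<^sub>1 c\<^sub>2)\<^sup>2 * \<mu> * (V * r\<^sup>2 / s)"
proof -
  have c1: "0 \<le> c\<^sub>1" using s by (meson linorder_not_le mult_neg_pos order_trans not_le)
  have "s0 * s0 \<le> (c\<^sub>1 * s) * (c\<^sub>1 * s)" using s by (intro mult_mono) auto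
  then have "r * (400 * (s0 * s0 * \<mu>)) \<le> r * (400 * ((c\<^sub>1 * s) * (c\<^sub>1 * s) * \<mu>))"
    using r \<mu> by (intro mult_left_mono mult_right_mono) auto
  also have "\<dots> = (c\<^sub>2 * s / 2)\<^sup>2 * (1600 * r * c\<^sub>1\<^sup>2 / c\<^sub>2\<^sup>2 * \<mu>)"
    using c by (simp add: power2_eq_square)
  finally have "(c\<^sub>2 * s / 2)\<^sup>2 * S \<le> (c\<^sub>2 * s / 2)\<^sup>2 * (1600 * r * c\<^sub>1\<^sup>2 / c\<^sub>2\<^sup>2 * \<mu>)"
    using S by linarith
  then have S': "S \<le> 1600 * r * c\<^sub>1\<^sup>2 / c\<^sub>2\<^sup>2 * \<mu>" using s c by (subst (asm) mult_le_cancel_left_pos) auto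
  have r2: "1 \<le> r\<^sup>2" "r \<le> r\<^sup>2" using r by (auto simp: power2_eq_square mult_ge1_I)
  have "16 * (400 * (s0 * \<mu>)) / s\<^sup>2 \<le> 6400 * c\<^sub>1 * \<mu> / s"
  proof -
    have "s0 * \<mu> \<le> c\<^sub>1 * s * \<mu>" using s \<mu> by (intro mult_right_mono) auto
    then have "16 * (400 * (s0 * \<mu>)) / s\<^sup>2 \<le> 16 * (400 * (c\<^sub>1 * s * \<mu>)) / s\<^sup>2"
      using s by (intro divide_right_mono) auto
    also have "\<dots> = 6400 * c\<^sub>1 * \<mu> / s" using s by (simp add: power2_eq_square)
    finally show ?thesis .
  qed
  also have "\<dots> \<le> 6400 * c\<^sub>1 * \<mu> / s * r\<^sup>2"
    using mult_left_mono[OF r2(1), of "6400 * c\<^sub>1 * \<mu> / s"] c1 \<mu> s by simp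
  finally have 1: "16 * (400 * (s0 * \<mu>)) / s\<^sup>2 \<le> 6400 * c\<^sub>1 * \<mu> / s * r\<^sup>2" .
  have "18 * S / s \<le> 18 * (1600 * r * c\<^sub>1\<^sup>2 / c\<^sub>2\<^sup>2 * \<mu>) / s"
    using S' s by (intro divide_right_mono mult_left_mono) auto
  also have "\<dots> = 28800 * c\<^sub>1\<^sup>2 / c\<^sub>2\<^sup>2 * \<mu> / s * r" by simp
  also have "\<dots> \<le> 28800 * c\<^sub>1\<^sup>2 / c\<^sub>2\<^sup>2 * \<mu> / s * r\<^sup>2"
    using r2(2) \<mu> s by (intro mult_left_mono) auto
  finally have 2: "18 * S / s \<le> 28800 * c\<^sub>1\<^sup>2 / c\<^sub>2\<^sup>2 * \<mu> / s * r\<^sup>2" .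
  have "16 * (400 * (s0 * \<mu>)) / s\<^sup>2 + 18 * S / s \<le> (6400 * c\<^sub>1 + 28800 * c\<^sub>1\<^sup>2 / c\<^sub>2\<^sup>2) * \<mu> / s * r\<^sup>2"
    using 1 2 by (simp add: distrib_right add_divide_distrib)
  then have "V * (16 * (400 * (s0 * \<mu>)) / s\<^sup>2 + 18 * S / s) \<le> V * ((6400 * c\<^sub>1 + 28800 * c\<^sub>1\<^sup>2 / c\<^sub>2\<^sup>2) * \<mu> / s * r\<^sup>2)"
    by (rule mult_left_mono[OF _ V])
  also have "\<dots> = (bound_const c\<^sub>1 c\<^sub>2)\<^sup>2 * \<mu> * (V * r\<^sup>2 / s)"
    using c1 by (simp add: bound_const_def)
  finally show ?thesis .
qed

text \<open>One operator norm bound and \<open>v \<le> 2 d\<close> vector bounds fail with probability at most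
  \<open>3 exp (- 8 m) \<le> 3 / d ^ 8\<close> each.\<close>
lemma failure_probability:
  fixes d :: nat and v m :: real
  assumes d: "2 \<le> d" and v: "v \<le> 2 * d" and m: "ln d \<le> m"
  shows "(3 + 3 * v) * exp (- 8 * m) \<le> 1 / real d ^ 2"
proof -
  have "exp (- 8 * m) \<le> exp (- (8 * ln d))" using m by simp
  also have "\<dots> = 1 / real d ^ 8"
    using d exp_of_nat_mult[of 8 "ln (real d)"] by (simp add: exp_minus inverse_eq_divide)
  finally have e: "exp (- 8 * m) \<le> 1 / real d ^ 8" .
  have d2: "2 \<le> real d" using d by simp
  have "3 + 3 * v \<le> 9 * real d" using v d2 by linarith
  also have "\<dots> \<le> real d ^ 5 * real d"
  proof (intro mult_right_mono)
    have "(9::real) \<le> 2 ^ 5" by simp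
    also have "\<dots> \<le> real d ^ 5" using d2 by (intro power_mono) auto
    finally show "9 \<le> real d ^ 5" .
  qed simp
  finally have "3 + 3 * v \<le> real d ^ 6" by (simp add: eval_nat_numeral)
  then have "(3 + 3 * v) * exp (- 8 * m) \<le> real d ^ 6 * (1 / real d ^ 8)"
    using e d2 by (intro mult_mono) auto
  also have "\<dots> = 1 / real d ^ 2" using d2 by (simp add: eval_nat_numeral)
  finally show ?thesis .
qed

text \<open>The tolerance \<open>\<eta>\<close> of the operator norm bound makes \<open>\<eta> \<sigma>\<^sub>1\<close> at most half of the eigenvalue
  gap and at most half of \<open>\<sigma>\<^sub>r\<close>. The good event asks for the vector bound at the \<open>r\<close> leading
  eigenvectors and at the projections of the \<open>d\<close> standard basis vectors.\<close>
lemma sampling_bound: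
  fixes M :: "'a measure" and c\<^sub>1 c\<^sub>2 :: real and d r n :: nat
  defines "\<eta> \<equiv> min c\<^sub>2 1 / (2 * c\<^sub>1)"
  assumes n: "1 \<le> n" and rd: "1 \<le> r" "r < d"
    and sample: "gaussian_sample M d S n Y"
    and U: "leading_singular_vectors d r S U"
    and Uhat: "\<And>\<omega>. \<omega> \<in> space M \<Longrightarrow> leading_singular_vectors d r (sample_cov d n Y \<omega>) (Uhat \<omega>)"
    and W: "\<And>\<omega>. \<omega> \<in> space M \<Longrightarrow> procrustes_matrix r U (Uhat \<omega>) (W \<omega>)"
    and c: "0 < c\<^sub>1" "0 < c\<^sub>2"
    and cond: "sing_val S 1 / sing_val S r \<le> c\<^sub>1"
    and gap: "sv_gap S r \<ge> c\<^sub>2 * sing_val S r"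
    and pos: "0 < sing_val S r"
    and m: "m = max (eff_rank S) (ln (real d))" "m \<le> max_ratio \<eta> * n"
  shows "\<exists>A\<in>sets M. measure M A \<ge> 1 - 1 / real d ^ 2 \<and>
    (\<forall>\<omega>\<in>A. norm_2_inf (Uhat \<omega> - U * W \<omega>)
       \<le> bound_const c\<^sub>1 c\<^sub>2 * sqrt (m / n) * (max_std M d (Y 0) * r / sqrt (sing_val S r)))"
proof -
  define \<sigma> where "\<sigma> j = sing_val S (j + 1)" for j
  define s where "s = sing_val S r"
  have s: "s = \<sigma> (r - 1)" "0 < s" using rd pos by (simp_all add: s_def \<sigma>_def)
  obtain Q where Q: "orthogonal_matrix_of_dim d Q" and Uc: "U \<in> carrier_mat d r"
    and QU: "\<And>i j. i < d \<Longrightarrow> j < r \<Longrightarrow> Q $$ (i, j) = U $$ (i, j)"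
    and S: "S = Q * mat_diag d \<sigma> * transpose_mat Q"
    using leading_singular_vectors_eigenbasis[OF U] rd unfolding \<sigma>_def by (metis less_imp_le)
  have Qc: "Q \<in> carrier_mat d d" using Q by (simp add: orthogonal_matrix_of_dim_def)
  define q where "q j i = Q $$ (i, j)" for j i
  have oq: "orthonormal_basis d q" using orthonormal_basis_from_matrix[OF Q] by (simp add: q_def[abs_def])
  have \<sigma>_nonneg: "0 \<le> \<sigma> j" if "j < d" for j
    unfolding \<sigma>_def by (rule sing_val_properties(1)[OF Q Q S[unfolded \<sigma>_def] that])
  have \<sigma>_anti: "\<sigma> j \<le> \<sigma> i" if "i \<le> j" "j < d" for i j
    unfolding \<sigma>_def by (rule sing_val_properties(2)[OF Q Q S[unfolded \<sigma>_def] that])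
  have s_top: "s \<le> \<sigma> 0" using s(1) \<sigma>_anti[of 0 "r - 1"] rd by simp
  have top: "0 < \<sigma> 0" using s_top s(2) by linarith
  have sv1: "sing_val S 1 = \<sigma> 0" by (simp add: \<sigma>_def)
  have "\<sigma> 0 / s \<le> c\<^sub>1" using cond unfolding sv1 s_def .
  then have cond': "\<sigma> 0 \<le> c\<^sub>1 * s" using s(2) by (simp add: pos_divide_le_eq)
  have c1: "1 \<le> c\<^sub>1" using order_trans[OF s_top cond'] s(2) by simp
  have gap': "c\<^sub>2 * s \<le> s - \<sigma> r" using gap by (simp add: sv_gap_def s_def \<sigma>_def)
  have \<eta>: "0 < \<eta>" "\<eta> \<le> 1"
  proof -
    show "0 < \<eta>" using c by (simp add: \<eta>_def)
    have "min c\<^sub>2 1 \<le> 1 * (2 * c\<^sub>1)" using c1 by linarith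
    then show "\<eta> \<le> 1" unfolding \<eta>_def using c1 by (subst pos_divide_le_eq) auto
  qed
  have \<eta>_top: "\<eta> * \<sigma> 0 \<le> min c\<^sub>2 1 * s / 2"
  proof -
    have "\<eta> * \<sigma> 0 \<le> \<eta> * (c\<^sub>1 * s)" using \<eta> cond' by (intro mult_left_mono) auto
    also have "\<dots> = min c\<^sub>2 1 * s / 2" using c by (simp add: \<eta>_def)
    finally show ?thesis .
  qed
  define H where "H = (\<lambda>k \<omega>. \<lambda>j\<in>{..<d}. \<Sum>i<d. Q $$ (i, j) * Y (Suc k) \<omega> i)"
  have ges: "gaussian_eigen_sample M d n \<sigma> H"
    unfolding H_def by (rule gaussian_sample_eigen[OF sample _ _ Q S]) (use n rd \<sigma>_nonneg \<sigma>_anti top in auto)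
  interpret E: gaussian_eigen_sample M d n \<sigma> H by (rule ges)
  have "0 \<le> ln (real d)" using rd by (intro ln_ge_zero) auto
  then have m0: "0 \<le> m" using m(1) by (simp add: le_max_iff_disj)
  have es: "E.eigen_sum \<le> m * \<sigma> 0"
  proof -
    have "eff_rank S = E.eigen_sum / \<sigma> 0"
      unfolding eff_rank_def sv1 E.eigen_sum_def trace_eigen_sum[OF Q S] ..
    then have "E.eigen_sum / \<sigma> 0 \<le> m" using m(1) by simp
    then show ?thesis using top by (simp add: pos_divide_le_eq)
  qed
  define \<nu> where "\<nu> = max_std M d (Y 0)"
  define y where "y i j = Q $$ (i, j)" for i j
  have pv: "E.popvar (y i) \<le> \<nu>\<^sup>2" and \<nu>0: "0 \<le> \<nu>" if i: "i < d" for i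
  proof -
    let ?v = "E.variance (\<lambda>\<omega>. Y 0 \<omega> i)"
    have "sqrt ?v \<le> \<nu>" unfolding \<nu>_def max_std_def using i by (intro Max_ge) auto
    moreover have "0 \<le> ?v" by simp
    ultimately show "0 \<le> \<nu>" by (meson order_trans real_sqrt_ge_zero)
    have "E.popvar (y i) = S $$ (i, i)"
      unfolding S E.popvar_def sandwich_diag_index[OF Qc Qc i i] by (simp add: y_def power2_eq_square mult_ac)
    also have "\<dots> = ?v"
      using sample i by (auto simp: gaussian_sample_def covariance_matrix_def power2_eq_square)
    also have "\<dots> \<le> \<nu>\<^sup>2" using \<open>sqrt ?v \<le> \<nu>\<close> \<open>0 \<le> ?v\<close> by (metis real_sqrt_ge_zero real_sqrt_pow2 power_mono)
    finally show "E.popvar (y i) \<le> \<nu>\<^sup>2" .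
  qed
  \<comment> \<open>The leading eigenvectors and the projections of the standard basis vectors, in coordinates.\<close>
  define V where "V = (\<lambda>a j. if j = a then 1 else 0 :: real) ` {..<r} \<union> (\<lambda>i. E.tail_part r (y i)) ` {..<d}"
  have Vfin: "finite V" by (simp add: V_def)
  have Vcard: "real (card V) \<le> 2 * d"
  proof -
    have "card V \<le> card ((\<lambda>a j. if j = a then 1 else 0 :: real) ` {..<r}) + card ((\<lambda>i. E.tail_part r (y i)) ` {..<d})"
      unfolding V_def by (rule card_Un_le)
    also have "\<dots> \<le> r + d" using card_image_le[of "{..<r}"] card_image_le[of "{..<d}"] by (intro add_mono) auto
    finally show ?thesis using rd by linarith
  qed
  obtain N where N: "N \<in> sets M" "E.prob N \<le> (3 + 3 * real (card V)) * exp (- 8 * m)"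
    and good: "\<And>\<omega> x. \<omega> \<in> space M - N \<Longrightarrow> \<bar>(\<Sum>k<n. (E.lin x k \<omega>)\<^sup>2) / n - E.popvar x\<bar> \<le> \<eta> * \<sigma> 0 * sqnorm d x"
    and goodV: "\<And>\<omega> v. \<omega> \<in> space M - N \<Longrightarrow> v \<in> V \<Longrightarrow> sqnorm d (E.cov_err v \<omega>) \<le> 400 * (E.popvar v * \<sigma> 0 * (m / n))"
    using E.good_event[OF \<eta> m0 es m(2) Vfin] unfolding E.holds_except_def by blast
  have "E.prob N \<le> 1 / real d ^ 2"
    using N(2) failure_probability[of d "card V" m] Vcard m(1) rd by linarith
  then have prob: "measure M (space M - N) \<ge> 1 - 1 / real d ^ 2"
    using E.prob_compl[OF N(1)] by simp
  have "norm_2_inf (Uhat \<omega> - U * W \<omega>) \<le> bound_const c\<^sub>1 c\<^sub>2 * sqrt (m / n) * (\<nu> * r / sqrt s)"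
    if \<omega>: "\<omega> \<in> space M - N" for \<omega>
  proof -
    let ?Sh = "sample_cov d n Y \<omega>"
    define \<sigma>' where "\<sigma>' j = sing_val ?Sh (j + 1)" for j
    have \<omega>M: "\<omega> \<in> space M" using \<omega> by simp
    obtain Qh where Qh: "orthogonal_matrix_of_dim d Qh" and Uhc: "Uhat \<omega> \<in> carrier_mat d r"
      and QUh: "\<And>i j. i < d \<Longrightarrow> j < r \<Longrightarrow> Qh $$ (i, j) = Uhat \<omega> $$ (i, j)"
      and Sh: "?Sh = Qh * mat_diag d \<sigma>' * transpose_mat Qh"
      using leading_singular_vectors_eigenbasis[OF Uhat[OF \<omega>M]] rd unfolding \<sigma>'_def by (metis less_imp_le)
    define p where "p b i = Qh $$ (i, b)" for b i
    have op: "orthonormal_basis d p" using orthonormal_basis_from_matrix[OF Qh] by (simp add: p_def[abs_def])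
    have \<sigma>'_anti: "\<sigma>' j \<le> \<sigma>' i" if "i \<le> j" "j < d" for i j
      unfolding \<sigma>'_def by (rule sing_val_properties(2)[OF Qh Qh Sh[unfolded \<sigma>'_def] that])
    define z where "z b j = dotp d (q j) (p b)" for b j
    have oz: "orthonormal_basis d z" using rotated_basis[OF oq op] by (simp add: z_def[abs_def])
    define G where "G j l = (\<Sum>k<n. H k \<omega> j * H k \<omega> l) / n" for j l
    have G: "G j l = (\<Sum>b<d. \<sigma>' b * z b j * z b l)" if "j < d" "l < d" for j l
      using sample_cov_rotated[OF Qh Sh, of "q j" "q l"] that by (simp add: G_def H_def q_def z_def p_def[abs_def])
    interpret P: perturbed_diagonal d r \<sigma> \<sigma>' z G
      by unfold_locales (use rd \<sigma>_nonneg \<sigma>_anti \<sigma>'_anti oz G in auto)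
    have err: "P.err v = E.cov_err v \<omega>" for v
    proof
      fix j
      have "(\<Sum>l<d. G j l * v l) = (\<Sum>l<d. \<Sum>k<n. H k \<omega> j * H k \<omega> l * v l / n)"
        by (simp add: G_def sum_distrib_right sum_divide_distrib)
      also have "\<dots> = (\<Sum>k<n. \<Sum>l<d. H k \<omega> j * H k \<omega> l * v l / n)" by (rule sum.swap)
      also have "\<dots> = (\<Sum>k<n. E.lin v k \<omega> * H k \<omega> j) / n"
        by (simp add: E.lin_def sum_distrib_left sum_distrib_right sum_divide_distrib mult_ac)
      finally show "P.err v j = E.cov_err v \<omega> j" by (simp add: P.err_def E.cov_err_def)
    qed
    have form: "bilin d G x x = (\<Sum>k<n. (E.lin x k \<omega>)\<^sup>2) / n" for x
    proof -
      have "bilin d G x x = (\<Sum>i<d. \<Sum>j<d. \<Sum>k<n. (x i * H k \<omega> i) * (x j * H k \<omega> j) / n)"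
        unfolding bilin_def G_def by (simp add: sum_distrib_left sum_distrib_right sum_divide_distrib mult_ac)
      also have "\<dots> = (\<Sum>k<n. \<Sum>i<d. \<Sum>j<d. (x i * H k \<omega> i) * (x j * H k \<omega> j) / n)" by (rule sum_rotate[symmetric])
      also have "\<dots> = (\<Sum>k<n. (E.lin x k \<omega>)\<^sup>2) / n"
        by (simp add: E.lin_def power2_eq_square sum_product sum_divide_distrib)
      finally show ?thesis .
    qed
    have op_err: "\<bar>bilin d G x x - (\<Sum>j<d. \<sigma> j * (x j)\<^sup>2)\<bar> \<le> \<eta> * \<sigma> 0 * sqnorm d x" for x
      using good[OF \<omega>, of x] unfolding form E.popvar_def .
    note close = P.eigenvalues_close[OF op_err]
    have half: "\<eta> * \<sigma> 0 \<le> s / 2" and half2: "\<eta> * \<sigma> 0 \<le> c\<^sub>2 * s / 2"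
    proof -
      have "min c\<^sub>2 1 * s \<le> 1 * s" "min c\<^sub>2 1 * s \<le> c\<^sub>2 * s" using s(2) by (intro mult_right_mono; simp)+
      then show "\<eta> * \<sigma> 0 \<le> s / 2" "\<eta> * \<sigma> 0 \<le> c\<^sub>2 * s / 2" using \<eta>_top by linarith+
    qed
    have low: "s / 2 \<le> \<sigma>' b" if "b < r" for b
    proof -
      have "r - 1 < d" "b \<le> r - 1" using that rd by auto
      then have "\<sigma> (r - 1) \<le> \<sigma>' (r - 1) + \<eta> * \<sigma> 0" "\<sigma>' (r - 1) \<le> \<sigma>' b" using close(2) \<sigma>'_anti by auto
      then show ?thesis using half s(1) by linarith
    qed
    have sep: "c\<^sub>2 * s / 2 \<le> \<sigma> a - \<sigma>' b" if "a < r" "r \<le> b" "b < d" for a b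
    proof -
      have "s \<le> \<sigma> a" using s(1) \<sigma>_anti[of a "r - 1"] that rd by simp
      moreover have "\<sigma>' b \<le> \<sigma>' r" using \<sigma>'_anti that by simp
      moreover have "\<sigma>' r \<le> \<sigma> r + \<eta> * \<sigma> 0" using close(1) rd by simp
      ultimately show ?thesis using gap' half2 by linarith
    qed
    have dk: "(c\<^sub>2 * s / 2)\<^sup>2 * P.sin_sq \<le> r * (400 * (\<sigma> 0 * \<sigma> 0 * (m / n)))"
    proof (rule P.davis_kahan)
      show "0 < c\<^sub>2 * s / 2" using c s by simp
      fix a assume a: "a < r"
      let ?e = "\<lambda>j. if j = a then 1 else 0 :: real"
      have "?e \<in> V" using a by (auto simp: V_def)
      moreover have "E.popvar ?e = \<sigma> a"
        using a rd by (simp add: E.popvar_def if_distrib[of "\<lambda>x. _ * x"] if_distrib[of "\<lambda>x. x ^ _"] cong: if_cong)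
      ultimately have "sqnorm d (P.err ?e) \<le> 400 * (\<sigma> a * \<sigma> 0 * (m / n))" using goodV[OF \<omega>, of ?e] by (simp add: err)
      also have "\<dots> \<le> 400 * (\<sigma> 0 * \<sigma> 0 * (m / n))"
        using \<sigma>_anti[of 0 a] a rd top m0 by (intro mult_left_mono mult_right_mono) auto
      finally show "sqnorm d (P.err ?e) \<le> 400 * (\<sigma> 0 * \<sigma> 0 * (m / n))" .
    qed (rule sep)
    have Csum: "z b a = (\<Sum>i<d. U $$ (i, a) * Uhat \<omega> $$ (i, b))" if "a < r" "b < r" for a b
      using that QU QUh by (simp add: z_def dotp_def q_def p_def)
    have oU: "(\<Sum>i<d. U $$ (i, a) * U $$ (i, b)) = (if a = b then 1 else 0)" if "a < r" "b < r" for a b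
    proof -
      have "(\<Sum>i<d. U $$ (i, a) * U $$ (i, b)) = (\<Sum>i<d. q a i * q b i)"
        using that by (intro sum.cong refl) (simp add: q_def QU)
      then show ?thesis using oq that rd by (simp add: orthonormal_basis_def)
    qed
    have oUh: "(\<Sum>i<d. Uhat \<omega> $$ (i, a) * Uhat \<omega> $$ (i, b)) = (if a = b then 1 else 0)" if "a < r" "b < r" for a b
    proof -
      have "(\<Sum>i<d. Uhat \<omega> $$ (i, a) * Uhat \<omega> $$ (i, b)) = (\<Sum>i<d. p a i * p b i)"
        using that by (intro sum.cong refl) (simp add: p_def QUh)
      then show ?thesis using op that rd by (simp add: orthonormal_basis_def)
    qed
    note mis = procrustes_misfit[OF W[OF \<omega>M] Uc Uhc oU oUh]
    have Wfit: "(\<Sum>a<r. \<Sum>b<r. (z b a - W \<omega> $$ (a, b))\<^sup>2) \<le> P.sin_sq"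
      using mis(2) by (simp add: P.sin_sq_def block_mass(1)[OF oz] less_imp_le[OF rd(2)] Csum)
    define B where "B = bound_const c\<^sub>1 c\<^sub>2 * sqrt (m / n) * (\<nu> * r / sqrt s)"
    have "norm_2_inf (Uhat \<omega> - U * W \<omega>) \<le> B"
    proof (rule norm_2_inf_le)
      show "Uhat \<omega> - U * W \<omega> \<in> carrier_mat d r" using Uhc Uc mis(1) by auto
      show "0 < d" "0 < r" using rd by auto
      show "0 \<le> B" using c m0 \<nu>0[of 0] rd s(2) unfolding B_def bound_const_def
        by (intro mult_nonneg_nonneg divide_nonneg_nonneg real_sqrt_ge_zero add_nonneg_nonneg) auto
      fix i assume i: "i < d"
      have yz: "(\<Sum>j<d. y i j * z b j) = Uhat \<omega> $$ (i, b)" if "b < r" for b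
      proof -
        have "(\<Sum>j<d. y i j * z b j) = (\<Sum>j<d. dotp d (q j) (\<lambda>l. if i = l then 1 else 0) * dotp d (q j) (p b))"
          using i by (intro sum.cong refl) (simp add: y_def z_def q_def dotp_def if_distrib[of "\<lambda>x. _ * x"] cong: if_cong)
        also have "\<dots> = p b i" unfolding parseval_bilinear[OF oq] by (rule dotp_std[OF i])
        finally show ?thesis using QUh[OF i that] by (simp add: p_def)
      qed
      have row: "(Uhat \<omega> - U * W \<omega>) $$ (i, b) = (\<Sum>j<d. y i j * z b j) - (\<Sum>j<r. y i j * W \<omega> $$ (j, b))" if "b < r" for b
      proof -
        have "(Uhat \<omega> - U * W \<omega>) $$ (i, b) = Uhat \<omega> $$ (i, b) - (\<Sum>j<r. U $$ (i, j) * W \<omega> $$ (j, b))"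
          using i that Uc Uhc mis(1) by (simp add: scalar_prod_def lessThan_atLeast0)
        moreover have "(\<Sum>j<r. U $$ (i, j) * W \<omega> $$ (j, b)) = (\<Sum>j<r. y i j * W \<omega> $$ (j, b))"
          using i by (intro sum.cong refl) (simp add: y_def QU)
        ultimately show ?thesis by (simp only: yz[OF that])
      qed
      have tail: "E.tail_part r (y i) = (\<lambda>j. if r \<le> j then y i j else 0)" by (simp add: E.tail_part_def[abs_def])
      have pt: "E.popvar (E.tail_part r (y i)) \<le> \<nu>\<^sup>2"
        using E.popvar_head_tail[of "y i" r] E.popvar_nonneg[of "E.head_part r (y i)"] pv[OF i] by linarith
      have "sqnorm d (P.err (E.tail_part r (y i))) \<le> 400 * (E.popvar (E.tail_part r (y i)) * \<sigma> 0 * (m / n))"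
        unfolding err using i by (intro goodV[OF \<omega>]) (auto simp: V_def)
      also have "\<dots> \<le> 400 * (\<nu>\<^sup>2 * \<sigma> 0 * (m / n))"
        using pt top m0 by (intro mult_left_mono mult_right_mono) auto
      finally have tail_err: "sqnorm d (P.err (\<lambda>j. if r \<le> j then y i j else 0)) \<le> 400 * (\<sigma> 0 * (m / n)) * \<nu>\<^sup>2"
        by (simp add: tail mult_ac)
      have "(\<Sum>b<r. ((Uhat \<omega> - U * W \<omega>) $$ (i, b))\<^sup>2)
          = (\<Sum>b<r. ((\<Sum>j<d. y i j * z b j) - (\<Sum>j<r. y i j * W \<omega> $$ (j, b)))\<^sup>2)"
        by (intro sum.cong refl) (simp add: row)
      also have "\<dots> \<le> \<nu>\<^sup>2 * (16 * (400 * (\<sigma> 0 * (m / n))) / s\<^sup>2 + 18 * P.sin_sq / s)"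
        by (rule P.row_bound[OF s(2) s(1) low pv[OF i, unfolded E.popvar_def] tail_err Wfit])
      also have "\<dots> \<le> (bound_const c\<^sub>1 c\<^sub>2)\<^sup>2 * (m / n) * (\<nu>\<^sup>2 * (real r)\<^sup>2 / s)"
        by (rule bound_arith[OF s(2) _ cond' c(2) _ _ _ dk]) (use top m0 rd in auto)
      also have "\<dots> = B\<^sup>2" using m0 s(2) by (simp add: B_def power_mult_distrib power_divide)
      finally show "(\<Sum>b<r. ((Uhat \<omega> - U * W \<omega>) $$ (i, b))\<^sup>2) \<le> B\<^sup>2" .
    qed
    then show ?thesis by (simp add: B_def)
  qed
  then show ?thesis using prob N(1) by (intro bexI[of _ "space M - N"]) (auto simp: \<nu>_def s_def)
qed

theorem theorem1p1:
  fixes M :: "nat \<Rightarrow> 'a measure"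
    and d r :: "nat \<Rightarrow> nat"
    and \<Gamma> U :: "nat \<Rightarrow> real mat"
    and Y :: "nat \<Rightarrow> nat \<Rightarrow> 'a \<Rightarrow> nat \<Rightarrow> real"
    and Uhat W :: "nat \<Rightarrow> 'a \<Rightarrow> real mat"
    and c\<^sub>1 c\<^sub>2 c\<^sub>3 :: real
  assumes rank: "\<And>n. n \<ge> 1 \<Longrightarrow> 1 \<le> r n \<and> r n < d n"
    and rank_small: "(\<lambda>n. real (r n) / real (d n)) \<longlonglongrightarrow> 0"
    and sample: "\<And>n. n \<ge> 1 \<Longrightarrow> gaussian_sample (M n) (d n) (\<Gamma> n) n (Y n)"
    and U: "\<And>n. n \<ge> 1 \<Longrightarrow> leading_singular_vectors (d n) (r n) (\<Gamma> n) (U n)"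
    and Uhat: "\<And>n \<omega>. n \<ge> 1 \<Longrightarrow> \<omega> \<in> space (M n) \<Longrightarrow>
        leading_singular_vectors (d n) (r n) (sample_cov (d n) n (Y n) \<omega>) (Uhat n \<omega>)"
    and W: "\<And>n \<omega>. n \<ge> 1 \<Longrightarrow> \<omega> \<in> space (M n) \<Longrightarrow>
        procrustes_matrix (r n) (U n) (Uhat n \<omega>) (W n \<omega>)"
    and growth: "(\<lambda>n. max (eff_rank (\<Gamma> n)) (ln (real (d n)))) \<in> o(\<lambda>n. real n)"
    and c_pos: "c\<^sub>1 > 0" "c\<^sub>2 > 0" "c\<^sub>3 > 0"
    and cond: "\<And>n. n \<ge> 1 \<Longrightarrow> sing_val (\<Gamma> n) 1 / sing_val (\<Gamma> n) (r n) \<le> c\<^sub>1"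
    and gap: "\<And>n. n \<ge> 1 \<Longrightarrow> sv_gap (\<Gamma> n) (r n) \<ge> c\<^sub>2 * sing_val (\<Gamma> n) (r n)"
    and pos: "\<And>n. n \<ge> 1 \<Longrightarrow> c\<^sub>2 * sing_val (\<Gamma> n) (r n) > 0"
    and incoherence: "\<And>n. n \<ge> 1 \<Longrightarrow> norm_2_inf (U n) \<le> c\<^sub>3 * sqrt (real (r n) / real (d n))"
  shows "\<exists>C>0. \<forall>\<^sub>F n in sequentially.
    \<exists>A \<in> sets (M n). measure (M n) A \<ge> 1 - 1 / real (d n) ^ 2 \<and>
      (\<forall>\<omega>\<in>A.
        norm_2_inf (Uhat n \<omega> - U n * W n \<omega>)
        \<le> C * sqrt (max (eff_rank (\<Gamma> n)) (ln (real (d n))) / real n)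
             * (max_std (M n) (d n) (Y n 0) * real (r n) / sqrt (sing_val (\<Gamma> n) (r n))
                + sing_val (\<Gamma> n) (r n + 1) / sing_val (\<Gamma> n) (r n))
          + C * (max (eff_rank (\<Gamma> n)) (ln (real (d n))) / real n)
             * (sqrt (sing_val (\<Gamma> n) (r n + 1) / sing_val (\<Gamma> n) (r n))
                + sqrt (real (r n) / real (d n))))"
proof -
  \<comment> \<open>The condition number is at least \<open>1\<close>; the maximum makes \<open>\<eta> \<le> 1\<close> evident.\<close>
  define \<eta> where "\<eta> = min c\<^sub>2 1 / (2 * max c\<^sub>1 1)"
  define C where "C = bound_const (max c\<^sub>1 1) c\<^sub>2"
  have C: "0 < C"
    unfolding C_def bound_const_def by (intro real_sqrt_gt_zero add_pos_nonneg) auto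
  have \<eta>: "0 < \<eta>" "\<eta> \<le> 1"
  proof -
    show "0 < \<eta>" using c_pos by (simp add: \<eta>_def)
    have "min c\<^sub>2 1 \<le> 1 * (2 * max c\<^sub>1 1)" by linarith
    then show "\<eta> \<le> 1" unfolding \<eta>_def by (subst pos_divide_le_eq) auto
  qed
  let ?m = "\<lambda>n. max (eff_rank (\<Gamma> n)) (ln (real (d n)))"
  have "\<forall>\<^sub>F n in sequentially. norm (?m n) \<le> max_ratio \<eta> * norm (real n)"
    by (rule landau_o.smallD[OF growth max_ratio_bounds(1)[OF \<eta>]])
  then have small: "\<forall>\<^sub>F n in sequentially. ?m n \<le> max_ratio \<eta> * n \<and> n \<ge> 1"
    using eventually_ge_at_top[of "1::nat"] by eventually_elim auto
  have "\<forall>\<^sub>F n in sequentially.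
    \<exists>A \<in> sets (M n). measure (M n) A \<ge> 1 - 1 / real (d n) ^ 2 \<and>
      (\<forall>\<omega>\<in>A. norm_2_inf (Uhat n \<omega> - U n * W n \<omega>)
        \<le> C * sqrt (?m n / real n)
             * (max_std (M n) (d n) (Y n 0) * real (r n) / sqrt (sing_val (\<Gamma> n) (r n))
                + sing_val (\<Gamma> n) (r n + 1) / sing_val (\<Gamma> n) (r n))
          + C * (?m n / real n)
             * (sqrt (sing_val (\<Gamma> n) (r n + 1) / sing_val (\<Gamma> n) (r n))
                + sqrt (real (r n) / real (d n))))"
    using small
  proof eventually_elim
    case (elim n)
    then have n: "n \<ge> 1" and m: "?m n \<le> max_ratio \<eta> * n" by auto
    have s: "0 < sing_val (\<Gamma> n) (r n)" using pos[OF n] c_pos by (simp add: zero_less_mult_iff)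
    have "0 \<le> ln (real (d n))" using rank[OF n] by (intro ln_ge_zero) auto
    then have mm: "0 \<le> ?m n" by (simp add: le_max_iff_disj)
    have next_sv: "0 \<le> sing_val (\<Gamma> n) (r n + 1)"
    proof -
      obtain Q where "orthogonal_matrix_of_dim (d n) Q"
        "\<Gamma> n = Q * mat_diag (d n) (\<lambda>i. sing_val (\<Gamma> n) (i + 1)) * transpose_mat Q"
        using leading_singular_vectors_eigenbasis[OF U[OF n]] rank[OF n] by (metis less_imp_le)
      then show ?thesis using sing_val_properties(1) rank[OF n] by blast
    qed
    have c1: "sing_val (\<Gamma> n) 1 / sing_val (\<Gamma> n) (r n) \<le> max c\<^sub>1 1" "0 < max c\<^sub>1 1" using cond[OF n] by auto
    obtain A where A: "A \<in> sets (M n)" "measure (M n) A \<ge> 1 - 1 / real (d n) ^ 2"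
      "\<And>\<omega>. \<omega> \<in> A \<Longrightarrow> norm_2_inf (Uhat n \<omega> - U n * W n \<omega>)
        \<le> C * sqrt (?m n / n) * (max_std (M n) (d n) (Y n 0) * r n / sqrt (sing_val (\<Gamma> n) (r n)))"
      using sampling_bound[OF n _ _ sample[OF n] U[OF n] Uhat[OF n] W[OF n] c1(2) c_pos(2) c1(1) gap[OF n] s refl m[unfolded \<eta>_def]]
        rank[OF n] unfolding C_def by blast
    have "C * sqrt (?m n / n) * (max_std (M n) (d n) (Y n 0) * r n / sqrt (sing_val (\<Gamma> n) (r n)))
      \<le> C * sqrt (?m n / real n)
             * (max_std (M n) (d n) (Y n 0) * real (r n) / sqrt (sing_val (\<Gamma> n) (r n))
                + sing_val (\<Gamma> n) (r n + 1) / sing_val (\<Gamma> n) (r n))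
          + C * (?m n / real n)
             * (sqrt (sing_val (\<Gamma> n) (r n + 1) / sing_val (\<Gamma> n) (r n))
                + sqrt (real (r n) / real (d n)))"
    proof -
      have "0 \<le> C * sqrt (?m n / n) * (sing_val (\<Gamma> n) (r n + 1) / sing_val (\<Gamma> n) (r n))"
        using C mm s next_sv by (intro mult_nonneg_nonneg divide_nonneg_nonneg real_sqrt_ge_zero) auto
      moreover have "0 \<le> C * (?m n / real n) * (sqrt (sing_val (\<Gamma> n) (r n + 1) / sing_val (\<Gamma> n) (r n)) + sqrt (real (r n) / real (d n)))"
        using C mm s next_sv by (intro mult_nonneg_nonneg add_nonneg_nonneg divide_nonneg_nonneg real_sqrt_ge_zero) auto
      ultimately show ?thesis unfolding distrib_left[of "C * sqrt (?m n / n)"] by linarith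
    qed
    then show ?case using A by (intro bexI[OF _ A(1)]) (auto intro: order_trans)
  qed
  then show ?thesis using C by blast
qed

end
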